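(* Every formal power series $f \in \mathbb{C}[[x, y]]$ is formally right equivalent to a formal power series $g \in \mathbb{C}[[x, y]]$ which is normalised with respect to each compact facet of its Newton polyhedron. If $f \in \mathbb{C}\{x, y\}$ defines an isolated singularity, then there exists a right equivalence between $f$ and a polynomial $g \in \mathbb{C}[x, y]$ which is normalised with respect to each compact facet of its Newton polyhedron.
   Context: $\mathbb{C}\{x,y\}$ is the $\mathbb{C}$-algebra of power series absolutely convergent in a neighbourhood of the origin. "Isolated singularity" refers to the germ of $V(f)$ at the origin. Right equivalence: $f, g \in \mathbb{C}[[x,y]]$ are formally right equivalent if there is a $\mathbb{C}$-algebra isomorphism $\Phi$ of $\mathbb{C}[[x,y]]$ with $\Phi(f) = g$. $f, g \in \mathbb{C}\{x,y\}$ are right equivalent if there is a $\mathbb{C}$-algebra isomorphism $\Phi$ of $\mathbb{C}\{x,y\}$ with $\Phi(f) = g$; such a $\Phi$ is a right equivalence. Newton polyhedron: for $f \in \mathbb{C}[[x,y]]$, it is the convex hull in $\mathbb{R}^2$ of the union of the sets $(i,j) + (\mathbb{R}_{\geq 0})^2$ over all non-negative integers $i,j$ such that $x^i y^j$ has a non-zero coefficient in $f$. A facet is a face of codimension $1$. Leading term: for $\mathbf{w} = (w_x,w_y)$ non-negative, not both zero, and $f = \sum a_{i,j} x^i y^j \neq 0$, the weight $\operatorname{wt}_{\mathbf{w}}(f)$ is the minimum of $i w_x + j w_y$ over all $(i,j)$ with $a_{i,j} \neq 0$. The leading term $f_{\mathbf{w}}$ is the sum of the terms $a_{i,j} x^i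 y^j$ with $i w_x + j w_y = \operatorname{wt}_{\mathbf{w}}(f)$. The saturation $\operatorname{sat}(f)$ is $f/(x^{a} y^{b})$ with $a,b \in \mathbb{Z}_{\geq 0}$ as large as possible. Normalised: let $f \in \mathbb{C}[[x,y]]$ be non-zero and let $\Delta$ be a facet of its Newton polyhedron. Let $\mathbf{w} = (w_x,w_y)$ be the unique pair of non-negative integers with $\gcd(w_x,w_y)=1$ that is a normal vector of $\Delta$. Let $a, b$ be the greatest non-negative integers such that $f_{\mathbf{w}}/(x^a y^b)$ is a power series. Let $d$ be the greatest non-negative integer such that the $d$-th power of an irreducible power series divides $\operatorname{sat}(f_{\mathbf{w}})$. Then $f$ is normalised with respect to $\Delta$ if one of the following holds: (1) $w_x = 0$ or $w_y = 0$; (2) $w_x = 1$ and $w_y = 1$ and $d \leq \min(a,b)$; (3) $w_x = 1$ and $w_y > 1$ and $d \leq b$; (4) $w_x > 1$ and $w_y = 1$ and $d \leq a$; (5) $w_x > 1$ and $w_y > 1$. (The zero power series has empty Newton polyhedron, hence no facets.) *)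

theory Defs
  imports
    "HOL-Analysis.Analysis"
    "HOL-Computational_Algebra.Computational_Algebra"
begin

text \<open>The ring of formal power series in \<open>x, y\<close> is realised as \<open>\<complex>[[x]][[y]]\<close>:
  the inner variable is \<open>x\<close>, the outer one is \<open>y\<close>.\<close>

type_synonym series2 = "complex fps fps"

definition coeff2 :: "series2 \<Rightarrow> nat \<Rightarrow> nat \<Rightarrow> complex" where
  "coeff2 f i j = fps_nth (fps_nth f j) i"

definition series_of_coeffs :: "(nat \<Rightarrow> nat \<Rightarrow> complex) \<Rightarrow> series2" where
  "series_of_coeffs a = Abs_fps (\<lambda>j. Abs_fps (\<lambda>i. a i j))"

definition const2 :: "complex \<Rightarrow> series2" where
  "const2 c = fps_const (fps_const c)"

definition X2 :: series2 where
  "X2 = fps_const fps_X"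

definition Y2 :: series2 where
  "Y2 = fps_X"

definition series_of_poly :: "complex poly poly \<Rightarrow> series2" where
  "series_of_poly p = fps_of_poly (map_poly fps_of_poly p)"


subsection \<open>Convergent power series and isolated singularities\<close>

definition convergent_series :: "series2 set" where
  "convergent_series = {f. \<forall>\<^sub>F (x, y) in nhds (0, 0).
     (\<lambda>(i, j). norm (coeff2 f i j * x ^ i * y ^ j)) summable_on UNIV}"

definition eval2 :: "series2 \<Rightarrow> complex \<times> complex \<Rightarrow> complex" where
  "eval2 f = (\<lambda>(x, y). \<Sum>\<^sub>\<infinity>(i, j)\<in>UNIV. coeff2 f i j * x ^ i * y ^ j)"

definition deriv_x :: "series2 \<Rightarrow> series2" where
  "deriv_x f = series_of_coeffs (\<lambda>i j. of_nat (Suc i) * coeff2 f (Suc i) j)"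

definition deriv_y :: "series2 \<Rightarrow> series2" where
  "deriv_y f = series_of_coeffs (\<lambda>i j. of_nat (Suc j) * coeff2 f i (Suc j))"

text \<open>Singular points of \<open>V(f)\<close> are those of the complex space defined by \<open>f\<close> (not of its
  reduction), so all points of a multiple component are singular.\<close>

definition singular_point :: "series2 \<Rightarrow> complex \<times> complex \<Rightarrow> bool" where
  "singular_point f z \<longleftrightarrow>
     eval2 f z = 0 \<and> eval2 (deriv_x f) z = 0 \<and> eval2 (deriv_y f) z = 0"

text \<open>The origin lies on \<open>V(f)\<close>, and a punctured neighbourhood of it contains no singular point.
  As in the usual convention for germs, \<open>V(f)\<close> may also be smooth at the origin.
  Meaningful for convergent \<open>f\<close> only.\<close>

definition isolated_singularity :: "series2 \<Rightarrow> bool" where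
  "isolated_singularity f \<longleftrightarrow>
     eval2 f (0, 0) = 0 \<and> (\<forall>\<^sub>F z in at (0, 0). \<not> singular_point f z)"


subsection \<open>Right equivalence\<close>

text \<open>\<open>A\<close> stands for a \<open>\<complex>\<close>-subalgebra of the ring of formal power series; values of \<open>\<Phi>\<close> outside
  \<open>A\<close> are irrelevant.\<close>

definition algebra_automorphism :: "series2 set \<Rightarrow> (series2 \<Rightarrow> series2) \<Rightarrow> bool" where
  "algebra_automorphism A \<Phi> \<longleftrightarrow>
     bij_betw \<Phi> A A \<and>
     (\<forall>p\<in>A. \<forall>q\<in>A. \<Phi> (p + q) = \<Phi> p + \<Phi> q) \<and>
     (\<forall>p\<in>A. \<forall>q\<in>A. \<Phi> (p * q) = \<Phi> p * \<Phi> q) \<and>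
     (\<forall>c. \<Phi> (const2 c) = const2 c)"

definition formally_right_equivalent :: "series2 \<Rightarrow> series2 \<Rightarrow> bool" where
  "formally_right_equivalent f g \<longleftrightarrow> (\<exists>\<Phi>. algebra_automorphism UNIV \<Phi> \<and> \<Phi> f = g)"

definition right_equivalent :: "series2 \<Rightarrow> series2 \<Rightarrow> bool" where
  "right_equivalent f g \<longleftrightarrow>
     f \<in> convergent_series \<and> g \<in> convergent_series \<and>
     (\<exists>\<Phi>. algebra_automorphism convergent_series \<Phi> \<and> \<Phi> f = g)"


subsection \<open>Newton polyhedra and normalised power series\<close>

definition newton_polyhedron :: "series2 \<Rightarrow> (real \<times> real) set" where
  "newton_polyhedron f = convex hull
     (\<Union>(i, j)\<in>{(i, j). coeff2 f i j \<noteq> 0}. {(real i + s, real j + t) | s t. 0 \<le> s \<and> 0 \<le> t})"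

text \<open>The least attained weight; meaningful for \<open>f \<noteq> 0\<close>.\<close>

definition weight :: "nat \<Rightarrow> nat \<Rightarrow> series2 \<Rightarrow> nat" where
  "weight wx wy f = (LEAST n. \<exists>i j. coeff2 f i j \<noteq> 0 \<and> n = i * wx + j * wy)"

definition leading_term :: "nat \<Rightarrow> nat \<Rightarrow> series2 \<Rightarrow> series2" where
  "leading_term wx wy f = series_of_coeffs
     (\<lambda>i j. if i * wx + j * wy = weight wx wy f then coeff2 f i j else 0)"

definition x_exponent :: "series2 \<Rightarrow> nat" where
  "x_exponent h = (GREATEST a. X2 ^ a dvd h)"

definition y_exponent :: "series2 \<Rightarrow> nat" where
  "y_exponent h = (GREATEST b. Y2 ^ b dvd h)"

text \<open>For \<open>h \<noteq> 0\<close> the two exponents can be maximised independently, \<open>X2\<close> and \<open>Y2\<close> being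
  non-associated primes.\<close>

definition saturation :: "series2 \<Rightarrow> series2" where
  "saturation h = (THE s. h = X2 ^ x_exponent h * Y2 ^ y_exponent h * s)"

definition max_irreducible_power :: "series2 \<Rightarrow> nat" where
  "max_irreducible_power s = (GREATEST d. \<exists>p. irreducible p \<and> p ^ d dvd s)"

definition primitive_normal :: "(real \<times> real) set \<Rightarrow> nat \<Rightarrow> nat \<Rightarrow> bool" where
  "primitive_normal \<Delta> wx wy \<longleftrightarrow>
     coprime wx wy \<and> (\<forall>p\<in>\<Delta>. \<forall>q\<in>\<Delta>. (real wx, real wy) \<bullet> (p - q) = 0)"

text \<open>To be used when \<open>\<Delta>\<close> is a facet of the Newton polyhedron of \<open>f\<close>; the pair \<open>(wx, wy)\<close> is
  then unique.\<close>

definition normalised :: "series2 \<Rightarrow> (real \<times> real) set \<Rightarrow> bool" where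
  "normalised f \<Delta> \<longleftrightarrow> (\<exists>wx wy. primitive_normal \<Delta> wx wy \<and>
     (let h = leading_term wx wy f;
          a = x_exponent h;
          b = y_exponent h;
          d = max_irreducible_power (saturation h)
      in wx = 0 \<or> wy = 0 \<or>
         wx = 1 \<and> wy = 1 \<and> d \<le> min a b \<or>
         wx = 1 \<and> wy > 1 \<and> d \<le> b \<or>
         wx > 1 \<and> wy = 1 \<and> d \<le> a \<or>
         wx > 1 \<and> wy > 1))"

definition normalised_compact_facets :: "series2 \<Rightarrow> bool" where
  "normalised_compact_facets f \<longleftrightarrow>
     (\<forall>\<Delta>. \<Delta> facet_of newton_polyhedron f \<and> compact \<Delta> \<longrightarrow> normalised f \<Delta>)"

end

theory Submission
  imports Defs "Jordan_Normal_Form.Determinant" "HOL-Complex_Analysis.Complex_Analysis"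
begin

text \<open>At the weights \<open>(1, k)\<close> the leading form of \<open>f\<close> is \<open>x\<^sup>n L(y / x\<^sup>k)\<close> with a polynomial \<open>L\<close>, and
  the factors of its saturation are the \<open>y - c x\<^sup>k\<close> with \<open>c\<close> a nonzero root of \<open>L\<close>. Being normalised
  therefore means that no root of \<open>L\<close> has larger multiplicity than the root \<open>0\<close>. A shear
  \<open>y \<mapsto> y + \<phi>(x)\<close> with \<open>\<phi> = c x\<^sup>k + \<dots>\<close> translates the roots by \<open>c\<close> and preserves the leading forms
  at \<open>(1, l)\<close> for \<open>l < k\<close>. So the coefficients of \<open>\<phi>\<close> can be chosen one after the other to move a root of
  maximal multiplicity to \<open>0\<close> for each \<open>k\<close>. A shear of \<open>x\<close> does the same for the weights \<open>(k, 1)\<close>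
  without destroying what the first one has achieved (\<open>ex_normalising_shears\<close>). A compact facet
  has a normal vector with positive entries, and the remaining normal vectors impose no condition
  (\<open>normal_imp_normalised_compact_facets\<close>). This proves the formal statement.

  For an isolated singularity the Jacobian ideal contains powers of \<open>x\<close> and of \<open>y\<close>
  (\<open>isolated_singularity_jacobian\<close>). By Weierstrass preparation one of the partial derivatives may be
  replaced by a Weierstrass polynomial \<open>P\<close> in \<open>y\<close>. Multiplication by the other one, \<open>b\<close>, on the remainders
  modulo \<open>P\<close> has a determinant \<open>\<delta>(x)\<close>, which lies in the ideal \<open>(P, b)\<close> and is a unit times a power
  of \<open>x\<close> unless it vanishes identically. If it did, there would be a curve of common zeros of both
  derivatives. On such a curve \<open>f\<close> is constant, the constant is \<open>0\<close>, and the singularity would not be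
  isolated.

  Consequently \<open>f\<close> is finitely determined (\<open>finite_determinacy\<close>): changing terms of high order is undone
  by a convergent change of coordinates, which a fixed point argument with majorant norms
  provides. The normalising shears may diverge, but their truncations are polynomials. They take \<open>f\<close> to a
  series which agrees up to high order with the formal normal form, hence also with a polynomial
  truncation of the latter. That truncation is right equivalent to \<open>f\<close> by finite determinacy,
  and it is still normalised since the leading forms depend on finitely many
  monomials only (\<open>normal_box_part\<close>).\<close>

section \<open>Coefficients of power series in two variables\<close>

lemma sum_sum_delta:
  assumes "finite A" "finite B"
  shows "(\<Sum>k\<in>A. \<Sum>l\<in>B. if k = a \<and> l = b then h k l else 0)
    = (if a \<in> A \<and> b \<in> B then h a b else (0 :: 'a :: comm_monoid_add))"
proof -
  have "(\<Sum>k\<in>A. \<Sum>l\<in>B. if k = a \<and> l = b then h k l else 0)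
      = (\<Sum>k\<in>A. if k = a then (\<Sum>l\<in>B. if l = b then h a l else 0) else 0)"
    by (rule sum.cong) auto
  then show ?thesis
    using assms by simp
qed

lemma coeff2_series_of_coeffs [simp]: "coeff2 (series_of_coeffs a) i j = a i j"
  by (simp add: coeff2_def series_of_coeffs_def)

lemma series2_eqI: "(\<And>i j. coeff2 f i j = coeff2 g i j) \<Longrightarrow> f = g"
  by (simp add: coeff2_def fps_eq_iff)

lemma coeff2_0 [simp]: "coeff2 0 i j = 0"
  and coeff2_add [simp]: "coeff2 (f + g) i j = coeff2 f i j + coeff2 g i j"
  and coeff2_diff [simp]: "coeff2 (f - g) i j = coeff2 f i j - coeff2 g i j"
  and coeff2_uminus [simp]: "coeff2 (- f) i j = - coeff2 f i j"
  by (simp_all add: coeff2_def)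

lemma coeff2_sum [simp]: "coeff2 (sum f S) i j = (\<Sum>a\<in>S. coeff2 (f a) i j)"
  by (simp add: coeff2_def fps_sum_nth)

lemma coeff2_mult:
  "coeff2 (f * g) i j = (\<Sum>j1\<le>j. \<Sum>i1\<le>i. coeff2 f i1 j1 * coeff2 g (i - i1) (j - j1))"
  by (simp add: coeff2_def fps_mult_nth fps_sum_nth atMost_atLeast0)

lemma coeff2_const2_mult [simp]: "coeff2 (const2 c * f) i j = c * coeff2 f i j"
  by (simp add: coeff2_def const2_def)

lemma coeff2_const2: "coeff2 (const2 c) i j = (if i = 0 \<and> j = 0 then c else 0)"
  by (simp add: coeff2_def const2_def)

lemma const2_0 [simp]: "const2 0 = 0"
  and const2_1 [simp]: "const2 1 = 1"
  and const2_add: "const2 (a + b) = const2 a + const2 b"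
  and const2_mult: "const2 (a * b) = const2 a * const2 b"
  by (simp_all add: const2_def)

lemma coeff2_1: "coeff2 1 i j = (if i = 0 \<and> j = 0 then 1 else 0)"
  using coeff2_const2[of 1] by simp

lemma coeff2_X2_power_mult: "coeff2 (X2 ^ a * f) i j = (if i < a then 0 else coeff2 f (i - a) j)"
  by (simp add: coeff2_def X2_def fps_const_power fps_X_power_mult_nth)

lemma coeff2_Y2_power_mult: "coeff2 (Y2 ^ a * f) i j = (if j < a then 0 else coeff2 f i (j - a))"
  by (simp add: coeff2_def Y2_def fps_X_power_mult_nth)

lemma coeff2_monomial:
  "coeff2 (const2 c * X2 ^ a * Y2 ^ b) i j = (if i = a \<and> j = b then c else 0)"
proof -
  have *: "const2 c * X2 ^ a * Y2 ^ b = X2 ^ a * (Y2 ^ b * const2 c)"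
    by (simp add: mult_ac)
  show ?thesis
    unfolding * by (auto simp: coeff2_X2_power_mult coeff2_Y2_power_mult coeff2_const2)
qed

lemma coeff2_X2: "coeff2 X2 i j = (if i = 1 \<and> j = 0 then 1 else 0)"
  using coeff2_monomial[of 1 1 0] by simp

lemma coeff2_Y2: "coeff2 Y2 i j = (if i = 0 \<and> j = 1 then 1 else 0)"
  using coeff2_monomial[of 1 0 1] by simp

lemma coeff2_mult_00 [simp]: "coeff2 (f * g) 0 0 = coeff2 f 0 0 * coeff2 g 0 0"
  by (simp add: coeff2_mult)


section \<open>The weight filtration\<close>

text \<open>The ideal of series all of whose monomials have weight at least \<open>n\<close>. With \<open>u = v = 1\<close> this
  is the \<open>n\<close>-th power of the maximal ideal; other weights are used for Newton polyhedra and for the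
  division theorem.\<close>

definition wt_ge :: "nat \<Rightarrow> nat \<Rightarrow> nat \<Rightarrow> series2 \<Rightarrow> bool" where
  "wt_ge u v n f \<longleftrightarrow> (\<forall>i j. u * i + v * j < n \<longrightarrow> coeff2 f i j = 0)"

lemma wt_geD: "wt_ge u v n f \<Longrightarrow> u * i + v * j < n \<Longrightarrow> coeff2 f i j = 0"
  by (simp add: wt_ge_def)

lemma wt_ge_0 [simp]: "wt_ge u v n 0" and wt_ge_zero [simp]: "wt_ge u v 0 f"
  by (simp_all add: wt_ge_def)

lemma wt_ge_add: "wt_ge u v n f \<Longrightarrow> wt_ge u v n g \<Longrightarrow> wt_ge u v n (f + g)"
  and wt_ge_diff: "wt_ge u v n f \<Longrightarrow> wt_ge u v n g \<Longrightarrow> wt_ge u v n (f - g)"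
  and wt_ge_uminus: "wt_ge u v n f \<Longrightarrow> wt_ge u v n (- f)"
  and wt_ge_mono: "wt_ge u v n f \<Longrightarrow> m \<le> n \<Longrightarrow> wt_ge u v m f"
  by (simp_all add: wt_ge_def)

lemma wt_ge_mult:
  assumes "wt_ge u v n f" "wt_ge u v m g"
  shows "wt_ge u v (n + m) (f * g)"
  unfolding wt_ge_def coeff2_mult
proof (intro allI impI sum.neutral ballI)
  fix i j j1 i1
  assume ij: "u * i + v * j < n + m" and "j1 \<in> {..j}" "i1 \<in> {..i}"
  then obtain i2 j2 where e: "i = i1 + i2" "j = j1 + j2"
    by (metis atMost_iff le_iff_add)
  have "u * i1 + v * j1 < n \<or> u * i2 + v * j2 < m"
    using ij unfolding e by (simp add: algebra_simps) linarith
  then show "coeff2 f i1 j1 * coeff2 g (i - i1) (j - j1) = 0"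
    using assms e by (auto simp: wt_ge_def)
qed

lemma wt_ge_mult_left: "wt_ge u v n f \<Longrightarrow> wt_ge u v n (f * g)"
  using wt_ge_mult[of u v n f 0 g] by simp

lemma wt_ge_mult_right: "wt_ge u v n f \<Longrightarrow> wt_ge u v n (g * f)"
  using wt_ge_mult_left[of u v n f g] by (simp add: mult.commute)

lemma wt_ge_power: "wt_ge u v d f \<Longrightarrow> wt_ge u v (d * k) (f ^ k)"
  by (induction k) (auto simp: algebra_simps dest: wt_ge_mult)

lemma wt_ge_X2: "wt_ge u v u X2" and wt_ge_Y2: "wt_ge u v v Y2"
  by (auto simp: wt_ge_def coeff2_X2 coeff2_Y2)

lemma wt_ge_11_1: "wt_ge 1 1 1 f \<longleftrightarrow> coeff2 f 0 0 = 0"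
  "wt_ge (Suc 0) (Suc 0) (Suc 0) f \<longleftrightarrow> coeff2 f 0 0 = 0"
  by (auto simp: wt_ge_def)

lemma wt_ge_diff_trans:
  "wt_ge u v n (f - g) \<Longrightarrow> wt_ge u v n (g - h) \<Longrightarrow> wt_ge u v n (f - h)"
  by (simp add: wt_ge_def)

lemma wt_ge_diff_sym: "wt_ge u v n (f - g) \<Longrightarrow> wt_ge u v n (g - f)"
  by (simp add: wt_ge_def)

lemma wt_ge_diff_mult:
  assumes "wt_ge u v n f" "wt_ge u v m g'" "wt_ge u v (n + e) (f - f')" "wt_ge u v (m + e) (g - g')"
  shows "wt_ge u v (n + m + e) (f * g - f' * g')"
proof -
  have "f * g - f' * g' = f * (g - g') + (f - f') * g'"
    by (simp add: algebra_simps)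
  moreover have "wt_ge u v (n + m + e) (f * (g - g'))"
    using wt_ge_mult[OF assms(1,4)] by (simp add: add_ac)
  moreover have "wt_ge u v (n + m + e) ((f - f') * g')"
    using wt_ge_mult[OF assms(3,2)] by (simp add: add_ac)
  ultimately show ?thesis
    by (simp add: wt_ge_add)
qed

lemma wt_ge_diff_power:
  assumes "wt_ge u v d p" "wt_ge u v d p'" "wt_ge u v (d + e) (p - p')"
  shows "wt_ge u v (d * k + e) (p ^ k - p' ^ k)"
proof (induction k)
  case (Suc k)
  then show ?case
    using wt_ge_diff_mult[OF assms(1) wt_ge_power[OF assms(2), of k] assms(3), of "p ^ k"]
    by (simp add: add_ac)
qed simp

lemma series2_eqI_wt:
  assumes "\<And>n. wt_ge 1 1 n (f - g)"
  shows "f = g"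
proof (rule series2_eqI)
  fix i j
  show "coeff2 f i j = coeff2 g i j"
    using wt_geD[OF assms[of "Suc (i + j)"], of i j] by simp
qed

definition box_part :: "nat \<Rightarrow> series2 \<Rightarrow> series2" where
  "box_part n f = (\<Sum>i<n. \<Sum>j<n. const2 (coeff2 f i j) * X2 ^ i * Y2 ^ j)"

lemma coeff2_box_part: "coeff2 (box_part n f) i j = (if i < n \<and> j < n then coeff2 f i j else 0)"
proof -
  have "coeff2 (box_part n f) i j = (\<Sum>i'<n. \<Sum>j'<n. if i' = i \<and> j' = j then coeff2 f i' j' else 0)"
    by (simp add: box_part_def coeff2_monomial eq_commute)
  then show ?thesis
    by (simp add: sum_sum_delta)
qed

lemma wt_ge_truncation: "wt_ge 1 1 n (f - box_part n f)"
  by (simp add: wt_ge_def coeff2_box_part)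

text \<open>Additive maps that respect the filtration are determined by their values on monomials. This
  reduces the identities for substitutions below to finite sums.\<close>

lemma additive_continuous_eqI:
  assumes add: "\<And>f g. \<Phi> (f + g) = \<Phi> f + \<Phi> g" "\<And>f g. \<Psi> (f + g) = \<Psi> f + \<Psi> g"
    and cont: "\<And>n f. wt_ge 1 1 n f \<Longrightarrow> wt_ge 1 1 n (\<Phi> f)" "\<And>n f. wt_ge 1 1 n f \<Longrightarrow> wt_ge 1 1 n (\<Psi> f)"
    and mono: "\<And>c a b. \<Phi> (const2 c * X2 ^ a * Y2 ^ b) = \<Psi> (const2 c * X2 ^ a * Y2 ^ b)"
  shows "\<Phi> f = \<Psi> (f :: series2)"
proof (rule series2_eqI_wt)
  fix n
  have \<Phi>0: "\<Phi> 0 = 0" and \<Psi>0: "\<Psi> 0 = 0"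
    using add(1)[of 0 0] add(2)[of 0 0] by simp_all
  define t where "t = box_part n f"
  have \<Phi>s: "\<Phi> (sum h S) = (\<Sum>a\<in>S. \<Phi> (h a))" and \<Psi>s: "\<Psi> (sum h S) = (\<Sum>a\<in>S. \<Psi> (h a))"
    if "finite S" for h :: "nat \<Rightarrow> series2" and S
    using that by (induction S) (simp_all add: add \<Phi>0 \<Psi>0)
  have t: "\<Phi> t = \<Psi> t"
    unfolding t_def box_part_def by (simp add: \<Phi>s \<Psi>s mono)
  have "\<Phi> f = \<Phi> t + \<Phi> (f - t)" "\<Psi> f = \<Psi> t + \<Psi> (f - t)"
    by (simp_all flip: add)
  then have "\<Phi> f - \<Psi> f = \<Phi> (f - t) - \<Psi> (f - t)"
    using t by simp
  then show "wt_ge 1 1 n (\<Phi> f - \<Psi> f)"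
    using cont wt_ge_truncation[of n f] by (simp add: t_def wt_ge_diff)
qed


section \<open>Substitution\<close>

text \<open>The value at \<open>(p, q)\<close> of a power series in two further variables with coefficients
  \<open>c k l\<close> in \<open>\<complex>[[x, y]]\<close>. As \<open>p\<close> and \<open>q\<close> have no constant term, only the terms
  with \<open>k, l \<le> i + j\<close> contribute to the coefficient of \<open>x\<^sup>i y\<^sup>j\<close>.\<close>

definition psubst :: "(nat \<Rightarrow> nat \<Rightarrow> series2) \<Rightarrow> series2 \<Rightarrow> series2 \<Rightarrow> series2" where
  "psubst c p q =
     series_of_coeffs (\<lambda>i j. coeff2 (\<Sum>k\<le>i + j. \<Sum>l\<le>i + j. c k l * p ^ k * q ^ l) i j)"

definition subst :: "series2 \<Rightarrow> series2 \<Rightarrow> series2 \<Rightarrow> series2" where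
  "subst f = psubst (\<lambda>k l. const2 (coeff2 f k l))"

lemma coeff2_power_mult_eq_0:
  assumes "coeff2 p 0 0 = 0" "coeff2 q 0 0 = 0" "i + j < k + l"
  shows "coeff2 (c * p ^ k * q ^ l) i j = 0"
proof -
  have "wt_ge 1 1 (1 * k + 1 * l) (p ^ k * q ^ l)"
    using assms by (intro wt_ge_mult wt_ge_power) (simp_all add: wt_ge_11_1)
  then have "wt_ge 1 1 (k + l) (c * p ^ k * q ^ l)"
    using wt_ge_mult_right[of 1 1 "k + l" "p ^ k * q ^ l" c] by (simp add: mult.assoc)
  then show ?thesis
    using assms(3) wt_geD[of 1 1 "k + l" _ i j] by simp
qed

lemma coeff2_psubst:
  assumes "coeff2 p 0 0 = 0" "coeff2 q 0 0 = 0" "i + j < K" "i + j < L"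
  shows "coeff2 (psubst c p q) i j = coeff2 (\<Sum>k<K. \<Sum>l<L. c k l * p ^ k * q ^ l) i j"
proof -
  have inner: "(\<Sum>l\<le>i + j. coeff2 (c k l * p ^ k * q ^ l) i j)
      = (\<Sum>l<L. coeff2 (c k l * p ^ k * q ^ l) i j)" for k
    using assms by (intro sum.mono_neutral_left) (auto intro!: coeff2_power_mult_eq_0)
  have "(\<Sum>k\<le>i + j. \<Sum>l<L. coeff2 (c k l * p ^ k * q ^ l) i j)
      = (\<Sum>k<K. \<Sum>l<L. coeff2 (c k l * p ^ k * q ^ l) i j)"
    using assms
    by (intro sum.mono_neutral_left) (auto intro!: sum.neutral coeff2_power_mult_eq_0)
  then show ?thesis
    by (simp add: psubst_def inner)
qed

lemma psubst_approx:
  assumes "coeff2 p 0 0 = 0" "coeff2 q 0 0 = 0" "n \<le> K" "n \<le> L"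
  shows "wt_ge 1 1 n (psubst c p q - (\<Sum>k<K. \<Sum>l<L. c k l * p ^ k * q ^ l))"
  unfolding wt_ge_def
proof (intro allI impI)
  fix i j :: nat
  assume "1 * i + 1 * j < n"
  then have "coeff2 (psubst c p q) i j = coeff2 (\<Sum>k<K. \<Sum>l<L. c k l * p ^ k * q ^ l) i j"
    using assms by (intro coeff2_psubst) auto
  then show "coeff2 (psubst c p q - (\<Sum>k<K. \<Sum>l<L. c k l * p ^ k * q ^ l)) i j = 0"
    by simp
qed

lemma wt_ge_psubst:
  assumes "\<And>k l. wt_ge u v n (c k l * p ^ k * q ^ l)"
  shows "wt_ge u v n (psubst c p q)"
  using assms by (auto simp: wt_ge_def psubst_def intro!: sum.neutral)

lemma wt_ge_psubst_diff:
  assumes "\<And>k l. wt_ge u v n (c k l * p ^ k * q ^ l - c' k l * p' ^ k * q' ^ l)"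
  shows "wt_ge u v n (psubst c p q - psubst c' p' q')"
  using assms unfolding wt_ge_def psubst_def
  by (auto simp flip: sum_subtractf intro!: sum.neutral)

lemma psubst_add: "psubst (\<lambda>k l. c k l + c' k l) p q = psubst c p q + psubst c' p q"
  by (rule series2_eqI) (simp add: psubst_def algebra_simps sum.distrib)

lemma psubst_split:
  assumes "coeff2 p 0 0 = 0" "coeff2 q 0 0 = 0"
  shows "psubst c p q
    = psubst (\<lambda>k l. if k = 0 then c 0 l else 0) p q + p * psubst (\<lambda>k. c (Suc k)) p q" (is ?A)
    and "psubst c p q
    = psubst (\<lambda>k l. if l = 0 then c k 0 else 0) p q + q * psubst (\<lambda>k l. c k (Suc l)) p q" (is ?B)
proof -
  show ?A
  proof (rule series2_eqI_wt)
    fix n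
    let ?S = "\<lambda>c K L. \<Sum>k<K. \<Sum>l<L. c k l * p ^ k * q ^ l"
    let ?c0 = "\<lambda>k l. if k = 0 then c 0 l else 0"
    have *: "?S c (Suc n) n = ?S ?c0 (Suc n) n + p * ?S (\<lambda>k. c (Suc k)) n n"
      by (simp only: sum.lessThan_Suc_shift)
        (simp add: sum_distrib_left mult_ac)
    have "wt_ge 1 1 n ((psubst c p q - ?S c (Suc n) n) - (psubst ?c0 p q - ?S ?c0 (Suc n) n)
        - p * (psubst (\<lambda>k. c (Suc k)) p q - ?S (\<lambda>k. c (Suc k)) n n))"
      using assms by (intro wt_ge_diff wt_ge_mult_right psubst_approx) auto
    then show "wt_ge 1 1 n (psubst c p q - (psubst ?c0 p q + p * psubst (\<lambda>k. c (Suc k)) p q))"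
      unfolding * by (simp add: algebra_simps)
  qed
  show ?B
  proof (rule series2_eqI_wt)
    fix n
    let ?S = "\<lambda>c K L. \<Sum>k<K. \<Sum>l<L. c k l * p ^ k * q ^ l"
    let ?c0 = "\<lambda>k l. if l = 0 then c k 0 else 0"
    have *: "?S c n (Suc n) = ?S ?c0 n (Suc n) + q * ?S (\<lambda>k l. c k (Suc l)) n n"
      by (simp only: sum.lessThan_Suc_shift)
        (simp add: sum_distrib_left sum.distrib mult_ac)
    have "wt_ge 1 1 n ((psubst c p q - ?S c n (Suc n)) - (psubst ?c0 p q - ?S ?c0 n (Suc n))
        - q * (psubst (\<lambda>k l. c k (Suc l)) p q - ?S (\<lambda>k l. c k (Suc l)) n n))"
      using assms by (intro wt_ge_diff wt_ge_mult_right psubst_approx) auto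
    then show "wt_ge 1 1 n (psubst c p q - (psubst ?c0 p q + q * psubst (\<lambda>k l. c k (Suc l)) p q))"
      unfolding * by (simp add: algebra_simps)
  qed
qed

lemma psubst_const:
  assumes "\<And>k l. c k l = (if k = 0 \<and> l = 0 then f else 0)"
  shows "psubst c p q = f"
proof (rule series2_eqI)
  fix i j
  have "(\<Sum>k\<le>i + j. \<Sum>l\<le>i + j. c k l * p ^ k * q ^ l)
      = (\<Sum>k\<le>i + j. \<Sum>l\<le>i + j. if k = 0 \<and> l = 0 then f else 0)"
    by (intro sum.cong) (auto simp: assms)
  also have "\<dots> = f"
    by (subst sum_sum_delta) auto
  finally show "coeff2 (psubst c p q) i j = coeff2 f i j"
    by (simp add: psubst_def del: coeff2_sum)
qed

text \<open>Three quadratic remainder terms suffice: the terms with \<open>k \<ge> 2\<close> go into the first, those with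
  \<open>k = 1\<close>, \<open>l \<ge> 1\<close> into the second and those with \<open>k = 0\<close>, \<open>l \<ge> 2\<close> into the third.\<close>

lemma psubst_second_order:
  assumes "coeff2 p 0 0 = 0" "coeff2 q 0 0 = 0"
  shows "psubst c p q = c 0 0 + p * c 1 0 + q * c 0 1
    + p\<^sup>2 * psubst (\<lambda>k l. c (k + 2) l) p q
    + p * q * psubst (\<lambda>k l. if k = 0 then c 1 (l + 1) else 0) p q
    + q\<^sup>2 * psubst (\<lambda>k l. if k = 0 then c 0 (l + 2) else 0) p q"
proof -
  note s1 = psubst_split(1)[OF assms] and s2 = psubst_split(2)[OF assms]
  have c0: "psubst (\<lambda>k l. if l = 0 then if k = 0 then a else 0 else 0) p q = a" for a
    by (rule psubst_const) auto
  have 0: "psubst (\<lambda>k l. if k = 0 then a l else 0) p q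
      = a 0 + q * psubst (\<lambda>k l. if k = 0 then a (Suc l) else 0) p q" for a
    using s2[of "\<lambda>k l. if k = 0 then a l else 0"] by (simp add: c0)
  have 1: "psubst c p q = psubst (\<lambda>k l. if k = 0 then c 0 l else 0) p q
      + p * (psubst (\<lambda>k l. if k = 0 then c 1 l else 0) p q + p * psubst (\<lambda>k l. c (k + 2) l) p q)"
    using s1[of c] s1[of "\<lambda>k l. c (Suc k) l"] by (simp add: numeral_2_eq_2 cong: if_cong)
  show ?thesis
    unfolding 1 0[of "c 0"] 0[of "c 1"] 0[of "\<lambda>l. c 0 (Suc l)"]
    by (simp add: algebra_simps power2_eq_square cong: if_cong)
qed

lemma subst_add: "subst (f + g) p q = subst f p q + subst g p q"
  by (simp add: subst_def const2_add psubst_add)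

lemma subst_diff: "subst (f - g) p q = subst f p q - subst g p q"
  using subst_add[of "f - g" g p q] by simp

text \<open>A substitution is compatible with weights as soon as it is so on the variables; the second
  lemma says that terms of higher weight in \<open>p\<close>, \<open>q\<close> do not affect leading terms.\<close>

lemma wt_ge_subst:
  assumes "wt_ge u v n f" "wt_ge u v u p" "wt_ge u v v q"
  shows "wt_ge u v n (subst f p q)"
  unfolding subst_def
proof (rule wt_ge_psubst)
  fix k l
  show "wt_ge u v n (const2 (coeff2 f k l) * p ^ k * q ^ l)"
  proof (cases "u * k + v * l < n")
    case True
    then show ?thesis
      using assms(1) by (simp add: wt_ge_def)
  next
    case False
    have "wt_ge u v (u * k + v * l) (p ^ k * q ^ l)"
      using assms by (intro wt_ge_mult wt_ge_power) auto
    then have "wt_ge u v n (const2 (coeff2 f k l) * (p ^ k * q ^ l))"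
      using False by (metis not_less wt_ge_mono wt_ge_mult_right)
    then show ?thesis
      by (simp add: mult.assoc)
  qed
qed

lemma wt_ge_subst_diff:
  assumes "wt_ge u v n f" "wt_ge u v u p" "wt_ge u v v q" "wt_ge u v u p'" "wt_ge u v v q'"
    and "wt_ge u v (u + e) (p - p')" "wt_ge u v (v + e) (q - q')"
  shows "wt_ge u v (n + e) (subst f p q - subst f p' q')"
  unfolding subst_def
proof (rule wt_ge_psubst_diff)
  fix k l
  let ?c = "const2 (coeff2 f k l)"
  show "wt_ge u v (n + e) (?c * p ^ k * q ^ l - ?c * p' ^ k * q' ^ l)"
  proof (cases "u * k + v * l < n")
    case True
    then show ?thesis
      using assms(1) by (simp add: wt_ge_def)
  next
    case False
    have "wt_ge u v (u * k + v * l + e) (p ^ k * q ^ l - p' ^ k * q' ^ l)"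
      using assms by (intro wt_ge_diff_mult wt_ge_diff_power wt_ge_power) auto
    then have "wt_ge u v (n + e) (?c * (p ^ k * q ^ l - p' ^ k * q' ^ l))"
      using False by (metis not_less wt_ge_mono wt_ge_mult_right add_le_mono1)
    then show ?thesis
      by (simp add: algebra_simps)
  qed
qed

lemma wt_ge_subst_11:
  assumes "wt_ge 1 1 n f" "coeff2 p 0 0 = 0" "coeff2 q 0 0 = 0"
  shows "wt_ge 1 1 n (subst f p q)"
  using assms by (intro wt_ge_subst) (simp_all add: wt_ge_11_1)

lemma coeff2_00_subst [simp]:
  "coeff2 (subst f p q) 0 0 = coeff2 f 0 0"
  by (simp add: subst_def psubst_def coeff2_const2)

lemma subst_monomial:
  assumes "coeff2 p 0 0 = 0" "coeff2 q 0 0 = 0"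
  shows "subst (const2 c * X2 ^ a * Y2 ^ b) p q = const2 c * p ^ a * q ^ b"
proof (rule series2_eqI)
  fix i j
  define N where "N = Suc (i + j + a + b)"
  have "(\<Sum>k<N. \<Sum>l<N. const2 (if k = a \<and> l = b then c else 0) * p ^ k * q ^ l)
      = (\<Sum>k<N. \<Sum>l<N. if k = a \<and> l = b then const2 c * p ^ a * q ^ b else 0)"
    by (intro sum.cong) auto
  also have "\<dots> = const2 c * p ^ a * q ^ b"
    by (subst sum_sum_delta) (auto simp: N_def)
  finally show "coeff2 (subst (const2 c * X2 ^ a * Y2 ^ b) p q) i j = coeff2 (const2 c * p ^ a * q ^ b) i j"
    unfolding subst_def by (subst coeff2_psubst[of _ _ _ _ N N]) (simp_all add: assms N_def coeff2_monomial del: coeff2_sum)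
qed

lemma subst_X2 [simp]: "coeff2 p 0 0 = 0 \<Longrightarrow> coeff2 q 0 0 = 0 \<Longrightarrow> subst X2 p q = p"
  and subst_Y2 [simp]: "coeff2 p 0 0 = 0 \<Longrightarrow> coeff2 q 0 0 = 0 \<Longrightarrow> subst Y2 p q = q"
  and subst_const2: "coeff2 p 0 0 = 0 \<Longrightarrow> coeff2 q 0 0 = 0 \<Longrightarrow> subst (const2 c) p q = const2 c"
  using subst_monomial[of p q 1 1 0] subst_monomial[of p q 1 0 1] subst_monomial[of p q c 0 0] by simp_all

lemma subst_0 [simp]: "subst 0 p q = 0"
  using subst_add[of 0 0 p q] by simp

lemma subst_mult:
  assumes [simp]: "coeff2 p 0 0 = 0" "coeff2 q 0 0 = 0"
  shows "subst (f * g) p q = subst f p q * subst g p q"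
proof -
  have 1: "subst (const2 c * X2 ^ a * Y2 ^ b * g) p q = subst (const2 c * X2 ^ a * Y2 ^ b) p q * subst g p q" for c a b
  proof (rule additive_continuous_eqI[where f = g])
    fix d a' b'
    have "const2 c * X2 ^ a * Y2 ^ b * (const2 d * X2 ^ a' * Y2 ^ b')
        = const2 (c * d) * X2 ^ (a + a') * Y2 ^ (b + b')"
      by (simp add: const2_mult power_add mult_ac)
    then show "subst (const2 c * X2 ^ a * Y2 ^ b * (const2 d * X2 ^ a' * Y2 ^ b')) p q =
        subst (const2 c * X2 ^ a * Y2 ^ b) p q * subst (const2 d * X2 ^ a' * Y2 ^ b') p q"
      by (simp add: subst_monomial) (simp add: const2_mult power_add mult_ac)
  qed (simp_all add: subst_add distrib_left wt_ge_mult_right wt_ge_subst_11 del: One_nat_def)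
  show ?thesis
    by (rule additive_continuous_eqI[where f = f])
      (simp_all add: subst_add distrib_right 1 wt_ge_mult_left wt_ge_subst_11 del: One_nat_def)
qed

lemma subst_1 [simp]: "coeff2 p 0 0 = 0 \<Longrightarrow> coeff2 q 0 0 = 0 \<Longrightarrow> subst 1 p q = 1"
  using subst_const2[of p q 1] by simp

lemma subst_power:
  "coeff2 p 0 0 = 0 \<Longrightarrow> coeff2 q 0 0 = 0 \<Longrightarrow> subst (f ^ n) p q = subst f p q ^ n"
  by (induction n) (simp_all add: subst_mult)

lemma subst_subst:
  assumes [simp]: "coeff2 p 0 0 = 0" "coeff2 q 0 0 = 0" "coeff2 p' 0 0 = 0" "coeff2 q' 0 0 = 0"
  shows "subst (subst f p q) p' q' = subst f (subst p p' q') (subst q p' q')"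
proof (rule additive_continuous_eqI[where f = f])
  fix c a b
  show "subst (subst (const2 c * X2 ^ a * Y2 ^ b) p q) p' q' =
      subst (const2 c * X2 ^ a * Y2 ^ b) (subst p p' q') (subst q p' q')"
    by (simp add: subst_monomial subst_mult subst_power subst_const2)
qed (auto simp: subst_add simp del: One_nat_def intro!: wt_ge_subst_11)

lemma subst_id [simp]: "subst f X2 Y2 = f"
  by (rule additive_continuous_eqI[where f = f and \<Psi> = "\<lambda>f. f"])
    (auto simp: subst_add subst_monomial coeff2_X2 coeff2_Y2 simp del: One_nat_def intro!: wt_ge_subst_11)

text \<open>The Hasse derivatives, that is the partial derivatives divided by \<open>k! l!\<close>, are the
  coefficients of the Taylor expansion.\<close>

definition hasse :: "series2 \<Rightarrow> nat \<Rightarrow> nat \<Rightarrow> series2" where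
  "hasse f k l = series_of_coeffs (\<lambda>i j.
     of_nat ((i + k) choose k) * of_nat ((j + l) choose l) * coeff2 f (i + k) (j + l))"

lemma hasse_0_0: "hasse f 0 0 = f"
  and hasse_1_0: "hasse f 1 0 = deriv_x f"
  and hasse_0_1: "hasse f 0 1 = deriv_y f"
  by (rule series2_eqI, simp add: hasse_def deriv_x_def deriv_y_def)+

lemma hasse_add: "hasse (f + g) k l = hasse f k l + hasse g k l"
  by (rule series2_eqI) (simp add: hasse_def algebra_simps)

lemma hasse_monomial:
  "hasse (const2 c * X2 ^ a * Y2 ^ b) k l = (if k \<le> a \<and> l \<le> b
     then const2 c * (of_nat (a choose k) * X2 ^ (a - k)) * (of_nat (b choose l) * Y2 ^ (b - l)) else 0)"
proof -
  have of_nat: "of_nat n = const2 (of_nat n)" for n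
    by (simp add: const2_def fps_of_nat)
  have *: "const2 c * (of_nat (a choose k) * X2 ^ (a - k)) * (of_nat (b choose l) * Y2 ^ (b - l))
      = const2 (c * of_nat (a choose k) * of_nat (b choose l)) * X2 ^ (a - k) * Y2 ^ (b - l)"
    by (simp add: of_nat const2_mult mult_ac)
  show ?thesis
    unfolding * by (rule series2_eqI) (auto simp: hasse_def coeff2_monomial)
qed

lemma subst_taylor:
  assumes [simp]: "coeff2 u 0 0 = 0" "coeff2 v 0 0 = 0"
  shows "subst f (X2 + u) (Y2 + v) = psubst (hasse f) u v"
proof (rule additive_continuous_eqI[where f = f])
  show "psubst (hasse (f + g)) u v = psubst (hasse f) u v + psubst (hasse g) u v" for f g
    using psubst_add[of "hasse f" "hasse g" u v] by (simp add: hasse_add[abs_def])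
  show "wt_ge 1 1 n (psubst (hasse f) u v)" if "wt_ge 1 1 n f" for n f
  proof (rule wt_ge_psubst)
    fix k l
    have "wt_ge 1 1 (n - (k + l)) (hasse f k l)"
      using that by (auto simp: wt_ge_def hasse_def)
    moreover have "wt_ge 1 1 (1 * k + 1 * l) (u ^ k * v ^ l)"
      by (intro wt_ge_mult wt_ge_power) (simp_all add: wt_ge_11_1)
    ultimately have "wt_ge 1 1 (n - (k + l) + (1 * k + 1 * l)) (hasse f k l * (u ^ k * v ^ l))"
      by (rule wt_ge_mult)
    then show "wt_ge 1 1 n (hasse f k l * u ^ k * v ^ l)"
      by (auto simp: mult.assoc elim: wt_ge_mono)
  qed
  show "subst (const2 c * X2 ^ a * Y2 ^ b) (X2 + u) (Y2 + v)
      = psubst (hasse (const2 c * X2 ^ a * Y2 ^ b)) u v" for c a b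
  proof (rule series2_eqI)
    fix i j
    define N where "N = Suc (i + j + a + b)"
    have box: "sum h {..m} = (\<Sum>k<N. if k \<le> m then h k else 0)" if "m < N" for h :: "nat \<Rightarrow> series2" and m
      using that by (intro sum.mono_neutral_cong_left) auto
    have "const2 c * (X2 + u) ^ a * (Y2 + v) ^ b = const2 c
        * (\<Sum>k\<le>a. of_nat (a choose k) * u ^ k * X2 ^ (a - k))
        * (\<Sum>l\<le>b. of_nat (b choose l) * v ^ l * Y2 ^ (b - l))"
      by (simp only: mult.assoc binomial_ring[of u X2 a] binomial_ring[of v Y2 b] add.commute[of X2] add.commute[of Y2])
    also have "\<dots> = (\<Sum>k\<le>a. \<Sum>l\<le>b. hasse (const2 c * X2 ^ a * Y2 ^ b) k l * u ^ k * v ^ l)"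
      unfolding mult.assoc[of "const2 c"] unfolding sum_product unfolding sum_distrib_left
      by (intro sum.cong refl)
        (simp only: mult.assoc[of "const2 c" "X2 ^ a" "Y2 ^ b", symmetric] hasse_monomial, simp add: mult_ac)
    also have "\<dots> = (\<Sum>k<N. \<Sum>l<N. hasse (const2 c * X2 ^ a * Y2 ^ b) k l * u ^ k * v ^ l)"
    proof -
      have "(\<Sum>l\<le>b. hasse (const2 c * X2 ^ a * Y2 ^ b) k l * u ^ k * v ^ l)
          = (\<Sum>l<N. hasse (const2 c * X2 ^ a * Y2 ^ b) k l * u ^ k * v ^ l)" for k
        by (rule sum.mono_neutral_left) (auto simp: N_def hasse_monomial)
      then show ?thesis
        by simp (rule sum.mono_neutral_left, auto simp: N_def hasse_monomial)
    qed
    finally have *: "const2 c * (X2 + u) ^ a * (Y2 + v) ^ b =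
        (\<Sum>k<N. \<Sum>l<N. hasse (const2 c * X2 ^ a * Y2 ^ b) k l * u ^ k * v ^ l)" .
    show "coeff2 (subst (const2 c * X2 ^ a * Y2 ^ b) (X2 + u) (Y2 + v)) i j
        = coeff2 (psubst (hasse (const2 c * X2 ^ a * Y2 ^ b)) u v) i j"
      by (subst coeff2_psubst[of _ _ _ _ N N])
        (simp_all add: subst_monomial coeff2_X2 coeff2_Y2 * N_def del: coeff2_sum)
  qed
qed (auto simp: subst_add coeff2_X2 coeff2_Y2 simp del: One_nat_def intro!: wt_ge_subst_11)


section \<open>Majorant norms\<close>

text \<open>\<open>nrm n r s\<close> is a partial sum of the norm \<open>\<Sum>|a\<^sub>i\<^sub>j| r\<^sup>i s\<^sup>j\<close>. It is submultiplicative already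
  for fixed \<open>n\<close>, which gives all estimates without infinite sums.\<close>

definition nrm :: "nat \<Rightarrow> real \<Rightarrow> real \<Rightarrow> series2 \<Rightarrow> real" where
  "nrm n r s f = (\<Sum>i<n. \<Sum>j<n. norm (coeff2 f i j) * r ^ i * s ^ j)"

definition mbound :: "real \<Rightarrow> real \<Rightarrow> real \<Rightarrow> series2 \<Rightarrow> bool" where
  "mbound r s C f \<longleftrightarrow> (\<forall>n. nrm n r s f \<le> C)"

lemma mboundD: "mbound r s C f \<Longrightarrow> nrm n r s f \<le> C"
  by (simp add: mbound_def)

lemma nrm_nonneg: "0 \<le> r \<Longrightarrow> 0 \<le> s \<Longrightarrow> 0 \<le> nrm n r s f"
  by (auto simp: nrm_def intro!: sum_nonneg mult_nonneg_nonneg)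

lemma mbound_nonneg: "mbound r s C f \<Longrightarrow> 0 \<le> C"
  using mboundD[of r s C f 0] by (simp add: nrm_def)

lemma nrm_0 [simp]: "nrm n r s 0 = 0"
  and nrm_uminus [simp]: "nrm n r s (- f) = nrm n r s f"
  by (simp_all add: nrm_def)

lemma nrm_add: "0 \<le> r \<Longrightarrow> 0 \<le> s \<Longrightarrow> nrm n r s (f + g) \<le> nrm n r s f + nrm n r s g"
  unfolding nrm_def sum.distrib[symmetric]
  by (intro sum_mono) (auto simp flip: distrib_right intro!: mult_right_mono norm_triangle_ineq)

lemma nrm_sum: "0 \<le> r \<Longrightarrow> 0 \<le> s \<Longrightarrow> nrm n r s (sum f A) \<le> (\<Sum>a\<in>A. nrm n r s (f a))"
proof (induction A rule: infinite_finite_induct)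
  case (insert x F)
  then show ?case
    using nrm_add[of r s n "f x" "sum f F"] by simp
qed simp_all

lemma sum_convolution_le:
  fixes F :: "nat \<Rightarrow> nat \<Rightarrow> real"
  assumes "\<And>a b. 0 \<le> F a b"
  shows "(\<Sum>i<n. \<Sum>a\<le>i. F a (i - a)) \<le> (\<Sum>a<n. \<Sum>b<n. F a b)"
proof -
  have "(\<Sum>i<n. \<Sum>a\<le>i. F a (i - a)) = (\<Sum>(a, b)\<in>{(a, b). a + b < n}. F a b)"
    by (rule sum.triangle_reindex[symmetric])
  also have "\<dots> \<le> (\<Sum>(a, b)\<in>{..<n} \<times> {..<n}. F a b)"
    using assms by (intro sum_mono2) auto
  also have "\<dots> = (\<Sum>a<n. \<Sum>b<n. F a b)"
    by (simp add: sum.cartesian_product)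
  finally show ?thesis .
qed

lemma nrm_mult:
  assumes [simp]: "0 \<le> r" "0 \<le> s"
  shows "nrm n r s (f * g) \<le> nrm n r s f * nrm n r s g"
proof -
  define \<alpha> \<beta> where "\<alpha> = (\<lambda>i j. norm (coeff2 f i j) * r ^ i * s ^ j)"
    and "\<beta> = (\<lambda>i j. norm (coeff2 g i j) * r ^ i * s ^ j)"
  have [simp]: "0 \<le> \<alpha> i j" "0 \<le> \<beta> i j" for i j
    by (simp_all add: \<alpha>_def \<beta>_def)
  have "norm (coeff2 (f * g) i j) * r ^ i * s ^ j
      \<le> (\<Sum>j1\<le>j. \<Sum>i1\<le>i. \<alpha> i1 j1 * \<beta> (i - i1) (j - j1))" for i j
  proof -
    have "norm (coeff2 (f * g) i j)
        \<le> (\<Sum>j1\<le>j. \<Sum>i1\<le>i. norm (coeff2 f i1 j1) * norm (coeff2 g (i - i1) (j - j1)))"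
      unfolding coeff2_mult by (intro order.trans[OF norm_sum] sum_mono) (simp add: norm_mult)
    then have "norm (coeff2 (f * g) i j) * (r ^ i * s ^ j)
        \<le> (\<Sum>j1\<le>j. \<Sum>i1\<le>i. norm (coeff2 f i1 j1) * norm (coeff2 g (i - i1) (j - j1))) * (r ^ i * s ^ j)"
      by (intro mult_right_mono) auto
    also have "\<dots> = (\<Sum>j1\<le>j. \<Sum>i1\<le>i. \<alpha> i1 j1 * \<beta> (i - i1) (j - j1))"
      unfolding sum_distrib_right
    proof (intro sum.cong refl)
      fix j1 i1 assume "j1 \<in> {..j}" "i1 \<in> {..i}"
      then have "r ^ i = r ^ i1 * r ^ (i - i1)" "s ^ j = s ^ j1 * s ^ (j - j1)"
        by (simp_all flip: power_add)
      then show "norm (coeff2 f i1 j1) * norm (coeff2 g (i - i1) (j - j1)) * (r ^ i * s ^ j)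
          = \<alpha> i1 j1 * \<beta> (i - i1) (j - j1)"
        by (simp add: \<alpha>_def \<beta>_def mult_ac)
    qed
    finally show ?thesis
      by (simp add: mult_ac)
  qed
  then have "nrm n r s (f * g) \<le> (\<Sum>i<n. \<Sum>j<n. \<Sum>j1\<le>j. \<Sum>i1\<le>i. \<alpha> i1 j1 * \<beta> (i - i1) (j - j1))"
    unfolding nrm_def by (intro sum_mono)
  also have "\<dots> \<le> (\<Sum>i<n. \<Sum>j1<n. \<Sum>j2<n. \<Sum>i1\<le>i. \<alpha> i1 j1 * \<beta> (i - i1) j2)"
    by (intro sum_mono sum_convolution_le[where F = "\<lambda>j1 j2. \<Sum>i1\<le>_. \<alpha> i1 j1 * \<beta> (_ - i1) j2"]
        sum_nonneg mult_nonneg_nonneg) simp_all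
  also have "\<dots> = (\<Sum>j1<n. \<Sum>j2<n. \<Sum>i<n. \<Sum>i1\<le>i. \<alpha> i1 j1 * \<beta> (i - i1) j2)"
    by (subst sum.swap) (intro sum.cong refl sum.swap)
  also have "\<dots> \<le> (\<Sum>j1<n. \<Sum>j2<n. \<Sum>i1<n. \<Sum>i2<n. \<alpha> i1 j1 * \<beta> i2 j2)"
    by (intro sum_mono sum_convolution_le[where F = "\<lambda>i1 i2. \<alpha> i1 _ * \<beta> i2 _"]) simp
  also have "\<dots> = (\<Sum>j1<n. \<Sum>i1<n. \<alpha> i1 j1) * (\<Sum>j2<n. \<Sum>i2<n. \<beta> i2 j2)"
    by (simp add: sum_product)
  also have "\<dots> = nrm n r s f * nrm n r s g"
    unfolding nrm_def \<alpha>_def \<beta>_def by (intro arg_cong2[of _ _ _ _ times] sum.swap)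
  finally show ?thesis .
qed

lemma nrm_const2: "0 \<le> r \<Longrightarrow> 0 \<le> s \<Longrightarrow> nrm n r s (const2 c) \<le> norm c"
proof -
  have "nrm n r s (const2 c) = (\<Sum>i<n. \<Sum>j<n. if i = 0 \<and> j = 0 then norm c else 0)"
    unfolding nrm_def by (intro sum.cong refl) (simp add: coeff2_const2)
  then show ?thesis
    by (simp add: sum_sum_delta)
qed

lemma nrm_power: "0 \<le> r \<Longrightarrow> 0 \<le> s \<Longrightarrow> nrm n r s (f ^ k) \<le> nrm n r s f ^ k"
proof (induction k)
  case 0
  then show ?case
    using nrm_const2[of r s n 1] by simp
next
  case (Suc k)
  then show ?case
    using nrm_mult[of r s n f "f ^ k"] mult_left_mono[OF Suc.IH nrm_nonneg[of r s n f]] by simp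
qed

lemma mbound_0: "0 \<le> C \<Longrightarrow> mbound r s C 0"
  by (simp add: mbound_def)

lemma mbound_uminus: "mbound r s C f \<Longrightarrow> mbound r s C (- f)"
  by (simp add: mbound_def)

lemma mbound_add:
  "0 \<le> r \<Longrightarrow> 0 \<le> s \<Longrightarrow> mbound r s C f \<Longrightarrow> mbound r s D g \<Longrightarrow> mbound r s (C + D) (f + g)"
  unfolding mbound_def by (meson add_mono nrm_add order.trans)

lemma mbound_diff:
  "0 \<le> r \<Longrightarrow> 0 \<le> s \<Longrightarrow> mbound r s C f \<Longrightarrow> mbound r s D g \<Longrightarrow> mbound r s (C + D) (f - g)"
  using mbound_add[of r s C f D "- g"] mbound_uminus[of r s D g] by simp

lemma mbound_mult:
  assumes "0 \<le> r" "0 \<le> s" "mbound r s C f" "mbound r s D g"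
  shows "mbound r s (C * D) (f * g)"
  unfolding mbound_def
proof
  fix n
  have "nrm n r s f * nrm n r s g \<le> C * D"
    using assms mbound_nonneg[OF assms(3)] by (intro mult_mono) (auto simp: mboundD nrm_nonneg)
  then show "nrm n r s (f * g) \<le> C * D"
    using nrm_mult[of r s n f g] assms by linarith
qed

lemma mbound_const2: "0 \<le> r \<Longrightarrow> 0 \<le> s \<Longrightarrow> mbound r s (norm c) (const2 c)"
  by (simp add: mbound_def nrm_const2)

lemma mbound_mono: "mbound r s C f \<Longrightarrow> C \<le> D \<Longrightarrow> mbound r s D f"
  unfolding mbound_def by (meson order.trans)

lemma mbound_radius_mono:
  assumes "mbound r s C f" "0 \<le> r'" "r' \<le> r" "0 \<le> s'" "s' \<le> s"
  shows "mbound r' s' C f"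
  unfolding mbound_def
proof
  fix n
  have "nrm n r' s' f \<le> nrm n r s f"
    unfolding nrm_def using assms by (intro sum_mono mult_mono power_mono) auto
  then show "nrm n r' s' f \<le> C"
    using mboundD[OF assms(1), of n] by simp
qed

text \<open>Shrinking the radii makes a series without low order terms small.\<close>

lemma mbound_scale:
  assumes "mbound r s C f" "wt_ge u v n f" "0 \<le> t" "t \<le> 1" "0 \<le> r" "0 \<le> s"
  shows "mbound (t ^ u * r) (t ^ v * s) (t ^ n * C) f"
  unfolding mbound_def
proof
  fix N
  have "norm (coeff2 f i j) * (t ^ u * r) ^ i * (t ^ v * s) ^ j
      \<le> t ^ n * (norm (coeff2 f i j) * r ^ i * s ^ j)" for i j
  proof (cases "u * i + v * j < n")
    case True
    then show ?thesis
      using assms by (simp add: wt_ge_def)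
  next
    case False
    have "t ^ (u * i + v * j) * (norm (coeff2 f i j) * r ^ i * s ^ j)
        \<le> t ^ n * (norm (coeff2 f i j) * r ^ i * s ^ j)"
      using assms False by (intro mult_right_mono power_decreasing) auto
    moreover have "norm (coeff2 f i j) * (t ^ u * r) ^ i * (t ^ v * s) ^ j
        = t ^ (u * i + v * j) * (norm (coeff2 f i j) * r ^ i * s ^ j)"
      by (simp add: power_mult_distrib power_add power_mult)
    ultimately show ?thesis
      by linarith
  qed
  then have "nrm N (t ^ u * r) (t ^ v * s) f \<le> t ^ n * nrm N r s f"
    unfolding nrm_def sum_distrib_left by (intro sum_mono)
  also have "\<dots> \<le> t ^ n * C"
    using assms by (intro mult_left_mono mboundD) auto
  finally show "nrm N (t ^ u * r) (t ^ v * s) f \<le> t ^ n * C" .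
qed

lemma mbound_limit:
  assumes "\<And>N. \<exists>g. mbound r s C g \<and> wt_ge u v N (f - g)"
  shows "mbound r s C f"
  unfolding mbound_def
proof
  fix n
  obtain g where g: "mbound r s C g" "wt_ge u v (Suc (u * n + v * n)) (f - g)"
    using assms by blast
  have "coeff2 f i j = coeff2 g i j" if "i < n" "j < n" for i j
  proof -
    have "u * i + v * j \<le> u * n + v * n"
      using that by (intro add_mono mult_le_mono) auto
    then show ?thesis
      using wt_geD[OF g(2), of i j] by simp
  qed
  then have "nrm n r s f = nrm n r s g"
    by (simp add: nrm_def)
  then show "nrm n r s f \<le> C"
    using g(1) by (simp add: mboundD)
qed

lemma mbound_X2: "0 \<le> r \<Longrightarrow> mbound r s r X2" and mbound_Y2: "0 \<le> s \<Longrightarrow> mbound r s s Y2"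
proof -
  have "nrm n r s X2 = (\<Sum>i<n. \<Sum>j<n. if i = 1 \<and> j = 0 then r else 0)" for n
    unfolding nrm_def by (intro sum.cong refl) (simp add: coeff2_X2)
  then show "mbound r s r X2" if "0 \<le> r"
    using that by (simp add: mbound_def sum_sum_delta)
  have "nrm n r s Y2 = (\<Sum>i<n. \<Sum>j<n. if i = 0 \<and> j = 1 then s else 0)" for n
    unfolding nrm_def by (intro sum.cong refl) (simp add: coeff2_Y2)
  then show "mbound r s s Y2" if "0 \<le> s"
    using that by (simp add: mbound_def sum_sum_delta)
qed

lemma mbound_psubst:
  assumes pos: "0 \<le> r" "0 \<le> s" "coeff2 p 0 0 = 0" "coeff2 q 0 0 = 0"
    and p: "mbound r s U p" and q: "mbound r s V q"
    and c: "\<And>n M. (\<Sum>k<M. \<Sum>l<M. nrm n r s (c k l) * U ^ k * V ^ l) \<le> C"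
  shows "mbound r s C (psubst c p q)"
  unfolding mbound_def
proof
  fix n
  have UV: "0 \<le> U" "0 \<le> V"
    using p q by (simp_all add: mbound_nonneg)
  have "nrm n r s (psubst c p q) = nrm n r s (\<Sum>k<2*n. \<Sum>l<2*n. c k l * p ^ k * q ^ l)"
    unfolding nrm_def using pos
    by (intro sum.cong refl, subst coeff2_psubst[where K = "2*n" and L = "2*n"]) auto
  also have "\<dots> \<le> (\<Sum>k<2*n. \<Sum>l<2*n. nrm n r s (c k l * p ^ k * q ^ l))"
    using pos by (intro order.trans[OF nrm_sum] sum_mono nrm_sum)
  also have "\<dots> \<le> (\<Sum>k<2*n. \<Sum>l<2*n. nrm n r s (c k l) * U ^ k * V ^ l)"
  proof (intro sum_mono)
    fix k l
    have "nrm n r s (c k l * p ^ k * q ^ l) \<le> nrm n r s (c k l * p ^ k) * nrm n r s (q ^ l)"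
      using pos by (intro nrm_mult)
    also have "\<dots> \<le> (nrm n r s (c k l) * nrm n r s (p ^ k)) * nrm n r s (q ^ l)"
      using pos by (intro mult_right_mono nrm_mult nrm_nonneg)
    also have "\<dots> \<le> (nrm n r s (c k l) * U ^ k) * V ^ l"
      using pos UV p q
      by (intro mult_mono order.refl order.trans[OF nrm_power] power_mono mboundD mult_nonneg_nonneg
          zero_le_power nrm_nonneg)
    finally show "nrm n r s (c k l * p ^ k * q ^ l) \<le> nrm n r s (c k l) * U ^ k * V ^ l" .
  qed
  also have "\<dots> \<le> C"
    by (rule c)
  finally show "nrm n r s (psubst c p q) \<le> C" .
qed

lemma mbound_subst:
  assumes "0 \<le> r" "0 \<le> s" "coeff2 p 0 0 = 0" "coeff2 q 0 0 = 0"
    and "mbound r s U p" "mbound r s V q" "mbound U V C f"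
  shows "mbound r s C (subst f p q)"
  unfolding subst_def
proof (rule mbound_psubst)
  fix n M
  have "(\<Sum>k<M. \<Sum>l<M. nrm n r s (const2 (coeff2 f k l)) * U ^ k * V ^ l) \<le> nrm M U V f"
    unfolding nrm_def[of M] using assms mbound_nonneg[OF assms(5)] mbound_nonneg[OF assms(6)]
    by (intro sum_mono mult_right_mono nrm_const2) simp_all
  then show "(\<Sum>k<M. \<Sum>l<M. nrm n r s (const2 (coeff2 f k l)) * U ^ k * V ^ l) \<le> C"
    using mboundD[OF assms(7), of M] by linarith
qed (use assms in auto)

text \<open>By the binomial theorem the weighted norms of the Hasse derivatives add up to at most the norm of \<open>f\<close>
  for the enlarged radii. The next lemma is the case of one variable.\<close>

lemma sum_taylor_le:
  assumes "\<And>I. 0 \<le> F I" "0 \<le> r" "0 \<le> t"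
  shows "(\<Sum>k<M. \<Sum>i<n. real ((i + k) choose k) * F (i + k) * r ^ i * t ^ k)
    \<le> (\<Sum>I<M + n. F I * (r + t) ^ I)"
proof -
  have "(\<Sum>k<M. \<Sum>i<n. real ((i + k) choose k) * F (i + k) * r ^ i * t ^ k)
      = (\<Sum>(k, i)\<in>{..<M} \<times> {..<n}. real ((i + k) choose k) * F (i + k) * r ^ i * t ^ k)"
    by (simp add: sum.cartesian_product)
  also have "\<dots> \<le> (\<Sum>(k, i)\<in>{(k, i). k + i < M + n}. real ((i + k) choose k) * F (i + k) * r ^ i * t ^ k)"
  proof (rule sum_mono2)
    have "{(k, i). k + i < M + n} \<subseteq> {..<M + n} \<times> {..<M + n}"
      by auto
    then show "finite {(k, i). k + i < M + n}"
      by (rule finite_subset) simp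
  qed (use assms in auto)
  also have "\<dots> = (\<Sum>I<M + n. \<Sum>k\<le>I. real ((I - k + k) choose k) * F (I - k + k) * r ^ (I - k) * t ^ k)"
    by (rule sum.triangle_reindex)
  also have "\<dots> = (\<Sum>I<M + n. F I * (r + t) ^ I)"
    by (simp add: binomial_ring[of t r] sum_distrib_left add.commute[of r] mult_ac)
  finally show ?thesis .
qed

lemma sum_nrm_hasse_le:
  assumes "0 \<le> r" "0 \<le> s" "0 \<le> t" "0 \<le> w"
  shows "(\<Sum>k<M. \<Sum>l<M. nrm n r s (hasse f k l) * t ^ k * w ^ l) \<le> nrm (M + n) (r + t) (s + w) f"
proof -
  define G where "G = (\<lambda>I. \<Sum>J<M + n. norm (coeff2 f I J) * (s + w) ^ J)"
  have "(\<Sum>k<M. \<Sum>l<M. nrm n r s (hasse f k l) * t ^ k * w ^ l)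
      = (\<Sum>k<M. \<Sum>l<M. \<Sum>i<n. \<Sum>j<n. real ((i + k) choose k) * r ^ i * t ^ k *
           (real ((j + l) choose l) * norm (coeff2 f (i + k) (j + l)) * s ^ j * w ^ l))"
    by (simp add: nrm_def hasse_def norm_mult sum_distrib_right sum_distrib_left mult_ac)
  also have "\<dots> = (\<Sum>k<M. \<Sum>i<n. real ((i + k) choose k) * r ^ i * t ^ k * (\<Sum>l<M. \<Sum>j<n.
           real ((j + l) choose l) * norm (coeff2 f (i + k) (j + l)) * s ^ j * w ^ l))"
    by (simp add: sum_distrib_left) (intro sum.cong refl sum.swap)
  also have "\<dots> \<le> (\<Sum>k<M. \<Sum>i<n. real ((i + k) choose k) * r ^ i * t ^ k * G (i + k))"
    unfolding G_def using assms by (intro sum_mono mult_left_mono sum_taylor_le) auto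
  also have "\<dots> = (\<Sum>k<M. \<Sum>i<n. real ((i + k) choose k) * G (i + k) * r ^ i * t ^ k)"
    by (simp add: mult_ac)
  also have "\<dots> \<le> (\<Sum>I<M + n. G I * (r + t) ^ I)"
    using assms by (intro sum_taylor_le) (auto simp: G_def intro!: sum_nonneg)
  also have "\<dots> = nrm (M + n) (r + t) (s + w) f"
    by (simp add: nrm_def G_def sum_distrib_right sum_distrib_left mult_ac)
  finally show ?thesis .
qed

text \<open>The bound needed for the quadratic terms of a Taylor expansion, whose coefficients are the
  Hasse derivatives with indices shifted by \<open>(a, b)\<close>.\<close>

lemma sum_nrm_shifted_hasse_le:
  assumes pos: "0 \<le> r" "0 \<le> s" "0 < t" "0 < w" and f: "mbound (r + t) (s + w) C f"
    and c: "\<And>k l. c k l = hasse f (k + a) (l + b) \<or> c k l = 0"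
  shows "(\<Sum>k<M. \<Sum>l<M. nrm n r s (c k l) * t ^ k * w ^ l) \<le> C / (t ^ a * w ^ b)"
proof -
  define h where "h = (\<lambda>k l. nrm n r s (hasse f k l) * t ^ k * w ^ l)"
  have h: "0 \<le> h k l" for k l
    using pos by (simp add: h_def nrm_nonneg)
  have "nrm n r s (c k l) \<le> nrm n r s (hasse f (k + a) (l + b))" for k l
    using c[of k l] nrm_nonneg[OF pos(1,2)] by auto
  then have "(\<Sum>k<M. \<Sum>l<M. nrm n r s (c k l) * t ^ k * w ^ l) * (t ^ a * w ^ b)
      \<le> (\<Sum>k<M. \<Sum>l<M. nrm n r s (hasse f (k + a) (l + b)) * t ^ k * w ^ l) * (t ^ a * w ^ b)"
    using pos by (intro sum_mono mult_right_mono) auto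
  also have "\<dots> = (\<Sum>(k, l)\<in>{..<M} \<times> {..<M}. h (k + a) (l + b))"
    by (simp add: h_def sum_distrib_right sum_distrib_left power_add mult_ac flip: sum.cartesian_product)
  also have "\<dots> = (\<Sum>(k, l)\<in>(\<lambda>(k, l). (k + a, l + b)) ` ({..<M} \<times> {..<M}). h k l)"
    by (subst sum.reindex) (auto simp: inj_on_def case_prod_beta)
  also have "\<dots> \<le> (\<Sum>(k, l)\<in>{..<M + a + b} \<times> {..<M + a + b}. h k l)"
    using h by (intro sum_mono2) auto
  also have "\<dots> \<le> nrm (M + a + b + n) (r + t) (s + w) f"
    unfolding h_def sum.cartesian_product[symmetric] using pos by (intro sum_nrm_hasse_le) auto
  also have "\<dots> \<le> C"
    using f by (rule mboundD)
  finally show ?thesis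
    using pos by (simp add: pos_le_divide_eq)
qed

lemma mbound_hasse:
  assumes "0 \<le> r" "0 \<le> s" "0 < t" "0 < w" "mbound (r + t) (s + w) C f"
  shows "mbound r s (C / (t ^ a * w ^ b)) (hasse f a b)"
  unfolding mbound_def
proof
  fix n
  show "nrm n r s (hasse f a b) \<le> C / (t ^ a * w ^ b)"
    using sum_nrm_shifted_hasse_le[OF assms, of "\<lambda>k l. hasse f (k + a) (l + b)" a b n 1] by simp
qed


section \<open>Convergent series\<close>

text \<open>The subring of the series that converge absolutely on the closed polydisc of radii
  \<open>r\<close>, \<open>s\<close>.\<close>

definition conv_on :: "real \<Rightarrow> real \<Rightarrow> series2 set" where
  "conv_on r s = {f. \<exists>C. mbound r s C f}"

lemma conv_onI: "mbound r s C f \<Longrightarrow> f \<in> conv_on r s"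
  by (auto simp: conv_on_def)

lemma conv_on_ring:
  assumes [simp]: "0 \<le> r" "0 \<le> s"
  shows "f \<in> conv_on r s \<Longrightarrow> g \<in> conv_on r s \<Longrightarrow> f + g \<in> conv_on r s"
    and "f \<in> conv_on r s \<Longrightarrow> g \<in> conv_on r s \<Longrightarrow> f - g \<in> conv_on r s"
    and "f \<in> conv_on r s \<Longrightarrow> g \<in> conv_on r s \<Longrightarrow> f * g \<in> conv_on r s"
    and "f \<in> conv_on r s \<Longrightarrow> - f \<in> conv_on r s"
    and "const2 c \<in> conv_on r s" "0 \<in> conv_on r s" "1 \<in> conv_on r s"
    and "X2 \<in> conv_on r s" "Y2 \<in> conv_on r s"
  unfolding conv_on_def mem_Collect_eq const2_1[symmetric]
  by (fastforce intro: mbound_add[OF assms] mbound_diff[OF assms] mbound_mult[OF assms]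
      mbound_uminus mbound_const2[OF assms] mbound_0[OF order.refl] mbound_X2 mbound_Y2)+

lemma conv_on_power: "0 \<le> r \<Longrightarrow> 0 \<le> s \<Longrightarrow> f \<in> conv_on r s \<Longrightarrow> f ^ n \<in> conv_on r s"
  by (induction n) (auto simp: conv_on_ring)

lemma conv_on_sum:
  "0 \<le> r \<Longrightarrow> 0 \<le> s \<Longrightarrow> (\<And>a. a \<in> A \<Longrightarrow> f a \<in> conv_on r s) \<Longrightarrow> sum f A \<in> conv_on r s"
  by (induction A rule: infinite_finite_induct) (auto simp: conv_on_ring)

lemma conv_on_mono:
  "f \<in> conv_on r s \<Longrightarrow> 0 \<le> r' \<Longrightarrow> r' \<le> r \<Longrightarrow> 0 \<le> s' \<Longrightarrow> s' \<le> s \<Longrightarrow> f \<in> conv_on r' s'"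
  unfolding conv_on_def using mbound_radius_mono by blast

lemma finite_subset_box:
  assumes "finite (F :: (nat \<times> nat) set)"
  obtains n where "F \<subseteq> {..<n} \<times> {..<n}"
proof -
  obtain n where "\<forall>k\<in>fst ` F \<union> snd ` F. k < n"
    using assms finite_nat_set_iff_bounded[of "fst ` F \<union> snd ` F"] by auto
  then have "F \<subseteq> {..<n} \<times> {..<n}"
    by force
  then show ?thesis
    using that by blast
qed

lemma mbound_summable:
  assumes f: "mbound r s C f" and xy: "norm x \<le> r" "norm y \<le> s"
  shows "(\<lambda>(i, j). norm (coeff2 f i j * x ^ i * y ^ j)) summable_on UNIV"
    and "infsum (\<lambda>(i, j). norm (coeff2 f i j * x ^ i * y ^ j)) UNIV \<le> C"
proof -
  have le: "(\<Sum>(i, j)\<in>F. norm (coeff2 f i j * x ^ i * y ^ j)) \<le> C" if fin: "finite F" for F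
  proof -
    obtain n where n: "F \<subseteq> {..<n} \<times> {..<n}"
      using fin by (rule finite_subset_box)
    have "(\<Sum>(i, j)\<in>F. norm (coeff2 f i j * x ^ i * y ^ j))
        \<le> (\<Sum>(i, j)\<in>{..<n} \<times> {..<n}. norm (coeff2 f i j * x ^ i * y ^ j))"
      by (rule sum_mono2) (use n in auto)
    also have "\<dots> = (\<Sum>i<n. \<Sum>j<n. norm (coeff2 f i j * x ^ i * y ^ j))"
      by (simp add: sum.cartesian_product)
    also have "\<dots> \<le> nrm n r s f"
      unfolding nrm_def using xy
      by (intro sum_mono) (auto simp: norm_mult norm_power intro!: mult_mono power_mono mult_nonneg_nonneg zero_le_power order.trans[OF norm_ge_zero xy(1)])
    finally show ?thesis
      using mboundD[OF f, of n] by linarith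
  qed
  show s: "(\<lambda>(i, j). norm (coeff2 f i j * x ^ i * y ^ j)) summable_on UNIV"
    by (rule nonneg_bounded_partial_sums_imp_summable_on[where C = C])
      (auto simp: le intro!: eventually_finite_subsets_at_top_weakI)
  show "infsum (\<lambda>(i, j). norm (coeff2 f i j * x ^ i * y ^ j)) UNIV \<le> C"
    by (rule infsum_le_finite_sums[OF s]) (auto simp: le)
qed

lemma convergent_series_iff: "f \<in> convergent_series \<longleftrightarrow> (\<exists>r>0. f \<in> conv_on r r)"
proof
  assume "f \<in> convergent_series"
  then have "\<forall>\<^sub>F z in nhds (0, 0). (\<lambda>(i, j). norm (coeff2 f i j * fst z ^ i * snd z ^ j)) summable_on UNIV"
    by (auto simp: convergent_series_def elim!: eventually_mono)
  then obtain e where e: "e > 0"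
    "\<And>z. dist z (0, 0) < e \<Longrightarrow> (\<lambda>(i, j). norm (coeff2 f i j * fst z ^ i * snd z ^ j)) summable_on UNIV"
    unfolding eventually_nhds_metric by blast
  define r where "r = e / 3"
  have "dist (complex_of_real r, complex_of_real r) (0, 0) < e"
    using sqrt_sum_squares_le_sum[of r r] e(1) by (simp add: dist_Pair_Pair r_def)
  then have s: "(\<lambda>(i, j). norm (coeff2 f i j * of_real r ^ i * of_real r ^ j)) summable_on UNIV"
    using e(2) by fastforce
  have "nrm n r r f \<le> infsum (\<lambda>(i, j). norm (coeff2 f i j * of_real r ^ i * of_real r ^ j)) UNIV" for n
  proof -
    have "nrm n r r f = (\<Sum>(i, j)\<in>{..<n} \<times> {..<n}. norm (coeff2 f i j * of_real r ^ i * of_real r ^ j))"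
      using e(1) by (simp add: nrm_def sum.cartesian_product[symmetric] norm_mult norm_power r_def)
    also have "\<dots> \<le> infsum (\<lambda>(i, j). norm (coeff2 f i j * of_real r ^ i * of_real r ^ j)) UNIV"
      using s by (intro finite_sum_le_infsum) auto
    finally show ?thesis .
  qed
  then show "\<exists>r>0. f \<in> conv_on r r"
    using e(1) by (intro exI[of _ r]) (auto simp: r_def conv_on_def mbound_def)
next
  assume "\<exists>r>0. f \<in> conv_on r r"
  then obtain r C where r: "r > 0" "mbound r r C f"
    by (auto simp: conv_on_def)
  have "\<forall>\<^sub>F z in nhds (0, 0). z \<in> ball (0::complex) r \<times> ball (0::complex) r"
    using r by (intro eventually_nhds_in_open open_Times) auto
  then show "f \<in> convergent_series"
    unfolding convergent_series_def using mbound_summable(1)[OF r(2)]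
    by (auto simp: case_prod_beta elim!: eventually_mono)
qed

lemma convergent_seriesE2:
  assumes "f \<in> convergent_series" "g \<in> convergent_series"
  obtains r where "r > 0" "f \<in> conv_on r r" "g \<in> conv_on r r"
proof -
  obtain r1 r2 where "r1 > 0" "f \<in> conv_on r1 r1" "r2 > 0" "g \<in> conv_on r2 r2"
    using assms by (auto simp: convergent_series_iff)
  then show ?thesis
    using that[of "min r1 r2"] conv_on_mono[of f r1 r1 "min r1 r2" "min r1 r2"]
      conv_on_mono[of g r2 r2 "min r1 r2" "min r1 r2"] by auto
qed

lemma conv_on_imp_convergent:
  assumes "f \<in> conv_on r s" "r > 0" "s > 0"
  shows "f \<in> convergent_series"
  unfolding convergent_series_iff
  using assms by (intro exI[of _ "min r s"]) (auto intro!: conv_on_mono[of f r s])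

lemma convergent_ring:
  "f \<in> convergent_series \<Longrightarrow> g \<in> convergent_series \<Longrightarrow> f + g \<in> convergent_series"
  "f \<in> convergent_series \<Longrightarrow> g \<in> convergent_series \<Longrightarrow> f - g \<in> convergent_series"
  "f \<in> convergent_series \<Longrightarrow> g \<in> convergent_series \<Longrightarrow> f * g \<in> convergent_series"
  "f \<in> convergent_series \<Longrightarrow> - f \<in> convergent_series"
  "const2 c \<in> convergent_series" "0 \<in> convergent_series" "1 \<in> convergent_series"
  "X2 \<in> convergent_series" "Y2 \<in> convergent_series"
proof -
  show "f \<in> convergent_series \<Longrightarrow> g \<in> convergent_series \<Longrightarrow> f + g \<in> convergent_series"
    "f \<in> convergent_series \<Longrightarrow> g \<in> convergent_series \<Longrightarrow> f - g \<in> convergent_series"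
    "f \<in> convergent_series \<Longrightarrow> g \<in> convergent_series \<Longrightarrow> f * g \<in> convergent_series"
    by (erule (1) convergent_seriesE2, rule conv_on_imp_convergent, rule conv_on_ring, auto)+
  show "f \<in> convergent_series \<Longrightarrow> - f \<in> convergent_series"
    unfolding convergent_series_iff by (auto intro!: conv_on_ring)
qed (rule conv_on_imp_convergent[of _ 1 1], rule conv_on_ring, simp_all)+

lemma convergent_power: "f \<in> convergent_series \<Longrightarrow> f ^ n \<in> convergent_series"
  by (induction n) (auto simp: convergent_ring)

lemma convergent_sum: "(\<And>a. a \<in> A \<Longrightarrow> f a \<in> convergent_series) \<Longrightarrow> sum f A \<in> convergent_series"
  by (induction A rule: infinite_finite_induct) (auto simp: convergent_ring)

lemma convergent_box_part: "box_part n f \<in> convergent_series"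
  unfolding box_part_def by (intro convergent_sum convergent_ring convergent_power)

text \<open>A convergent series of order at least \<open>n\<close> is \<open>O(t\<^sup>n)\<close> on the polydisc of radius
  \<open>t r\<close>.\<close>

lemma convergent_bound:
  assumes "f \<in> convergent_series" "wt_ge 1 1 n f"
  obtains r C where "0 < r" "0 \<le> C" "\<And>t. 0 \<le> t \<Longrightarrow> t \<le> 1 \<Longrightarrow> mbound (t * r) (t * r) (t ^ n * C) f"
proof -
  obtain r C where r: "r > 0" "mbound r r C f"
    using assms(1) by (auto simp: convergent_series_iff conv_on_def)
  then show ?thesis
    using that[of r C] mbound_scale[OF r(2) assms(2)] mbound_nonneg[OF r(2)] by auto
qed

lemma convergent_small:
  assumes "f \<in> convergent_series" "coeff2 f 0 0 = 0" "0 < e"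
  obtains r where "0 < r" "\<And>r'. 0 \<le> r' \<Longrightarrow> r' \<le> r \<Longrightarrow> mbound r' r' e f"
proof -
  have "wt_ge 1 1 1 f"
    using assms by (simp add: wt_ge_11_1)
  with assms obtain r C where r: "0 < r" "0 \<le> C"
    "\<And>t. 0 \<le> t \<Longrightarrow> t \<le> 1 \<Longrightarrow> mbound (t * r) (t * r) (t ^ 1 * C) f"
    by (metis convergent_bound)
  define t where "t = min 1 (e / (C + 1))"
  have t: "0 < t" "t \<le> 1" "t * C \<le> e"
  proof -
    show "0 < t" "t \<le> 1"
      using assms r by (auto simp: t_def)
    have "t * C \<le> e / (C + 1) * (C + 1)"
      using r assms by (intro mult_mono) (auto simp: t_def)
    then show "t * C \<le> e"
      using r by simp
  qed
  have "mbound (t * r) (t * r) e f"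
    using r(3)[of t] t by (auto intro: mbound_mono)
  then show ?thesis
    using that[of "t * r"] t r(1) by (auto intro: mbound_radius_mono)
qed

lemma convergent_subst:
  assumes "f \<in> convergent_series" "p \<in> convergent_series" "q \<in> convergent_series"
    and "coeff2 p 0 0 = 0" "coeff2 q 0 0 = 0"
  shows "subst f p q \<in> convergent_series"
proof -
  obtain r C where r: "r > 0" "mbound r r C f"
    using assms(1) by (auto simp: convergent_series_iff conv_on_def)
  obtain r1 r2 where "r1 > 0" "\<And>r'. 0 \<le> r' \<Longrightarrow> r' \<le> r1 \<Longrightarrow> mbound r' r' r p"
    and "r2 > 0" "\<And>r'. 0 \<le> r' \<Longrightarrow> r' \<le> r2 \<Longrightarrow> mbound r' r' r q"
    using convergent_small assms r(1) by metis
  then have "mbound (min r1 r2) (min r1 r2) C (subst f p q)" "min r1 r2 > 0"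
    using r assms by (auto intro!: mbound_subst[where U = r and V = r])
  then show ?thesis
    unfolding convergent_series_iff conv_on_def by blast
qed

lemma convergent_hasse:
  assumes "f \<in> convergent_series"
  shows "hasse f a b \<in> convergent_series"
proof -
  obtain r C where r: "r > 0" "mbound r r C f"
    using assms(1) by (auto simp: convergent_series_iff conv_on_def)
  then have "mbound (r/2) (r/2) (C / ((r/2) ^ a * (r/2) ^ b)) (hasse f a b)"
    by (intro mbound_hasse) auto
  then show ?thesis
    using r(1) unfolding convergent_series_iff conv_on_def by (intro exI[of _ "r/2"]) auto
qed

lemma convergent_deriv:
  "f \<in> convergent_series \<Longrightarrow> deriv_x f \<in> convergent_series"
  "f \<in> convergent_series \<Longrightarrow> deriv_y f \<in> convergent_series"
  using convergent_hasse[of f 1 0] convergent_hasse[of f 0 1] by (simp_all add: hasse_1_0 hasse_0_1 flip: One_nat_def)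

text \<open>A system of equations \<open>z = \<Psi> z\<close> for power series whose right-hand side gains one order
  has a solution by iteration. As majorant bounds pass to limits of coefficients, the solution is
  convergent when \<open>\<Psi>\<close> preserves some ball of series bounded by \<open>\<rho>\<close>.\<close>

lemma fixed_point:
  fixes \<Psi> :: "('i \<Rightarrow> series2) \<Rightarrow> ('i \<Rightarrow> series2)" and r s \<rho> :: real and e :: nat
  defines "S \<equiv> {z. \<forall>a. wt_ge 1 1 e (z a) \<and> mbound r s \<rho> (z a)}"
  assumes "0 \<le> \<rho>" and maps: "\<And>z. z \<in> S \<Longrightarrow> \<Psi> z \<in> S"
    and contr: "\<And>z z' n a. z \<in> S \<Longrightarrow> z' \<in> S \<Longrightarrow> (\<And>b. wt_ge u v n (z b - z' b)) \<Longrightarrow>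
      wt_ge u v (Suc n) (\<Psi> z a - \<Psi> z' a)"
  obtains z where "z \<in> S" "\<Psi> z = z"
proof -
  define Z where "Z n = (\<Psi> ^^ n) (\<lambda>_. 0)" for n
  have ZS: "Z n \<in> S" for n
    using assms(2) by (induction n) (auto simp: Z_def S_def[symmetric] maps, simp add: S_def mbound_0)
  have Suc: "wt_ge u v n (Z (Suc n) a - Z n a)" for n a
  proof (induction n arbitrary: a)
    case (Suc n)
    then show ?case
      using contr[OF ZS ZS, of n "Suc n" n] by (simp add: Z_def)
  qed simp
  have Z: "wt_ge u v n (Z m a - Z n a)" if "n \<le> m" for n m a
    using that
  proof (induction m rule: dec_induct)
    case (step m)
    then show ?case
      using wt_ge_mono[OF Suc[of m a], of n] by (auto intro: wt_ge_diff_trans)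
  qed simp
  define z where "z a = series_of_coeffs (\<lambda>i j. coeff2 (Z (Suc (u * i + v * j)) a) i j)" for a
  have zZ: "wt_ge u v n (z a - Z n a)" for n a
    unfolding wt_ge_def
  proof (intro allI impI)
    fix i j assume "u * i + v * j < n"
    then show "coeff2 (z a - Z n a) i j = 0"
      using wt_geD[OF Z[of "Suc (u * i + v * j)" n a], of i j] by (simp add: z_def)
  qed
  have zS: "z \<in> S"
    unfolding S_def mem_Collect_eq
  proof (intro allI conjI)
    fix a
    show "wt_ge 1 1 e (z a)"
      using ZS by (auto simp: z_def wt_ge_def S_def)
    show "mbound r s \<rho> (z a)"
    proof (rule mbound_limit[of _ _ _ u v])
      show "\<exists>g. mbound r s \<rho> g \<and> wt_ge u v N (z a - g)" for N
        using ZS[of N] zZ[of N a] by (auto simp: S_def)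
    qed
  qed
  have "\<Psi> z a = z a" for a
  proof (rule series2_eqI)
    fix i j
    let ?n = "u * i + v * j"
    have "wt_ge u v (Suc ?n) (\<Psi> z a - Z (Suc ?n) a)"
      using contr[OF zS ZS zZ, of ?n a] by (simp add: Z_def)
    then have "wt_ge u v (Suc ?n) (\<Psi> z a - z a)"
      using wt_ge_diff_trans wt_ge_diff_sym zZ by blast
    then show "coeff2 (\<Psi> z a) i j = coeff2 (z a) i j"
      using wt_geD by fastforce
  qed
  then show ?thesis
    using that zS by blast
qed

text \<open>The inverse of \<open>c + h\<close> is the solution of \<open>z = (1 - h z) / c\<close>.\<close>

lemma convergent_unit:
  assumes "f \<in> convergent_series" "coeff2 f 0 0 \<noteq> 0"
  obtains g where "g \<in> convergent_series" "f * g = 1"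
proof -
  define c where "c = coeff2 f 0 0"
  define h where "h = f - const2 c"
  have c: "c \<noteq> 0"
    using assms by (simp add: c_def)
  have h: "h \<in> convergent_series" "coeff2 h 0 0 = 0"
    using assms by (auto simp: h_def c_def convergent_ring coeff2_const2)
  obtain r where r: "0 < r" "mbound r r (norm c / 2) h"
    by (rule convergent_small[OF h, of "norm c / 2"]) (use c in \<open>auto\<close>)
  define \<Psi> where "\<Psi> z = (\<lambda>a::unit. const2 (1 / c) * (1 - h * z a))" for z
  obtain z where z: "\<Psi> z = z" "\<And>a. mbound r r (2 / norm c) (z a)"
  proof (rule fixed_point[of "2 / norm c" 0 r r \<Psi> 1 1])
    fix z :: "unit \<Rightarrow> series2"
    assume "z \<in> {z. \<forall>a. wt_ge 1 1 0 (z a) \<and> mbound r r (2 / norm c) (z a)}"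
    then have "mbound r r (norm (1 / c) * (norm (1::complex) + norm c / 2 * (2 / norm c))) (\<Psi> z a)" for a
      unfolding \<Psi>_def const2_1[symmetric] using r
      by (intro mbound_mult mbound_diff mbound_const2) auto
    then show "\<Psi> z \<in> {z. \<forall>a. wt_ge 1 1 0 (z a) \<and> mbound r r (2 / norm c) (z a)}"
      using c by (simp add: norm_divide)
  next
    fix z z' :: "unit \<Rightarrow> series2" and n a
    assume "\<And>b. wt_ge 1 1 n (z b - z' b)"
    then have "wt_ge 1 1 (1 + n) (h * (z' a - z a))"
      using h by (intro wt_ge_mult) (auto simp: wt_ge_11_1 intro: wt_ge_diff_sym)
    moreover have "\<Psi> z a - \<Psi> z' a = const2 (1 / c) * (h * (z' a - z a))"
      by (simp add: \<Psi>_def algebra_simps)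
    ultimately show "wt_ge 1 1 (Suc n) (\<Psi> z a - \<Psi> z' a)"
      by (simp add: wt_ge_mult_right)
  qed auto
  have "z () = const2 (1 / c) * (1 - h * z ())"
    using fun_cong[OF z(1), of "()"] by (simp add: \<Psi>_def)
  then have "const2 c * z () = const2 c * const2 (1 / c) * (1 - h * z ())"
    by (simp add: mult.assoc)
  then have "const2 c * z () = 1 - h * z ()"
    using c by (simp flip: const2_mult)
  then have "f * z () = 1"
    by (simp add: h_def algebra_simps)
  moreover have "z () \<in> convergent_series"
    using z(2) r(1) by (auto simp: convergent_series_iff conv_on_def)
  ultimately show ?thesis
    using that by blast
qed


section \<open>Automorphisms given by substitution\<close>

lemma algebra_automorphism_substI:
  assumes A: "A = UNIV \<or> A = convergent_series"
    and pq: "p \<in> A" "q \<in> A" "p' \<in> A" "q' \<in> A"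
    and [simp]: "coeff2 p 0 0 = 0" "coeff2 q 0 0 = 0" "coeff2 p' 0 0 = 0" "coeff2 q' 0 0 = 0"
    and inv: "subst p p' q' = X2" "subst q p' q' = Y2" "subst p' p q = X2" "subst q' p q = Y2"
  shows "algebra_automorphism A (\<lambda>f. subst f p q)"
  unfolding algebra_automorphism_def
proof (intro conjI ballI allI)
  show "bij_betw (\<lambda>f. subst f p q) A A"
    by (rule bij_betw_byWitness[where f' = "\<lambda>f. subst f p' q'"])
      (use A pq in \<open>auto simp: subst_subst inv convergent_subst\<close>)
qed (simp_all add: subst_add subst_mult subst_const2)

lemma algebra_automorphism_comp:
  assumes \<Phi>: "algebra_automorphism A \<Phi>" and \<Psi>: "algebra_automorphism A \<Psi>"
  shows "algebra_automorphism A (\<lambda>f. \<Psi> (\<Phi> f))"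
proof -
  have "\<Phi> p \<in> A" if "p \<in> A" for p
    using \<Phi> that by (auto simp: algebra_automorphism_def bij_betw_def)
  then show ?thesis
    using \<Phi> \<Psi> bij_betw_trans[of \<Phi> A A \<Psi>] unfolding algebra_automorphism_def
    by (auto simp: comp_def)
qed

lemma right_equivalent_trans:
  assumes "right_equivalent f g" "right_equivalent g h"
  shows "right_equivalent f h"
proof -
  obtain \<Phi> \<Psi> where \<Phi>: "algebra_automorphism convergent_series \<Phi>" "\<Phi> f = g"
    and \<Psi>: "algebra_automorphism convergent_series \<Psi>" "\<Psi> g = h"
    using assms by (auto simp: right_equivalent_def)
  have "\<exists>\<Xi>. algebra_automorphism convergent_series \<Xi> \<and> \<Xi> f = h"
    using algebra_automorphism_comp[OF \<Phi>(1) \<Psi>(1)] \<Phi>(2) \<Psi>(2)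
    by (intro exI[of _ "\<lambda>p. \<Psi> (\<Phi> p)"]) simp
  then show ?thesis
    using assms by (simp add: right_equivalent_def)
qed

text \<open>Vanishing to second order gives a bound \<open>O(r\<^sup>2)\<close>, which is less than \<open>r\<close> for small \<open>r\<close>. The radius
  is \<open>2 r\<close> because the lemma is applied to arguments \<open>x + u'\<close>, \<open>y + v'\<close> with \<open>u'\<close>, \<open>v'\<close> bounded by \<open>r\<close>.\<close>

lemma convergent_quadratic_small:
  assumes "f \<in> convergent_series" "wt_ge 1 1 2 f"
  obtains r1 where "0 < r1" "\<And>r. 0 \<le> r \<Longrightarrow> r \<le> r1 \<Longrightarrow> mbound (2 * r) (2 * r) r f"
proof -
  obtain r0 C where r0: "0 < r0" "0 \<le> C"
    "\<And>t. 0 \<le> t \<Longrightarrow> t \<le> 1 \<Longrightarrow> mbound (t * r0) (t * r0) (t ^ 2 * C) f"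
    by (rule convergent_bound[OF assms]) blast
  define r1 where "r1 = min (r0 / 2) (r0\<^sup>2 / (4 * (C + 1)))"
  show ?thesis
  proof (rule that)
    show "0 < r1"
      using r0 by (simp add: r1_def)
    fix r assume r: "0 \<le> r" "r \<le> r1"
    then have t: "0 \<le> 2 * r / r0" "2 * r / r0 \<le> 1" and "r * (4 * (C + 1)) \<le> r0\<^sup>2"
      using r0 by (simp_all add: r1_def field_simps)
    then have "r * (4 * C) \<le> r0\<^sup>2"
      using r by (simp add: algebra_simps)
    then have "r * (r * (4 * C)) \<le> r * r0\<^sup>2"
      using r by (intro mult_left_mono) auto
    then have "(2 * r / r0)\<^sup>2 * C \<le> r"
      using r0(1) by (simp add: power2_eq_square field_simps)
    then show "mbound (2 * r) (2 * r) r f"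
      using r0(3)[OF t] r0(1) by (auto intro: mbound_mono)
  qed
qed

text \<open>The inverse function theorem for maps tangent to the identity. The components of the inverse solve
  \<open>u' = - u(x + u', y + v')\<close> and \<open>v' = - v(x + u', y + v')\<close>, where the right-hand sides gain one order
  because \<open>u\<close> and \<open>v\<close> have order at least 2. The boolean index distinguishes the two unknowns.\<close>

lemma near_identity_right_inverse:
  assumes u: "u \<in> convergent_series" "wt_ge 1 1 2 u" and v: "v \<in> convergent_series" "wt_ge 1 1 2 v"
  obtains u' v' where "u' \<in> convergent_series" "wt_ge 1 1 2 u'" "v' \<in> convergent_series" "wt_ge 1 1 2 v'"
    "subst (X2 + u) (X2 + u') (Y2 + v') = X2" "subst (Y2 + v) (X2 + u') (Y2 + v') = Y2"
proof -
  obtain r1 where r1: "0 < r1" "\<And>r. 0 \<le> r \<Longrightarrow> r \<le> r1 \<Longrightarrow> mbound (2 * r) (2 * r) r u"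
    by (rule convergent_quadratic_small[OF u]) blast
  obtain r2 where r2: "0 < r2" "\<And>r. 0 \<le> r \<Longrightarrow> r \<le> r2 \<Longrightarrow> mbound (2 * r) (2 * r) r v"
    by (rule convergent_quadratic_small[OF v]) blast
  define r where "r = min r1 r2"
  have r: "0 < r" "mbound (2 * r) (2 * r) r u" "mbound (2 * r) (2 * r) r v"
    using r1 r2 by (auto simp: r_def)
  define w where "w = (\<lambda>b. if b then u else v)"
  have w: "wt_ge 1 1 2 (w b)" "mbound (2 * r) (2 * r) r (w b)" for b
    using u v r by (auto simp: w_def)
  define \<Psi> where "\<Psi> z = (\<lambda>b. - subst (w b) (X2 + z True) (Y2 + z False))" for z
  let ?S = "{z. \<forall>a. wt_ge 1 1 2 (z a) \<and> mbound r r r (z a)}"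
  have 00: "coeff2 (z a) 0 0 = 0" if "z \<in> ?S" for z and a :: bool
    using that wt_geD[of 1 1 2 "z a" 0 0] by auto
  have 1: "wt_ge 1 1 1 (X2 + z True)" "wt_ge 1 1 1 (Y2 + z False)" if "z \<in> ?S" for z
    using 00[OF that] by (simp_all add: wt_ge_11_1 coeff2_X2 coeff2_Y2)
  obtain z where z: "z \<in> ?S" "\<Psi> z = z"
  proof (rule fixed_point[of r 2 r r \<Psi> 1 1])
    fix z :: "bool \<Rightarrow> series2" assume z: "z \<in> ?S"
    show "\<Psi> z \<in> ?S"
      unfolding mem_Collect_eq \<Psi>_def
    proof (intro allI conjI wt_ge_uminus mbound_uminus)
      fix a
      have "mbound r r (r + r) (X2 + z True)" "mbound r r (r + r) (Y2 + z False)"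
        by (intro mbound_add mbound_X2 mbound_Y2; use z r(1) in auto)+
      then have "mbound r r (2 * r) (X2 + z True)" "mbound r r (2 * r) (Y2 + z False)"
        by simp_all
      then show "mbound r r r (subst (w a) (X2 + z True) (Y2 + z False))"
        using r(1) w(2) 00[OF z] by (intro mbound_subst) (auto simp: coeff2_X2 coeff2_Y2)
      show "wt_ge 1 1 2 (subst (w a) (X2 + z True) (Y2 + z False))"
        using w(1) 1[OF z] by (rule wt_ge_subst)
    qed
    fix z' n a assume z': "z' \<in> ?S" and d: "\<And>b. wt_ge 1 1 n (z b - z' b)"
    have "wt_ge 1 1 (2 + (n - 1)) (subst (w a) (X2 + z True) (Y2 + z False)
        - subst (w a) (X2 + z' True) (Y2 + z' False))"
    proof (cases "n = 0")
      case True
      then show ?thesis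
        using wt_ge_diff[OF wt_ge_subst[OF w(1) 1[OF z]] wt_ge_subst[OF w(1) 1[OF z']]] by simp
    next
      case False
      then show ?thesis
        using d by (intro wt_ge_subst_diff w 1 z z') auto
    qed
    then have "wt_ge 1 1 (Suc n) (subst (w a) (X2 + z True) (Y2 + z False)
        - subst (w a) (X2 + z' True) (Y2 + z' False))"
      by (rule wt_ge_mono) simp
    then show "wt_ge 1 1 (Suc n) (\<Psi> z a - \<Psi> z' a)"
      unfolding \<Psi>_def by (drule_tac wt_ge_uminus) simp
  qed (use r in auto)
  note [simp] = 00[OF z(1)]
  have eq: "subst (w b) (X2 + z True) (Y2 + z False) = - z b" for b
    using fun_cong[OF z(2), of b] by (simp add: \<Psi>_def minus_equation_iff)
  show ?thesis
  proof (rule that)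
    show "z True \<in> convergent_series" "z False \<in> convergent_series"
      using z(1) r(1) by (auto simp: convergent_series_iff conv_on_def)
    show "subst (X2 + u) (X2 + z True) (Y2 + z False) = X2"
      using eq[of True] by (simp add: subst_add w_def coeff2_X2 coeff2_Y2)
    show "subst (Y2 + v) (X2 + z True) (Y2 + z False) = Y2"
      using eq[of False] by (simp add: subst_add w_def coeff2_X2 coeff2_Y2)
  qed (use z in auto)
qed

lemma near_identity_automorphism:
  assumes u: "u \<in> convergent_series" "wt_ge 1 1 2 u" and v: "v \<in> convergent_series" "wt_ge 1 1 2 v"
  shows "algebra_automorphism convergent_series (\<lambda>f. subst f (X2 + u) (Y2 + v))"
proof -
  have 00: "coeff2 (X2 + w) 0 0 = 0" "coeff2 (Y2 + w) 0 0 = 0" if "wt_ge 1 1 2 w" for w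
    using wt_geD[OF that, of 0 0] by (simp_all add: coeff2_X2 coeff2_Y2)
  obtain u' v' where uv': "u' \<in> convergent_series" "wt_ge 1 1 2 u'" "v' \<in> convergent_series" "wt_ge 1 1 2 v'"
    and 1: "subst (X2 + u) (X2 + u') (Y2 + v') = X2" "subst (Y2 + v) (X2 + u') (Y2 + v') = Y2"
    by (rule near_identity_right_inverse[OF assms])
  obtain u'' v'' where uv'': "wt_ge 1 1 2 u''" "wt_ge 1 1 2 v''"
    and 2: "subst (X2 + u') (X2 + u'') (Y2 + v'') = X2" "subst (Y2 + v') (X2 + u'') (Y2 + v'') = Y2"
    by (rule near_identity_right_inverse[OF uv'])
  note [simp] = 00[OF u(2)] 00[OF v(2)] 00[OF uv'(2)] 00[OF uv'(4)] 00[OF uv''(1)] 00[OF uv''(2)]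
  \<comment> \<open>a right inverse which has itself a right inverse is a two-sided one\<close>
  have "X2 + u'' = subst (subst (X2 + u) (X2 + u') (Y2 + v')) (X2 + u'') (Y2 + v'')"
    unfolding 1 by (simp del: coeff2_add)
  also have "\<dots> = X2 + u"
    by (subst subst_subst) (simp_all add: 2 del: coeff2_add)
  finally have "u'' = u"
    by simp
  moreover have "Y2 + v'' = subst (subst (Y2 + v) (X2 + u') (Y2 + v')) (X2 + u'') (Y2 + v'')"
    unfolding 1 by (simp del: coeff2_add)
  then have "Y2 + v'' = Y2 + v"
    by (subst (asm) subst_subst) (simp_all add: 2 del: coeff2_add)
  ultimately show ?thesis
    using 1 2 u v uv'
    by (intro algebra_automorphism_substI[where p' = "X2 + u'" and q' = "Y2 + v'"])
      (simp_all add: convergent_ring del: coeff2_add)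
qed


section \<open>Finite determinacy\<close>

lemma wt_ge_psubst_cong:
  assumes "wt_ge 1 1 n (u - u')" "wt_ge 1 1 n (v - v')"
  shows "wt_ge 1 1 n (psubst c u v - psubst c u' v')"
proof (rule wt_ge_psubst_diff)
  fix k l
  have "wt_ge 1 1 (0 * k + 0 * l + n) (u ^ k * v ^ l - u' ^ k * v' ^ l)"
    using assms by (intro wt_ge_diff_mult wt_ge_diff_power) auto
  then have "wt_ge 1 1 n (c k l * (u ^ k * v ^ l - u' ^ k * v' ^ l))"
    by (intro wt_ge_mult_right) simp
  then show "wt_ge 1 1 n (c k l * u ^ k * v ^ l - c k l * u' ^ k * v' ^ l)"
    by (simp add: algebra_simps)
qed

lemma wt_ge_triple_diff:
  assumes "wt_ge 1 1 1 x" "wt_ge 1 1 1 y" "wt_ge 1 1 1 x'" "wt_ge 1 1 1 y'"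
    and "wt_ge 1 1 n (x - x')" "wt_ge 1 1 n (y - y')" "wt_ge 1 1 n (A - A')"
  shows "wt_ge 1 1 (Suc n) (x * y * A - x' * y' * A')"
proof -
  have "x * y * A - x' * y' * A' = x * (y * (A - A')) + x * ((y - y') * A') + y' * ((x - x') * A')"
    by (simp add: algebra_simps)
  moreover have "wt_ge 1 1 (1 + n) \<dots>"
    using assms by (intro wt_ge_add wt_ge_mult[of 1 1 1 _ n] wt_ge_mult_left wt_ge_mult_right)
  ultimately show ?thesis
    by simp
qed

text \<open>The implicit function theorem in the form of Tougeron: a change of \<open>f\<close> by an element
  of \<open>\<mm>\<^sup>2 J\<^sup>2\<close>, where \<open>J\<close> is the Jacobian ideal, is undone by a change of coordinates. One looks
  for \<open>u, v\<close> in \<open>\<mm>\<^sup>2 J\<close>, say \<open>u = z\<^sub>0 f\<^sub>x + z\<^sub>1 f\<^sub>y\<close> and \<open>v = z\<^sub>2 f\<^sub>y\<close>. In the Taylor expansion of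
  \<open>f (x + u, y + v)\<close> all terms after \<open>f\<close> are then combinations of \<open>f\<^sub>x\<^sup>2\<close>, \<open>f\<^sub>x f\<^sub>y\<close>, \<open>f\<^sub>y\<^sup>2\<close>.
  Comparing coefficients gives equations \<open>z\<^sub>i = h\<^sub>i - Q\<^sub>i(z)\<close> with \<open>Q\<^sub>i\<close> at least quadratic in
  \<open>z\<close>, which the fixed point lemma solves.\<close>

lemma tougeron:
  assumes f: "f \<in> convergent_series"
    and h: "\<And>i. h i \<in> convergent_series" "\<And>i. wt_ge 1 1 2 (h i)"
    and g: "g = f + h (0::nat) * (deriv_x f)\<^sup>2 + h 1 * (deriv_x f * deriv_y f) + h 2 * (deriv_y f)\<^sup>2"
  obtains u v where "u \<in> convergent_series" "wt_ge 1 1 2 u" "v \<in> convergent_series" "wt_ge 1 1 2 v"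
    "subst f (X2 + u) (Y2 + v) = g"
proof -
  define a b where "a = deriv_x f" and "b = deriv_y f"
  define c1 c2 c3 :: "nat \<Rightarrow> nat \<Rightarrow> series2" where "c1 = (\<lambda>k l. hasse f (k + 2) l)"
    and "c2 = (\<lambda>k l. if k = 0 then hasse f 1 (l + 1) else 0)"
    and "c3 = (\<lambda>k l. if k = 0 then hasse f 0 (l + 2) else 0)"
  obtain R F where R: "0 < R" "mbound R R F f"
    using f by (auto simp: convergent_series_iff conv_on_def)
  define t D K where "t = R / 2" and "D = F / t" and "K = F / t\<^sup>2"
  have F: "0 \<le> F" and t: "0 < t" and D: "0 \<le> D" and K: "0 \<le> K"
    using R mbound_nonneg[OF R(2)] by (auto simp: t_def D_def K_def)
  have fR: "mbound (r + t) (r + t) F f" if "0 \<le> r" "r \<le> t" for r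
    using that R by (intro mbound_radius_mono[OF R(2)]) (auto simp: t_def)
  have ab: "mbound r r D a" "mbound r r D b" if "0 \<le> r" "r \<le> t" for r
    using mbound_hasse[OF that(1) that(1) t t fR[OF that], of 1 0]
      mbound_hasse[OF that(1) that(1) t t fR[OF that], of 0 1]
    by (simp_all add: hasse_1_0 hasse_0_1 D_def a_def b_def flip: One_nat_def)
  have c: "mbound r r K (psubst c1 u v)" "mbound r r K (psubst c2 u v)" "mbound r r K (psubst c3 u v)"
    if r: "0 \<le> r" "r \<le> t" and u: "mbound r r t u" "coeff2 u 0 0 = 0"
      and v: "mbound r r t v" "coeff2 v 0 0 = 0" for r u v
  proof -
    note le = sum_nrm_shifted_hasse_le[OF r(1) r(1) t t fR[OF r]]
    show "mbound r r K (psubst c1 u v)"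
      using le[of c1 2 0] u v r t by (intro mbound_psubst) (auto simp: K_def c1_def)
    show "mbound r r K (psubst c2 u v)"
      using le[of c2 1 1] u v r t by (intro mbound_psubst) (auto simp: K_def c2_def power2_eq_square)
    show "mbound r r K (psubst c3 u v)"
      using le[of c3 0 2] u v r t by (intro mbound_psubst) (auto simp: K_def c3_def)
  qed
  \<comment> \<open>\<open>\<rho>\<close> bounds the unknowns: then \<open>u\<close>, \<open>v\<close> stay below \<open>t\<close>, and the quadratic terms below \<open>\<rho> / 2\<close>\<close>
  define \<rho> where "\<rho> = min (t / (2 * D + 1)) (1 / (6 * K + 1))"
  have \<rho>: "0 < \<rho>" "2 * (\<rho> * D) \<le> t" "6 * (\<rho> * K) \<le> 1"
  proof -
    show "0 < \<rho>"
      using t D K by (simp add: \<rho>_def)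
    have "\<rho> * (2 * D + 1) \<le> t" "\<rho> * (6 * K + 1) \<le> 1"
      using D K by (simp_all add: \<rho>_def pos_le_divide_eq[symmetric])
    then show "2 * (\<rho> * D) \<le> t" "6 * (\<rho> * K) \<le> 1"
      using \<open>0 < \<rho>\<close> by (simp_all add: algebra_simps)
  qed
  have "\<exists>r>0. \<forall>r'. 0 \<le> r' \<longrightarrow> r' \<le> r \<longrightarrow> mbound r' r' (\<rho> / 2) (h i)" for i
  proof -
    have "coeff2 (h i) 0 0 = 0" "0 < \<rho> / 2"
      using wt_geD[OF h(2)[of i], of 0 0] \<rho>(1) by simp_all
    then show ?thesis
      using convergent_small[OF h(1)[of i]] by metis
  qed
  then obtain rh where rh: "\<And>i. 0 < rh i" "\<And>i r'. 0 \<le> r' \<Longrightarrow> r' \<le> rh i \<Longrightarrow> mbound r' r' (\<rho> / 2) (h i)"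
    by metis
  define r where "r = min t (min (rh 0) (min (rh 1) (rh 2)))"
  have r: "0 < r" "r \<le> t" "r \<le> rh 0" "r \<le> rh 1" "r \<le> rh 2"
    using t rh(1) by (auto simp: r_def)
  have hr: "mbound r r (\<rho> / 2) (h 0)" "mbound r r (\<rho> / 2) (h 1)" "mbound r r (\<rho> / 2) (h 2)"
    using r by (simp_all add: rh(2))
  define U V where "U z = z 0 * a + z 1 * b" and "V z = z 2 * b" for z :: "nat \<Rightarrow> series2"
  define A B C where "A z = psubst c1 (U z) (V z)" and "B z = psubst c2 (U z) (V z)"
    and "C z = psubst c3 (U z) (V z)" for z
  define \<Psi> where "\<Psi> z = (\<lambda>i::nat. if i = 0 then h 0 - z 0 * z 0 * A z
     else if i = 1 then h 1 - (z 0 * z 1 * A z + z 0 * z 1 * A z + z 0 * z 2 * B z)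
     else h 2 - (z 1 * z 1 * A z + z 1 * z 2 * B z + z 2 * z 2 * C z))" for z
  let ?S = "{z. \<forall>i. wt_ge 1 1 2 (z i) \<and> mbound r r \<rho> (z i)}"
  have wt1: "wt_ge 1 1 1 (z i)" if "z \<in> ?S" for z and i :: nat
    using that wt_ge_mono[of 1 1 2 "z i" 1] by auto
  have UV: "wt_ge 1 1 2 (U z)" "wt_ge 1 1 2 (V z)" "mbound r r t (U z)" "mbound r r t (V z)"
    if z: "z \<in> ?S" for z
  proof -
    show "wt_ge 1 1 2 (U z)" "wt_ge 1 1 2 (V z)"
      using z by (auto simp: U_def V_def intro!: wt_ge_add wt_ge_mult_left)
    have "mbound r r (\<rho> * D + \<rho> * D) (U z)" "mbound r r (\<rho> * D) (V z)"
      unfolding U_def V_def using z r by (safe intro!: mbound_add mbound_mult ab) auto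
    moreover have "0 \<le> \<rho> * D"
      using \<rho>(1) D by simp
    ultimately show "mbound r r t (U z)" "mbound r r t (V z)"
      using \<rho>(2) by (auto elim!: mbound_mono simp: mult_ac)
  qed
  have UV0: "coeff2 (U z) 0 0 = 0" "coeff2 (V z) 0 0 = 0" if z: "z \<in> ?S" for z
    using wt_geD[OF UV(1)[OF z], of 0 0] wt_geD[OF UV(2)[OF z], of 0 0] by simp_all
  have ABC: "mbound r r K (A z)" "mbound r r K (B z)" "mbound r r K (C z)" if z: "z \<in> ?S" for z
    unfolding A_def B_def C_def by (rule c; use r UV[OF z] UV0[OF z] in simp)+
  obtain z where z: "z \<in> ?S" "\<Psi> z = z"
  proof (rule fixed_point[of \<rho> 2 r r \<Psi> 1 1])
    fix z :: "nat \<Rightarrow> series2" assume z: "z \<in> ?S"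
    have "6 * (\<rho> * K) * \<rho> \<le> 1 * \<rho>"
      using \<rho> by (intro mult_right_mono) auto
    then have le: "\<rho> / 2 + (\<rho> * \<rho> * K + \<rho> * \<rho> * K + \<rho> * \<rho> * K) \<le> \<rho>"
      "\<rho> / 2 + \<rho> * \<rho> * K \<le> \<rho>"
    proof -
      have "6 * (\<rho> * \<rho> * K) \<le> \<rho>" "0 \<le> \<rho> * \<rho> * K"
        using \<open>6 * (\<rho> * K) * \<rho> \<le> 1 * \<rho>\<close> \<rho>(1) K by (simp_all add: mult_ac)
      then show "\<rho> / 2 + (\<rho> * \<rho> * K + \<rho> * \<rho> * K + \<rho> * \<rho> * K) \<le> \<rho>" "\<rho> / 2 + \<rho> * \<rho> * K \<le> \<rho>"
        by linarith+
    qed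
    show "\<Psi> z \<in> ?S"
      unfolding mem_Collect_eq
    proof (intro allI conjI)
      fix i
      show "wt_ge 1 1 2 (\<Psi> z i)"
      proof -
        have w: "wt_ge 1 1 2 (z j)" for j
          using z by simp
        have "wt_ge 1 1 2 (h 0 - z 0 * z 0 * A z)"
          "wt_ge 1 1 2 (h 1 - (z 0 * z 1 * A z + z 0 * z 1 * A z + z 0 * z 2 * B z))"
          "wt_ge 1 1 2 (h 2 - (z 1 * z 1 * A z + z 1 * z 2 * B z + z 2 * z 2 * C z))"
          by (intro wt_ge_diff wt_ge_add wt_ge_mult_left h(2) w)+
        then show ?thesis
          by (simp add: \<Psi>_def)
      qed
      have zz: "mbound r r \<rho> (z j)" for j
        using z by simp
      have r0: "0 \<le> r"
        using r(1) by simp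
      have b: "mbound r r (\<rho> / 2 + \<rho> * \<rho> * K) (h 0 - z 0 * z 0 * A z)"
        "mbound r r (\<rho> / 2 + (\<rho> * \<rho> * K + \<rho> * \<rho> * K + \<rho> * \<rho> * K))
          (h 1 - (z 0 * z 1 * A z + z 0 * z 1 * A z + z 0 * z 2 * B z))"
        "mbound r r (\<rho> / 2 + (\<rho> * \<rho> * K + \<rho> * \<rho> * K + \<rho> * \<rho> * K))
          (h 2 - (z 1 * z 1 * A z + z 1 * z 2 * B z + z 2 * z 2 * C z))"
        by (intro mbound_diff mbound_add mbound_mult r0 zz hr ABC[OF z])+
      then show "mbound r r \<rho> (\<Psi> z i)"
        using mbound_mono[OF b(1) le(2)] mbound_mono[OF b(2) le(1)] mbound_mono[OF b(3) le(1)]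
        by (simp add: \<Psi>_def)
    qed
    fix z' n i assume z': "z' \<in> ?S" and d: "\<And>b. wt_ge 1 1 n (z b - z' b)"
    have "wt_ge 1 1 n ((z 0 - z' 0) * a + (z 1 - z' 1) * b)" "wt_ge 1 1 n ((z 2 - z' 2) * b)"
      using d by (auto intro!: wt_ge_add wt_ge_mult_left)
    then have UVd: "wt_ge 1 1 n (U z - U z')" "wt_ge 1 1 n (V z - V z')"
      by (simp_all add: U_def V_def algebra_simps)
    have ABCd: "wt_ge 1 1 n (A z - A z')" "wt_ge 1 1 n (B z - B z')" "wt_ge 1 1 n (C z - C z')"
      unfolding A_def B_def C_def by (intro wt_ge_psubst_cong UVd)+
    define E where "E G i j = z i * z j * G z - z' i * z' j * G z'" for G i j
    have E: "wt_ge 1 1 (Suc n) (E G i j)" if "wt_ge 1 1 n (G z - G z')" for G i j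
      unfolding E_def by (intro wt_ge_triple_diff wt1 z z' d that)
    have "\<Psi> z i - \<Psi> z' i = (if i = 0 then - E A 0 0 else if i = 1 then - (E A 0 1 + E A 0 1 + E B 0 2)
        else - (E A 1 1 + E B 1 2 + E C 2 2))"
      by (simp add: \<Psi>_def E_def algebra_simps)
    moreover have "wt_ge 1 1 (Suc n) (- E A 0 0)"
      "wt_ge 1 1 (Suc n) (- (E A 0 1 + E A 0 1 + E B 0 2))"
      "wt_ge 1 1 (Suc n) (- (E A 1 1 + E B 1 2 + E C 2 2))"
      by (intro wt_ge_uminus wt_ge_add E ABCd)+
    ultimately show "wt_ge 1 1 (Suc n) (\<Psi> z i - \<Psi> z' i)"
      by (simp only: split: if_split) simp
  qed (use \<rho> in auto)
  have z0: "h 0 = z 0 + z 0 * z 0 * A z"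
    using fun_cong[OF z(2), of 0] by (simp add: \<Psi>_def algebra_simps)
  have z1: "h 1 = z 1 + (z 0 * z 1 * A z + z 0 * z 1 * A z + z 0 * z 2 * B z)"
    using fun_cong[OF z(2), of 1] by (simp add: \<Psi>_def algebra_simps)
  have z2: "h 2 = z 2 + (z 1 * z 1 * A z + z 1 * z 2 * B z + z 2 * z 2 * C z)"
    using fun_cong[OF z(2), of 2] by (simp add: \<Psi>_def algebra_simps)
  have "subst f (X2 + U z) (Y2 + V z) = f + U z * a + V z * b + (U z)\<^sup>2 * A z + U z * V z * B z + (V z)\<^sup>2 * C z"
    unfolding subst_taylor[OF UV0[OF z(1)]] psubst_second_order[OF UV0[OF z(1)], of "hasse f"]
      A_def B_def C_def c1_def c2_def c3_def hasse_0_0 hasse_1_0 hasse_0_1 a_def b_def ..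
  also have "\<dots> = g"
    unfolding g z0 z1 z2 unfolding U_def V_def a_def[symmetric] b_def[symmetric]
    by (simp add: algebra_simps power2_eq_square)
  finally have "subst f (X2 + U z) (Y2 + V z) = g" .
  moreover have "U z \<in> convergent_series" "V z \<in> convergent_series"
    using UV[OF z(1)] r(1) by (auto simp: convergent_series_iff conv_on_def)
  ultimately show ?thesis
    using that UV(1,2)[OF z(1)] by blast
qed

lemma mbound_shift:
  assumes "0 < r" "0 < s" "mbound r s C f"
    and g: "\<And>i j. norm (coeff2 g i j) \<le> norm (coeff2 f (i + a) (j + b))"
  shows "mbound r s (C / (r ^ a * s ^ b)) g"
  unfolding mbound_def
proof
  fix n
  define h where "h = (\<lambda>i j. norm (coeff2 f i j) * r ^ i * s ^ j)"
  have "nrm n r s g * (r ^ a * s ^ b)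
      \<le> (\<Sum>i<n. \<Sum>j<n. norm (coeff2 f (i + a) (j + b)) * r ^ i * s ^ j) * (r ^ a * s ^ b)"
    unfolding nrm_def using assms by (intro sum_mono mult_right_mono) auto
  also have "\<dots> = (\<Sum>(i, j)\<in>{..<n} \<times> {..<n}. h (i + a) (j + b))"
    by (simp add: h_def sum_distrib_right sum_distrib_left power_add mult_ac flip: sum.cartesian_product)
  also have "\<dots> = (\<Sum>(i, j)\<in>(\<lambda>(i, j). (i + a, j + b)) ` ({..<n} \<times> {..<n}). h i j)"
    by (subst sum.reindex) (auto simp: inj_on_def case_prod_beta)
  also have "\<dots> \<le> (\<Sum>(i, j)\<in>{..<n + a + b} \<times> {..<n + a + b}. h i j)"
    using assms by (intro sum_mono2) (auto simp: h_def)
  also have "\<dots> = nrm (n + a + b) r s f"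
    by (simp add: nrm_def h_def sum.cartesian_product)
  also have "\<dots> \<le> C"
    using assms(3) by (rule mboundD)
  finally show "nrm n r s g \<le> C / (r ^ a * s ^ b)"
    using assms by (simp add: pos_le_divide_eq)
qed

lemma convergent_shift:
  assumes "f \<in> convergent_series" "\<And>i j. norm (coeff2 g i j) \<le> norm (coeff2 f (i + a) (j + b))"
  shows "g \<in> convergent_series"
proof -
  obtain r C where "r > 0" "mbound r r C f"
    using assms(1) by (auto simp: convergent_series_iff conv_on_def)
  then show ?thesis
    using mbound_shift[of r r C f g a b] assms(2) by (auto simp: convergent_series_iff conv_on_def)
qed

text \<open>A monomial of degree at least \<open>2 K\<close> is divisible by \<open>x\<^sup>K\<close> or by \<open>y\<^sup>K\<close>.\<close>

lemma high_order_split: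
  assumes H: "H \<in> convergent_series" "wt_ge 1 1 N H" and N: "2 * K \<le> N"
  obtains H1 H2 where "H = X2 ^ K * H1 + Y2 ^ K * H2" "H1 \<in> convergent_series" "H2 \<in> convergent_series"
    "wt_ge 1 1 (N - K) H1" "wt_ge 1 1 (N - K) H2"
proof -
  define H1 H2 where "H1 = series_of_coeffs (\<lambda>i j. coeff2 H (i + K) j)"
    and "H2 = series_of_coeffs (\<lambda>i j. if i < K then coeff2 H i (j + K) else 0)"
  show ?thesis
  proof (rule that)
    show "H = X2 ^ K * H1 + Y2 ^ K * H2"
    proof (rule series2_eqI)
      fix i j
      have "coeff2 H i j = 0" if "i < K" "j < K"
        using that N wt_geD[OF H(2), of i j] by simp
      then show "coeff2 H i j = coeff2 (X2 ^ K * H1 + Y2 ^ K * H2) i j"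
        by (simp add: coeff2_X2_power_mult coeff2_Y2_power_mult H1_def H2_def)
    qed
    show "H1 \<in> convergent_series"
      by (rule convergent_shift[OF H(1), of _ K 0]) (simp add: H1_def)
    show "H2 \<in> convergent_series"
      by (rule convergent_shift[OF H(1), of _ 0 K]) (simp add: H2_def)
    show "wt_ge 1 1 (N - K) H1" "wt_ge 1 1 (N - K) H2"
      using H(2) by (auto simp: wt_ge_def H1_def H2_def)
  qed
qed

text \<open>If the Jacobian ideal contains \<open>x\<^sup>K\<close> and \<open>y\<^sup>K\<close>, then its square contains \<open>x\<^sup>2\<^sup>K\<close> and
  \<open>y\<^sup>2\<^sup>K\<close>, hence \<open>\<mm>\<^sup>2\<close> times it contains all series of order at least \<open>4 K + 2\<close>.\<close>

lemma finite_determinacy: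
  assumes f: "f \<in> convergent_series" and g: "g \<in> convergent_series"
    and gf: "wt_ge 1 1 (4 * K + 2) (g - f)"
    and J: "X2 ^ K = \<alpha> * deriv_x f + \<beta> * deriv_y f" "Y2 ^ K = \<gamma> * deriv_x f + \<delta> * deriv_y f"
    and conv: "\<alpha> \<in> convergent_series" "\<beta> \<in> convergent_series" "\<gamma> \<in> convergent_series" "\<delta> \<in> convergent_series"
  shows "right_equivalent f g"
proof -
  have "g - f \<in> convergent_series"
    using f g by (rule convergent_ring(2)[rotated])
  then obtain H1 H2 where H: "g - f = X2 ^ (2 * K) * H1 + Y2 ^ (2 * K) * H2"
    "H1 \<in> convergent_series" "H2 \<in> convergent_series"
    "wt_ge 1 1 (4 * K + 2 - 2 * K) H1" "wt_ge 1 1 (4 * K + 2 - 2 * K) H2"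
    by (rule high_order_split[OF _ gf, of "2 * K"]) simp_all
  have wt: "wt_ge 1 1 2 H1" "wt_ge 1 1 2 H2"
    using wt_ge_mono[OF H(4), of 2] wt_ge_mono[OF H(5), of 2] by simp_all
  define h0 h2 h1 where "h0 = H1 * \<alpha>\<^sup>2 + H2 * \<gamma>\<^sup>2" and "h2 = H1 * \<beta>\<^sup>2 + H2 * \<delta>\<^sup>2"
    and "h1 = H1 * (\<alpha> * \<beta>) + H1 * (\<alpha> * \<beta>) + (H2 * (\<gamma> * \<delta>) + H2 * (\<gamma> * \<delta>))"
  define h where "h i = (if i = 0 then h0 else if i = 1 then h1 else h2)" for i :: nat
  have hi: "h0 \<in> convergent_series" "h1 \<in> convergent_series" "h2 \<in> convergent_series"
    "wt_ge 1 1 2 h0" "wt_ge 1 1 2 h1" "wt_ge 1 1 2 h2"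
    unfolding h0_def h1_def h2_def using H(2,3) wt conv
    by (safe intro!: convergent_ring convergent_power wt_ge_add wt_ge_mult_left)
  have "X2 ^ (2 * K) = (X2 ^ K)\<^sup>2" "Y2 ^ (2 * K) = (Y2 ^ K)\<^sup>2"
    by (simp_all add: power_mult mult.commute[of 2] flip: power_mult)
  then have "g = f + ((X2 ^ K)\<^sup>2 * H1 + (Y2 ^ K)\<^sup>2 * H2)"
    using H(1) by (simp add: algebra_simps)
  then have g': "g = f + h 0 * (deriv_x f)\<^sup>2 + h 1 * (deriv_x f * deriv_y f) + h 2 * (deriv_y f)\<^sup>2"
    unfolding J by (simp add: h_def h0_def h1_def h2_def algebra_simps power2_eq_square)
  have h: "h i \<in> convergent_series" "wt_ge 1 1 2 (h i)" for i
    using hi by (auto simp: h_def)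
  obtain u v where "u \<in> convergent_series" "wt_ge 1 1 2 u" "v \<in> convergent_series"
    "wt_ge 1 1 2 v" "subst f (X2 + u) (Y2 + v) = g"
    by (rule tougeron[OF f h g'])
  then show ?thesis
    unfolding right_equivalent_def using near_identity_automorphism[of u v] f g
    by (intro conjI exI[of _ "\<lambda>f. subst f (X2 + u) (Y2 + v)"]) simp_all
qed


section \<open>Weierstrass division and preparation\<close>

definition y_shift :: "nat \<Rightarrow> series2 \<Rightarrow> series2" where
  "y_shift n g = series_of_coeffs (\<lambda>i j. coeff2 g i (j + n))"

text \<open>Division by \<open>y\<^sup>n + e\<close> with \<open>e\<close> small and divisible by \<open>x\<close>. The quotient \<open>q\<close> is the solution of
  \<open>q = (g - e q) div y\<^sup>n\<close>. The iteration gains one order if \<open>x\<close> is given the weight \<open>n + 1\<close>, since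
  multiplication by \<open>e\<close> gains \<open>n + 1\<close> and division by \<open>y\<^sup>n\<close> loses \<open>n\<close>.\<close>

lemma weierstrass_division:
  assumes rs: "0 < r" "0 < s" and e: "wt_ge 1 0 1 e" "mbound r s (s ^ n / 2) e"
    and g: "g \<in> conv_on r s"
  obtains q where "q \<in> conv_on r s" "\<And>i j. n \<le> j \<Longrightarrow> coeff2 (g - q * (Y2 ^ n + e)) i j = 0"
proof -
  obtain G where G: "mbound r s G g"
    using g by (auto simp: conv_on_def)
  define \<Psi> where "\<Psi> q = (\<lambda>a::unit. y_shift n (g - e * q a))" for q
  let ?\<rho> = "2 * G / s ^ n"
  let ?S = "{q. \<forall>a. wt_ge 1 1 0 (q a) \<and> mbound r s ?\<rho> (q a)}"
  obtain q where q: "q \<in> ?S" "\<Psi> q = q"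
  proof (rule fixed_point[of ?\<rho> 0 r s \<Psi> "n + 1" 1])
    show "0 \<le> ?\<rho>"
      using mbound_nonneg[OF G] rs by simp
    fix q :: "unit \<Rightarrow> series2" assume q: "q \<in> ?S"
    have "mbound r s (G + s ^ n / 2 * ?\<rho>) (g - e * q a)" for a
      using q rs by (intro mbound_diff mbound_mult G e) auto
    then have "mbound r s ((G + s ^ n / 2 * ?\<rho>) / (r ^ 0 * s ^ n)) (\<Psi> q a)" for a
      unfolding \<Psi>_def by (rule mbound_shift[OF rs]) (simp add: y_shift_def)
    then show "\<Psi> q \<in> ?S"
      using rs by simp
    fix q' m a assume d: "\<And>b. wt_ge (n + 1) 1 m (q b - q' b)"
    have "wt_ge (n + 1) 1 (n + 1) e"
      unfolding wt_ge_def
    proof (intro allI impI)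
      fix i j assume "(n + 1) * i + 1 * j < n + 1"
      then have "i = 0"
        by (cases i) auto
      then show "coeff2 e i j = 0"
        using e(1) by (simp add: wt_ge_def)
    qed
    then have "wt_ge (n + 1) 1 (n + 1 + m) (e * (q a - q' a))"
      using d by (rule wt_ge_mult)
    then have "wt_ge (n + 1) 1 (m + 1) (y_shift n (e * (q a - q' a)))"
      by (auto simp: wt_ge_def y_shift_def)
    moreover have "\<Psi> q a - \<Psi> q' a = - y_shift n (e * (q a - q' a))"
      by (rule series2_eqI) (simp add: \<Psi>_def y_shift_def algebra_simps)
    ultimately show "wt_ge (n + 1) 1 (Suc m) (\<Psi> q a - \<Psi> q' a)"
      by (simp add: wt_ge_uminus)
  qed
  show ?thesis
  proof (rule that)
    show "q () \<in> conv_on r s"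
      using q(1) by (auto simp: conv_on_def)
    fix i j assume "n \<le> j"
    have "coeff2 (q ()) i (j - n) = coeff2 (g - e * q ()) i (j - n + n)"
      using fun_cong[OF q(2), of "()"] by (metis \<Psi>_def coeff2_series_of_coeffs y_shift_def)
    moreover have "q () * (Y2 ^ n + e) = Y2 ^ n * q () + e * q ()"
      by (simp add: algebra_simps)
    ultimately show "coeff2 (g - q () * (Y2 ^ n + e)) i j = 0"
      using \<open>n \<le> j\<close> by (simp add: coeff2_Y2_power_mult)
  qed
qed

lemma finite_convergent_radius:
  assumes "finite F" "F \<subseteq> convergent_series" "0 < \<epsilon>"
  obtains r where "0 < r" "r < \<epsilon>" "F \<subseteq> conv_on r r"
proof -
  have "\<exists>r>0. r < \<epsilon> \<and> F \<subseteq> conv_on r r"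
    using assms(1,2)
  proof (induction F)
    case empty
    then show ?case
      using assms(3) by (intro exI[of _ "\<epsilon> / 2"]) auto
  next
    case (insert f F)
    then obtain r where r: "0 < r" "r < \<epsilon>" "F \<subseteq> conv_on r r"
      by auto
    obtain r' where r': "0 < r'" "f \<in> conv_on r' r'"
      using insert.prems by (auto simp: convergent_series_iff)
    have "g \<in> conv_on (min r r') (min r r')" if "g \<in> insert f F" for g
      using that r r' conv_on_mono[of f r' r' "min r r'" "min r r'"]
        conv_on_mono[of g r r "min r r'" "min r r'"] by auto
    then show ?case
      using r r' by (intro exI[of _ "min r r'"]) auto
  qed
  then show ?thesis
    using that by blast
qed

lemma shrink_x_radius:
  assumes "e \<in> conv_on r s" "wt_ge 1 0 1 e" "0 < r" "0 < s" "0 < \<eta>"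
  obtains r' where "0 < r'" "r' \<le> r" "mbound r' s \<eta> e"
proof -
  obtain C where C: "mbound r s C e"
    using assms by (auto simp: conv_on_def)
  note C0 = mbound_nonneg[OF C]
  define t where "t = min 1 (\<eta> / (C + 1))"
  have t: "0 < t" "t \<le> 1"
    using assms C0 by (auto simp: t_def)
  have "t * C \<le> \<eta> / (C + 1) * (C + 1)"
    using C0 assms by (intro mult_mono) (auto simp: t_def)
  then have "t * C \<le> \<eta>"
    using C0 by simp
  moreover have "mbound (t ^ 1 * r) (t ^ 0 * s) (t ^ 1 * C) e"
    using assms t by (intro mbound_scale[OF C]) auto
  ultimately have "mbound (t * r) s \<eta> e"
    by (auto intro: mbound_mono)
  then show ?thesis
    using that[of "t * r"] t assms(3) by (auto simp: mult_le_cancel_right1)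
qed

text \<open>\<open>y\<^sup>n - R\<close> is a Weierstrass polynomial in \<open>y\<close>, and the bound on \<open>R\<close> makes the division
  lemma applicable on the polydisc of radii \<open>r\<close>, \<open>s\<close>.\<close>

definition weierstrass_tail :: "real \<Rightarrow> real \<Rightarrow> nat \<Rightarrow> series2 \<Rightarrow> bool" where
  "weierstrass_tail r s n R \<longleftrightarrow> 0 < r \<and> 0 < s \<and> wt_ge 1 0 1 R \<and> mbound r s (s ^ n / 2) R \<and>
     (\<forall>i j. n \<le> j \<longrightarrow> coeff2 R i j = 0)"

lemma wt_ge_10_1: "wt_ge 1 0 1 e \<longleftrightarrow> (\<forall>j. coeff2 e 0 j = 0)"
  by (auto simp: wt_ge_def)

text \<open>Multiplying \<open>a\<close> by the inverse \<open>W\<close> of the unit in \<open>a = y\<^sup>n W\<^sup>-\<^sup>1 + l\<close>, where \<open>x\<close> divides \<open>l\<close>, gives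
  \<open>y\<^sup>n + e\<close> to which the division lemma applies. Dividing \<open>y\<^sup>n\<close> by it leaves a remainder
  \<open>R\<close>, and at \<open>x = 0\<close> the quotient is 1, so it is a unit. The radii are shrunk at the end, first both and
  then that of \<open>x\<close>, because the bound on \<open>R\<close> can only be reached through its divisibility by \<open>x\<close>.\<close>

lemma weierstrass_preparation:
  assumes a: "a \<in> convergent_series" "coeff2 a 0 n \<noteq> 0" "\<And>j. j < n \<Longrightarrow> coeff2 a 0 j = 0"
    and F: "finite F" "F \<subseteq> convergent_series" and \<epsilon>: "0 < \<epsilon>"
  obtains r s R U V where "weierstrass_tail r s n R" "r < \<epsilon>" "s < \<epsilon>" "F \<subseteq> conv_on r s"
    "U \<in> conv_on r s" "V \<in> conv_on r s" "a = U * (Y2 ^ n - R)" "Y2 ^ n - R = V * a"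
proof -
  have "y_shift n a \<in> convergent_series"
    by (rule convergent_shift[OF a(1), of _ 0 n]) (simp add: y_shift_def)
  moreover have "coeff2 (y_shift n a) 0 0 \<noteq> 0"
    using a(2) by (simp add: y_shift_def)
  ultimately obtain W where W: "W \<in> convergent_series" "y_shift n a * W = 1"
    by (rule convergent_unit)
  define l where "l = a - Y2 ^ n * y_shift n a"
  have l: "l \<in> convergent_series"
    unfolding l_def using a \<open>y_shift n a \<in> convergent_series\<close>
    by (simp add: convergent_ring convergent_power)
  define e where "e = W * l"
  have "coeff2 l 0 j = 0" for j
    using a(3) by (simp add: l_def coeff2_Y2_power_mult y_shift_def)
  then have "wt_ge 1 0 1 l"
    unfolding wt_ge_10_1 by blast
  then have e1: "wt_ge 1 0 1 e"
    unfolding e_def by (rule wt_ge_mult_right)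
  have Wa: "W * a = Y2 ^ n + e"
  proof -
    have "W * a = Y2 ^ n * (y_shift n a * W) + e"
      by (simp add: e_def l_def algebra_simps)
    then show ?thesis
      by (simp add: W)
  qed
  have e_conv: "e \<in> convergent_series"
    unfolding e_def using W(1) l by (rule convergent_ring)
  obtain r0 where r0: "0 < r0" "r0 < \<epsilon>" "e \<in> conv_on r0 r0"
    by (rule finite_convergent_radius[of "{e}" \<epsilon>]) (use e_conv \<epsilon> in auto)
  obtain r1 where r1: "0 < r1" "r1 \<le> r0" "mbound r1 r0 (r0 ^ n / 2) e"
    by (rule shrink_x_radius[OF r0(3) e1 r0(1) r0(1), of "r0 ^ n / 2"]) (use r0 in auto)
  have "Y2 ^ n \<in> conv_on r1 r0"
    using r0(1) r1(1) by (intro conv_on_power conv_on_ring) auto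
  then obtain q where q: "q \<in> conv_on r1 r0"
    "\<And>i j. n \<le> j \<Longrightarrow> coeff2 (Y2 ^ n - q * (Y2 ^ n + e)) i j = 0"
    by (rule weierstrass_division[OF r1(1) r0(1) e1 r1(3)]) blast
  have q_conv: "q \<in> convergent_series"
    using q(1) r1(1) r0(1) by (rule conv_on_imp_convergent)
  define R where "R = Y2 ^ n - q * (Y2 ^ n + e)"
  have "coeff2 (q * (Y2 ^ n + e)) 0 j = (if j < n then 0 else coeff2 q 0 (j - n))" for j
  proof -
    have "q * (Y2 ^ n + e) = Y2 ^ n * q + q * e"
      by (simp add: algebra_simps)
    moreover have "coeff2 (q * e) 0 j = 0"
      using wt_geD[OF wt_ge_mult_right[OF e1, of q], of 0 j] by simp
    ultimately show ?thesis
      by (simp add: coeff2_Y2_power_mult)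
  qed
  moreover have Yn: "coeff2 (Y2 ^ n) 0 j = (if j = n then 1 else 0)" for j
    using coeff2_monomial[of 1 0 n 0 j] by simp
  ultimately have R0: "coeff2 R 0 j = (if j = n then 1 else 0) - (if j < n then 0 else coeff2 q 0 (j - n))" for j
    by (simp add: R_def)
  have q0: "coeff2 q 0 0 = 1"
    using R0[of n] q(2)[of n 0] by (simp add: R_def)
  have R_wt: "wt_ge 1 0 1 R"
    unfolding wt_ge_10_1
  proof
    fix j
    show "coeff2 R 0 j = 0"
      using R0[of j] q(2)[of j 0] by (cases "j < n") (simp_all add: R_def)
  qed
  obtain q' where q': "q' \<in> convergent_series" "q * q' = 1"
    by (rule convergent_unit[OF q_conv]) (use q0 in auto)
  define U V where "U = y_shift n a * q'" and "V = q * W"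
  have UV_conv: "U \<in> convergent_series" "V \<in> convergent_series"
    using q' q_conv W \<open>y_shift n a \<in> convergent_series\<close> by (auto simp: U_def V_def intro!: convergent_ring)
  have PV: "Y2 ^ n - R = V * a"
    by (simp add: R_def V_def mult.assoc Wa)
  have aU: "a = U * (Y2 ^ n - R)"
  proof -
    have "U * (Y2 ^ n - R) = (y_shift n a * W) * (q * q') * a"
      unfolding PV by (simp add: U_def V_def mult_ac)
    then show ?thesis
      by (simp add: W q')
  qed
  have R_conv: "R \<in> convergent_series"
    unfolding R_def using q_conv e_conv by (intro convergent_ring convergent_power)
  obtain s where s: "0 < s" "s < \<epsilon>" "insert R (insert U (insert V F)) \<subseteq> conv_on s s"
    by (rule finite_convergent_radius[of "insert R (insert U (insert V F))" \<epsilon>])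
      (use R_conv UV_conv F \<epsilon> in auto)
  obtain r where r: "0 < r" "r \<le> s" "mbound r s (s ^ n / 2) R"
    by (rule shrink_x_radius[of R s s "s ^ n / 2"]) (use s R_wt in auto)
  have sub: "conv_on s s \<subseteq> conv_on r s"
    using r s by (auto intro: conv_on_mono)
  show ?thesis
  proof (rule that)
    show "weierstrass_tail r s n R"
      using r s R_wt q(2) by (simp add: weierstrass_tail_def R_def)
    show "a = U * (Y2 ^ n - R)" "Y2 ^ n - R = V * a"
      by (fact aU PV)+
  qed (use r s sub in auto)
qed


section \<open>Evaluation of convergent series\<close>

lemma mbound_tail:
  assumes f: "f \<in> conv_on r s" and rs: "0 \<le> r" "0 \<le> s" and "0 < \<epsilon>"
  obtains N where "\<And>n. N \<le> n \<Longrightarrow> mbound r s \<epsilon> (f - box_part n f)"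
proof -
  obtain C where C: "mbound r s C f"
    using f by (auto simp: conv_on_def)
  define L where "L = (SUP n. nrm n r s f)"
  have bdd: "bdd_above (range (\<lambda>n. nrm n r s f))"
    using C by (auto simp: mbound_def)
  have L: "nrm n r s f \<le> L" for n
    unfolding L_def by (rule cSUP_upper[OF _ bdd]) simp
  have "L - \<epsilon> < L"
    using \<open>0 < \<epsilon>\<close> by simp
  then obtain N where N: "L - \<epsilon> < nrm N r s f"
    unfolding L_def using less_cSUP_iff[OF _ bdd, of "(SUP n. nrm n r s f) - \<epsilon>"] by auto
  have le: "nrm M r s (f - box_part n f) + nrm n r s f \<le> L" for n M
  proof -
    define h where "h = (\<lambda>i j. norm (coeff2 f i j) * r ^ i * s ^ j)"
    let ?K = "M + n"
    have "nrm M r s (f - box_part n f) = (\<Sum>i<M. \<Sum>j<M. if i < n \<and> j < n then 0 else h i j)"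
      unfolding nrm_def h_def by (intro sum.cong refl) (simp add: coeff2_box_part)
    also have "\<dots> \<le> (\<Sum>i<?K. \<Sum>j<?K. if i < n \<and> j < n then 0 else h i j)"
      unfolding sum.cartesian_product using rs by (intro sum_mono2) (auto simp: h_def split: if_splits)
    finally have 1: "nrm M r s (f - box_part n f) \<le> (\<Sum>i<?K. \<Sum>j<?K. if i < n \<and> j < n then 0 else h i j)" .
    have "nrm n r s f = (\<Sum>(i, j)\<in>{..<n} \<times> {..<n}. if i < n \<and> j < n then h i j else 0)"
      by (auto simp: nrm_def h_def sum.cartesian_product intro!: sum.cong)
    also have "\<dots> \<le> (\<Sum>(i, j)\<in>{..<?K} \<times> {..<?K}. if i < n \<and> j < n then h i j else 0)"
      using rs by (intro sum_mono2) (auto simp: h_def split: if_splits)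
    finally have 2: "nrm n r s f \<le> (\<Sum>i<?K. \<Sum>j<?K. if i < n \<and> j < n then h i j else 0)"
      by (simp add: sum.cartesian_product)
    have "(\<Sum>i<?K. \<Sum>j<?K. if i < n \<and> j < n then 0 else h i j)
        + (\<Sum>i<?K. \<Sum>j<?K. if i < n \<and> j < n then h i j else 0) = nrm ?K r s f"
      unfolding sum.distrib[symmetric] nrm_def h_def by (intro sum.cong refl) auto
    then show ?thesis
      using 1 2 L[of ?K] by linarith
  qed
  show ?thesis
  proof (rule that[of N])
    fix n assume "N \<le> n"
    then have "nrm N r s f \<le> nrm n r s f"
      unfolding nrm_def sum.cartesian_product using rs by (intro sum_mono2) auto
    then show "mbound r s \<epsilon> (f - box_part n f)"
      unfolding mbound_def using le[of _ n] N by (smt (verit))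
  qed
qed

lemma box_part_conv_on: "0 \<le> r \<Longrightarrow> 0 \<le> s \<Longrightarrow> box_part n f \<in> conv_on r s"
  unfolding box_part_def by (intro conv_on_sum conv_on_ring conv_on_power)

text \<open>Polynomials are dense in the series converging on a closed polydisc, so bounded additive
  functionals are determined by their values on monomials.\<close>

lemma bounded_additive_eqI:
  fixes \<Phi> \<Psi> :: "series2 \<Rightarrow> complex"
  assumes rs: "0 \<le> r" "0 \<le> s" and f: "f \<in> conv_on r s"
    and add: "\<And>f g. f \<in> conv_on r s \<Longrightarrow> g \<in> conv_on r s \<Longrightarrow> \<Phi> (f + g) = \<Phi> f + \<Phi> g"
      "\<And>f g. f \<in> conv_on r s \<Longrightarrow> g \<in> conv_on r s \<Longrightarrow> \<Psi> (f + g) = \<Psi> f + \<Psi> g"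
    and bd: "\<And>f C. mbound r s C f \<Longrightarrow> norm (\<Phi> f) \<le> K * C" "\<And>f C. mbound r s C f \<Longrightarrow> norm (\<Psi> f) \<le> K * C"
    and mono: "\<And>c a b. \<Phi> (const2 c * X2 ^ a * Y2 ^ b) = \<Psi> (const2 c * X2 ^ a * Y2 ^ b)"
  shows "\<Phi> f = \<Psi> f"
proof (rule ccontr)
  assume ne: "\<Phi> f \<noteq> \<Psi> f"
  define \<epsilon> where "\<epsilon> = norm (\<Phi> f - \<Psi> f) / (4 * (\<bar>K\<bar> + 1))"
  have \<epsilon>: "0 < \<epsilon>"
    using ne by (simp add: \<epsilon>_def add_nonneg_pos)
  obtain n where n: "mbound r s \<epsilon> (f - box_part n f)"
    using mbound_tail[OF f rs \<epsilon>] by blast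
  note mem = conv_on_ring[OF rs] conv_on_power[OF rs] conv_on_sum[OF rs] box_part_conv_on[OF rs]
  have \<Phi>0: "\<Phi> 0 = 0" and \<Psi>0: "\<Psi> 0 = 0"
    using add(1)[of 0 0] add(2)[of 0 0] mem(6) by simp_all
  have sum: "\<Phi> (sum h S) = (\<Sum>a\<in>S. \<Phi> (h a))" "\<Psi> (sum h S) = (\<Sum>a\<in>S. \<Psi> (h a))"
    if "finite S" "\<And>a. h a \<in> conv_on r s" for h :: "nat \<Rightarrow> series2" and S
    using that by (induction S) (simp_all add: add \<Phi>0 \<Psi>0 mem)
  have box: "\<Phi> (box_part n f) = \<Psi> (box_part n f)"
    unfolding box_part_def by (simp add: sum mem mono)
  have "\<Phi> f = \<Phi> (box_part n f) + \<Phi> (f - box_part n f)" "\<Psi> f = \<Psi> (box_part n f) + \<Psi> (f - box_part n f)"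
    using add(1)[of "box_part n f" "f - box_part n f"] add(2)[of "box_part n f" "f - box_part n f"] mem f by simp_all
  then have "norm (\<Phi> f - \<Psi> f) \<le> norm (\<Phi> (f - box_part n f)) + norm (\<Psi> (f - box_part n f))"
    using box by (simp add: norm_triangle_ineq4)
  also have "\<dots> \<le> K * \<epsilon> + K * \<epsilon>"
    using n by (intro add_mono bd)
  also have "\<dots> \<le> 2 * ((\<bar>K\<bar> + 1) * \<epsilon>)"
    using \<epsilon> by (auto intro!: mult_right_mono)
  also have "\<dots> = norm (\<Phi> f - \<Psi> f) / 2"
    by (simp add: \<epsilon>_def field_simps add_nonneg_eq_0_iff)
  finally show False
    using ne by simp
qed

context
  fixes r s :: real and x y :: complex
  assumes xr: "norm x \<le> r" and ys: "norm y \<le> s"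
begin

lemma rs_nonneg: "0 \<le> r" "0 \<le> s"
  using xr ys norm_ge_zero order.trans by blast+

lemma eval2_summable:
  assumes "f \<in> conv_on r s"
  shows "(\<lambda>(i, j). coeff2 f i j * x ^ i * y ^ j) summable_on UNIV"
    and "(\<lambda>(i, j). norm (coeff2 f i j * x ^ i * y ^ j)) summable_on UNIV"
proof -
  obtain C where C: "mbound r s C f"
    using assms by (auto simp: conv_on_def)
  show 1: "(\<lambda>(i, j). norm (coeff2 f i j * x ^ i * y ^ j)) summable_on UNIV"
    by (rule mbound_summable[OF C xr ys])
  show "(\<lambda>(i, j). coeff2 f i j * x ^ i * y ^ j) summable_on UNIV"
    by (rule abs_summable_summable) (use 1 in \<open>simp add: case_prod_unfold\<close>)
qed

lemma eval2_add: "f \<in> conv_on r s \<Longrightarrow> g \<in> conv_on r s \<Longrightarrow> eval2 (f + g) (x, y) = eval2 f (x, y) + eval2 g (x, y)"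
  using infsum_add[OF eval2_summable(1)[of f] eval2_summable(1)[of g]]
  by (simp add: eval2_def case_prod_unfold distrib_right)

lemma norm_eval2_le:
  assumes C: "mbound r s C f"
  shows "norm (eval2 f (x, y)) \<le> C"
proof -
  have "norm (eval2 f (x, y)) \<le> infsum (\<lambda>(i, j). norm (coeff2 f i j * x ^ i * y ^ j)) UNIV"
    using norm_infsum_bound[of "\<lambda>(i, j). coeff2 f i j * x ^ i * y ^ j" UNIV] mbound_summable(1)[OF C xr ys]
    by (simp add: eval2_def case_prod_unfold)
  also have "\<dots> \<le> C"
    by (rule mbound_summable[OF C xr ys])
  finally show ?thesis .
qed

lemma eval2_monomial: "eval2 (const2 c * X2 ^ a * Y2 ^ b) (x, y) = c * x ^ a * y ^ b"
proof -
  have "eval2 (const2 c * X2 ^ a * Y2 ^ b) (x, y) = infsum (\<lambda>(i, j). c * x ^ i * y ^ j) {(a, b)}"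
    unfolding eval2_def split_conv
    by (rule infsum_cong_neutral) (auto simp: coeff2_monomial split: if_splits)
  then show ?thesis
    by simp
qed

lemma eval2_const2 [simp]: "eval2 (const2 c) (x, y) = c"
  and eval2_Y2 [simp]: "eval2 Y2 (x, y) = y"
  and eval2_0 [simp]: "eval2 0 (x, y) = 0"
  and eval2_1 [simp]: "eval2 1 (x, y) = 1"
  using eval2_monomial[of c 0 0] eval2_monomial[of 1 0 1] eval2_monomial[of 0 0 0]
    eval2_monomial[of 1 0 0] by simp_all

lemma eval2_diff: "f \<in> conv_on r s \<Longrightarrow> g \<in> conv_on r s \<Longrightarrow> eval2 (f - g) (x, y) = eval2 f (x, y) - eval2 g (x, y)"
  using eval2_add[of "f - g" g] conv_on_ring(2)[OF rs_nonneg] by simp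

lemma eval2_mult:
  assumes f: "f \<in> conv_on r s" and g: "g \<in> conv_on r s"
  shows "eval2 (f * g) (x, y) = eval2 f (x, y) * eval2 g (x, y)"
proof -
  note rs = rs_nonneg
  note mem = conv_on_ring[OF rs] conv_on_power[OF rs]
  have 1: "eval2 (const2 c * X2 ^ a * Y2 ^ b * g) (x, y)
      = eval2 (const2 c * X2 ^ a * Y2 ^ b) (x, y) * eval2 g (x, y)" for c a b
  proof -
    let ?m = "const2 c * X2 ^ a * Y2 ^ b"
    have m: "?m \<in> conv_on r s"
      by (intro mem)
    then obtain M where M: "mbound r s M ?m"
      by (auto simp: conv_on_def)
    show ?thesis
    proof (rule bounded_additive_eqI[OF rs g, where K = M])
      fix h C assume C: "mbound r s C h"
      show "norm (eval2 (?m * h) (x, y)) \<le> M * C"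
        by (rule norm_eval2_le[OF mbound_mult[OF rs M C]])
      show "norm (eval2 ?m (x, y) * eval2 h (x, y)) \<le> M * C"
        unfolding norm_mult
        by (intro mult_mono norm_eval2_le M C mbound_nonneg[OF M] norm_ge_zero)
    next
      fix d a' b'
      have "const2 c * X2 ^ a * Y2 ^ b * (const2 d * X2 ^ a' * Y2 ^ b')
          = const2 (c * d) * X2 ^ (a + a') * Y2 ^ (b + b')"
        by (simp add: const2_mult power_add mult_ac)
      then have "eval2 (?m * (const2 d * X2 ^ a' * Y2 ^ b')) (x, y) = c * d * x ^ (a + a') * y ^ (b + b')"
        by (simp only: eval2_monomial)
      then show "eval2 (?m * (const2 d * X2 ^ a' * Y2 ^ b')) (x, y) = eval2 ?m (x, y) * eval2 (const2 d * X2 ^ a' * Y2 ^ b') (x, y)"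
        by (simp only: eval2_monomial) (simp add: power_add mult_ac)
    qed (simp_all only: distrib_left eval2_add mem m)
  qed
  obtain M where M: "mbound r s M g"
    using g by (auto simp: conv_on_def)
  show ?thesis
  proof (rule bounded_additive_eqI[OF rs f, where K = M])
    fix h C assume C: "mbound r s C h"
    show "norm (eval2 (h * g) (x, y)) \<le> M * C"
      using norm_eval2_le[OF mbound_mult[OF rs C M]] by (simp add: mult.commute)
    have "norm (eval2 h (x, y)) * norm (eval2 g (x, y)) \<le> C * M"
      by (intro mult_mono norm_eval2_le M C mbound_nonneg[OF C] norm_ge_zero)
    then show "norm (eval2 h (x, y) * eval2 g (x, y)) \<le> M * C"
      by (simp add: norm_mult mult.commute)
  qed (simp_all only: distrib_right eval2_add mem g 1)
qed

lemma eval2_power: "f \<in> conv_on r s \<Longrightarrow> eval2 (f ^ n) (x, y) = eval2 f (x, y) ^ n"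
  by (induction n) (simp_all add: eval2_mult conv_on_power[OF rs_nonneg])

lemma eval2_sum:
  "(\<And>a. a \<in> A \<Longrightarrow> f a \<in> conv_on r s) \<Longrightarrow> eval2 (sum f A) (x, y) = (\<Sum>a\<in>A. eval2 (f a) (x, y))"
  by (induction A rule: infinite_finite_induct) (simp_all add: eval2_add conv_on_sum[OF rs_nonneg])

end

lemma deriv_add: "deriv_x (f + g) = deriv_x f + deriv_x g" "deriv_y (f + g) = deriv_y f + deriv_y g"
  using hasse_add[of f g 1 0] hasse_add[of f g 0 1] by (simp_all only: hasse_1_0 hasse_0_1)

lemma deriv_diff: "deriv_x (f - g) = deriv_x f - deriv_x g" "deriv_y (f - g) = deriv_y f - deriv_y g"
  using deriv_add[of "f - g" g] by simp_all

lemma deriv_sum: "deriv_x (sum f A) = (\<Sum>a\<in>A. deriv_x (f a))" "deriv_y (sum f A) = (\<Sum>a\<in>A. deriv_y (f a))"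
proof -
  have "deriv_x 0 = 0" "deriv_y 0 = 0"
    using deriv_diff[of 0 0] by simp_all
  then show "deriv_x (sum f A) = (\<Sum>a\<in>A. deriv_x (f a))" "deriv_y (sum f A) = (\<Sum>a\<in>A. deriv_y (f a))"
    by (induction A rule: infinite_finite_induct) (simp_all add: deriv_add)
qed

lemma deriv_monomial:
  "deriv_x (const2 c * X2 ^ a * Y2 ^ b) = const2 (of_nat a * c) * X2 ^ (a - 1) * Y2 ^ b"
  "deriv_y (const2 c * X2 ^ a * Y2 ^ b) = const2 (of_nat b * c) * X2 ^ a * Y2 ^ (b - 1)"
  by (rule series2_eqI; auto simp: deriv_x_def deriv_y_def coeff2_monomial)+

lemma mbound_deriv:
  assumes "mbound r s C f" "0 \<le> r'" "r' < r" "0 \<le> s'" "s' < s"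
  shows "mbound r' s' (C / (r - r')) (deriv_x f)" "mbound r' s' (C / (s - s')) (deriv_y f)"
  using mbound_hasse[of r' s' "r - r'" "s - s'" C f 1 0] mbound_hasse[of r' s' "r - r'" "s - s'" C f 0 1] assms
  by (simp_all add: hasse_1_0 hasse_0_1 flip: One_nat_def)

lemma conv_on_deriv:
  assumes "f \<in> conv_on r s" "0 \<le> r'" "r' < r" "0 \<le> s'" "s' < s"
  shows "deriv_x f \<in> conv_on r' s'" "deriv_y f \<in> conv_on r' s'"
  using assms mbound_deriv unfolding conv_on_def by blast+

text \<open>Termwise differentiation: the derivatives of the polynomials \<open>box_part n f\<close> converge
  uniformly on a slightly smaller polydisc.\<close>

lemma conv_on_eval2_has_derivative:
  assumes f: "f \<in> conv_on r s" and xy: "norm x < r" "norm y < s"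
  shows "(eval2 f has_derivative
    (\<lambda>(h, k). eval2 (deriv_x f) (x, y) * h + eval2 (deriv_y f) (x, y) * k)) (at (x, y))"
proof -
  obtain r' s' where rs': "norm x < r'" "r' < r" "norm y < s'" "s' < s"
    using xy by (meson dense)
  then have pos: "0 \<le> r'" "0 \<le> s'" "0 \<le> r" "0 \<le> s"
    using norm_ge_zero[of x] norm_ge_zero[of y] xy by linarith+
  define S where "S = ball (0::complex) r' \<times> ball (0::complex) s'"
  have S: "norm (fst z) \<le> r'" "norm (snd z) \<le> s'" if "z \<in> S" for z
    using that by (auto simp: S_def)
  have openS: "open S" and convS: "convex S" and inS: "(x, y) \<in> S"
    using rs' by (auto simp: S_def intro: open_Times convex_Times)
  let ?D = "\<lambda>f z (h, k). eval2 (deriv_x f) z * h + eval2 (deriv_y f) z * k"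
  note mem = conv_on_ring[OF pos(1,2)] conv_on_power[OF pos(1,2)]
  have mono: "(eval2 (const2 c * X2 ^ a * Y2 ^ b) has_derivative ?D (const2 c * X2 ^ a * Y2 ^ b) z) (at z within S)"
    if "z \<in> S" for c a b z
  proof -
    define m where "m = const2 c * X2 ^ a * Y2 ^ b"
    have ev: "eval2 (const2 d * X2 ^ a' * Y2 ^ b') w = d * fst w ^ a' * snd w ^ b'" if "w \<in> S" for d a' b' w
      using eval2_monomial[OF S[OF that], of d a' b'] by simp
    have d: "eval2 (deriv_x m) z = of_nat a * c * fst z ^ (a - 1) * snd z ^ b"
      "eval2 (deriv_y m) z = of_nat b * c * fst z ^ a * snd z ^ (b - 1)"
      unfolding m_def deriv_monomial ev[OF that] by simp_all
    have "((\<lambda>z. c * fst z ^ a * snd z ^ b) has_derivative ?D m z) (at z within S)"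
      by (auto intro!: derivative_eq_intros simp: d fun_eq_iff algebra_simps)
    then show ?thesis
      unfolding m_def[symmetric]
      by (rule has_derivative_transform[OF that, rotated]) (simp add: m_def ev)
  qed
  have box: "(eval2 (box_part n f) has_derivative ?D (box_part n f) z) (at z within S)" if z: "z \<in> S" for n z
  proof -
    obtain x' y' where z': "z = (x', y')"
      by (cases z)
    have le: "norm x' \<le> r'" "norm y' \<le> s'"
      using S[OF z] by (simp_all add: z')
    have D: "?D (box_part n f) z = (\<lambda>u. \<Sum>i<n. \<Sum>j<n. ?D (const2 (coeff2 f i j) * X2 ^ i * Y2 ^ j) z u)"
      unfolding box_part_def deriv_sum deriv_monomial z'
      by (auto simp: fun_eq_iff eval2_sum[OF le] mem conv_on_sum[OF pos(1,2)] sum_distrib_right sum.distrib)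
    have "((\<lambda>z. \<Sum>i<n. \<Sum>j<n. eval2 (const2 (coeff2 f i j) * X2 ^ i * Y2 ^ j) z) has_derivative
        ?D (box_part n f) z) (at z within S)"
      unfolding D by (intro has_derivative_sum mono z)
    then show ?thesis
    proof (rule has_derivative_transform[OF z, rotated])
      fix w assume "w \<in> S"
      then show "eval2 (box_part n f) w = (\<Sum>i<n. \<Sum>j<n. eval2 (const2 (coeff2 f i j) * X2 ^ i * Y2 ^ j) w)"
        using S[of w] by (cases w) (simp add: box_part_def eval2_sum mem conv_on_sum[OF pos(1,2)])
    qed
  qed
  have fS: "f \<in> conv_on r' s'"
    using conv_on_mono[OF f] pos rs' by simp
  have lim: "(\<lambda>n. eval2 (box_part n f) z) \<longlonglongrightarrow> eval2 f z" if "z \<in> S" for z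
  proof (rule LIMSEQ_I)
    fix e :: real assume "0 < e"
    then obtain N where N: "\<And>n. N \<le> n \<Longrightarrow> mbound r' s' (e / 2) (f - box_part n f)"
      using mbound_tail[OF fS pos(1,2), of "e / 2"] by auto
    have "norm (eval2 (box_part n f) z - eval2 f z) < e" if n: "N \<le> n" for n
    proof -
      have "norm (eval2 (f - box_part n f) z) \<le> e / 2"
        using norm_eval2_le[OF S[OF \<open>z \<in> S\<close>] N[OF n]] by simp
      then show ?thesis
        using eval2_diff[OF S[OF \<open>z \<in> S\<close>] fS box_part_conv_on[OF pos(1,2), of n f]] \<open>0 < e\<close>
        by (simp add: norm_minus_commute)
    qed
    then show "\<exists>no. \<forall>n\<ge>no. norm (eval2 (box_part n f) z - eval2 f z) < e"
      by blast
  qed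
  have "\<exists>g. \<forall>z\<in>S. (\<lambda>n. eval2 (box_part n f) z) \<longlonglongrightarrow> g z \<and> (g has_derivative ?D f z) (at z within S)"
  proof (rule has_derivative_sequence[OF convS box _ inS lim[OF inS]])
    fix e :: real assume e: "0 < e"
    define d where "d = e * min (r - r') (s - s') / 2"
    have d: "0 < d" "d / (r - r') \<le> e / 2" "d / (s - s') \<le> e / 2"
      using rs' e by (simp_all add: d_def pos_divide_le_eq) (simp_all add: min_def)
    obtain N where N: "\<And>n. N \<le> n \<Longrightarrow> mbound r s d (f - box_part n f)"
      using mbound_tail[OF f pos(3,4) d(1)] by blast
    have "norm (?D (box_part n f) z u - ?D f z u) \<le> e * norm u" if n: "N \<le> n" and z: "z \<in> S" for n z u
    proof -
      obtain x' y' h k where zu: "z = (x', y')" "u = (h, k)"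
        by (cases z; cases u)
      have le: "norm x' \<le> r'" "norm y' \<le> s'"
        using S[OF z] by (simp_all add: zu)
      let ?t = "f - box_part n f"
      have hk: "norm h \<le> norm u" "norm k \<le> norm u"
        by (simp_all add: zu norm_Pair)
      have bx: "mbound r' s' (e / 2) (deriv_x ?t)" "mbound r' s' (e / 2) (deriv_y ?t)"
        using mbound_deriv[OF N[OF n] pos(1) rs'(2) pos(2) rs'(4)] d by (auto intro: mbound_mono)
      have 1: "norm (eval2 (deriv_x ?t) z * h) \<le> e / 2 * norm u" "norm (eval2 (deriv_y ?t) z * k) \<le> e / 2 * norm u"
        unfolding norm_mult zu(1)
        by (intro mult_mono norm_eval2_le[OF le bx(1)] norm_eval2_le[OF le bx(2)] hk norm_ge_zero;
            use e in simp)+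
      have "?D f z u - ?D (box_part n f) z u = eval2 (deriv_x ?t) z * h + eval2 (deriv_y ?t) z * k"
        unfolding zu deriv_diff split_conv
        by (subst (1 2) eval2_diff[OF le])
          (simp_all add: conv_on_deriv[OF f pos(1) rs'(2) pos(2) rs'(4)] algebra_simps
            conv_on_deriv[OF box_part_conv_on[OF pos(3,4)] pos(1) rs'(2) pos(2) rs'(4)])
      then have "norm (?D f z u - ?D (box_part n f) z u) \<le> e * norm u"
        using norm_triangle_ineq[of "eval2 (deriv_x ?t) z * h" "eval2 (deriv_y ?t) z * k"] 1 by simp
      then show ?thesis
        by (simp only: norm_minus_commute[of "?D (box_part n f) z u"])
    qed
    then show "\<forall>\<^sub>F n in sequentially. \<forall>z\<in>S. \<forall>u. norm (?D (box_part n f) z u - ?D f z u) \<le> e * norm u"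
      unfolding eventually_sequentially by blast
  qed
  then obtain g where g: "\<And>z. z \<in> S \<Longrightarrow> (\<lambda>n. eval2 (box_part n f) z) \<longlonglongrightarrow> g z"
    "\<And>z. z \<in> S \<Longrightarrow> (g has_derivative ?D f z) (at z within S)"
    by blast
  have "eval2 f z = g z" if "z \<in> S" for z
    using LIMSEQ_unique[OF lim[OF that] g(1)[OF that]] .
  then have "(eval2 f has_derivative ?D f (x, y)) (at (x, y) within S)"
    by (intro has_derivative_transform[OF inS _ g(2)[OF inS]])
  then show ?thesis
    using at_within_open[OF inS openS] by simp
qed


section \<open>Common zeros and the determinant of multiplication\<close>

text \<open>For a Weierstrass polynomial \<open>P = y\<^sup>n - R\<close> the remainders modulo \<open>P\<close> form a free module with
  basis \<open>1, y, \<dots>, y\<^sup>n\<^sup>-\<^sup>1\<close> over the convergent series in \<open>x\<close>. \<open>mult_mat h\<close> is the matrix of the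
  multiplication by \<open>h\<close>.\<close>

definition wquot :: "real \<Rightarrow> real \<Rightarrow> nat \<Rightarrow> series2 \<Rightarrow> series2 \<Rightarrow> series2" where
  "wquot r s n R g = (SOME q. q \<in> conv_on r s \<and>
     (\<forall>i j. n \<le> j \<longrightarrow> coeff2 (g - q * (Y2 ^ n - R)) i j = 0))"

definition mult_mat :: "real \<Rightarrow> real \<Rightarrow> nat \<Rightarrow> series2 \<Rightarrow> series2 \<Rightarrow> complex fps mat" where
  "mult_mat r s n R h = mat n n (\<lambda>(i, j).
     fps_nth (h * Y2 ^ j - wquot r s n R (h * Y2 ^ j) * (Y2 ^ n - R)) i)"

lemma mult_mat_carrier: "mult_mat r s n R h \<in> carrier_mat n n"
  by (simp add: mult_mat_def)

text \<open>Series in \<open>x\<close> alone are treated as elements of \<open>conv_on r s\<close>, so that the results on two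
  variables apply to them.\<close>

definition xconv :: "real \<Rightarrow> real \<Rightarrow> complex fps set" where
  "xconv r s = {a. fps_const a \<in> conv_on r s}"

definition xeval :: "complex \<Rightarrow> complex fps \<Rightarrow> complex" where
  "xeval x a = eval2 (fps_const a) (x, 0)"

lemma coeff2_fps_const: "coeff2 (fps_const a) i j = (if j = 0 then fps_nth a i else 0)"
  by (simp add: coeff2_def)

lemma xconv_row:
  assumes "0 < r" "0 < s" "f \<in> conv_on r s"
  shows "fps_nth f j \<in> xconv r s"
proof -
  obtain C where C: "mbound r s C f"
    using assms by (auto simp: conv_on_def)
  have "mbound r s (C / (r ^ 0 * s ^ j)) (fps_const (fps_nth f j))"
    by (rule mbound_shift[OF assms(1,2) C]) (auto simp: coeff2_fps_const coeff2_def)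
  then show ?thesis
    by (auto simp: xconv_def conv_on_def)
qed

lemma poly_y_expand:
  assumes "\<And>i j. n \<le> j \<Longrightarrow> coeff2 f i j = 0"
  shows "f = (\<Sum>j<n. fps_const (fps_nth f j) * Y2 ^ j)"
proof (rule series2_eqI)
  fix i j
  have "coeff2 (fps_const (fps_nth f l) * Y2 ^ l) i j = (if l = j then coeff2 f i j else 0)" for l
    using coeff2_Y2_power_mult[of l "fps_const (fps_nth f l)" i j]
    by (simp add: mult.commute[of _ "Y2 ^ l"] coeff2_fps_const coeff2_def)
  then show "coeff2 f i j = coeff2 (\<Sum>j<n. fps_const (fps_nth f j) * Y2 ^ j) i j"
    using assms[of j i] by simp
qed

context
  fixes r s :: real and x :: complex
  assumes r: "0 < r" and s: "0 < s"
begin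

lemma xconv_ring:
  "a \<in> xconv r s \<Longrightarrow> b \<in> xconv r s \<Longrightarrow> a + b \<in> xconv r s"
  "a \<in> xconv r s \<Longrightarrow> b \<in> xconv r s \<Longrightarrow> a * b \<in> xconv r s"
  "a \<in> xconv r s \<Longrightarrow> - a \<in> xconv r s"
  "0 \<in> xconv r s" "1 \<in> xconv r s"
  using r s
  by (auto simp: xconv_def conv_on_ring fps_const_mult[symmetric] fps_const_add[symmetric]
      fps_const_neg[symmetric] simp del: fps_const_mult fps_const_add fps_const_neg)

lemma xconv_sum: "(\<And>i. i \<in> A \<Longrightarrow> f i \<in> xconv r s) \<Longrightarrow> sum f A \<in> xconv r s"
  by (induction A rule: infinite_finite_induct) (auto simp: xconv_ring)

lemma xconv_prod: "(\<And>i. i \<in> A \<Longrightarrow> f i \<in> xconv r s) \<Longrightarrow> prod f A \<in> xconv r s"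
  by (induction A rule: infinite_finite_induct) (auto simp: xconv_ring)

lemma xconv_signof: "signof p \<in> xconv r s"
  by (auto simp: sign_def xconv_ring)

lemma xconv_det:
  assumes "A \<in> carrier_mat n n" "\<And>i j. i < n \<Longrightarrow> j < n \<Longrightarrow> A $$ (i, j) \<in> xconv r s"
  shows "det A \<in> xconv r s"
  unfolding det_def'[OF assms(1)]
proof (intro xconv_sum xconv_ring xconv_signof xconv_prod)
  fix p i assume "p \<in> {p. p permutes {0..<n}}" "i \<in> {0..<n}"
  then show "A $$ (i, p i) \<in> xconv r s"
    using assms(2)[of i "p i"] permutes_in_image[of p "{0..<n}" i] by auto
qed

lemma xconv_adj_mat:
  assumes "A \<in> carrier_mat n n" "\<And>i j. i < n \<Longrightarrow> j < n \<Longrightarrow> A $$ (i, j) \<in> xconv r s" "i < n" "j < n"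
  shows "adj_mat A $$ (i, j) \<in> xconv r s"
proof -
  have "det (mat_delete A j i) \<in> xconv r s"
  proof (rule xconv_det)
    show "mat_delete A j i \<in> carrier_mat (n - 1) (n - 1)"
      using assms(1) by (rule mat_delete_carrier)
    show "mat_delete A j i $$ (k, l) \<in> xconv r s" if "k < n - 1" "l < n - 1" for k l
      using that assms by (auto simp: mat_delete_def)
  qed
  moreover have "(- 1) ^ (j + i) \<in> xconv r s"
    by (cases "even (j + i)") (simp_all add: xconv_ring)
  ultimately show ?thesis
    using assms by (simp add: adj_mat_def cofactor_def xconv_ring)
qed

context
  assumes x: "norm x \<le> r"
begin

lemma norm_0_le_s: "norm (0 :: complex) \<le> s"
  using s by simp

lemma xeval_add: "a \<in> xconv r s \<Longrightarrow> b \<in> xconv r s \<Longrightarrow> xeval x (a + b) = xeval x a + xeval x b"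
  and xeval_mult: "a \<in> xconv r s \<Longrightarrow> b \<in> xconv r s \<Longrightarrow> xeval x (a * b) = xeval x a * xeval x b"
  and xeval_0: "xeval x 0 = 0" and xeval_1: "xeval x 1 = 1"
  using eval2_add[OF x norm_0_le_s] eval2_mult[OF x norm_0_le_s] eval2_0[OF x norm_0_le_s] eval2_1[OF x norm_0_le_s]
  by (simp_all add: xeval_def xconv_def fps_const_mult[symmetric] fps_const_add[symmetric]
      del: fps_const_mult fps_const_add)

lemma xeval_neg_1: "xeval x (- 1) = - 1"
  using xeval_add[of "- 1" 1] by (simp add: xconv_ring xeval_0 xeval_1 eq_neg_iff_add_eq_0)

lemma xeval_sum: "(\<And>i. i \<in> A \<Longrightarrow> f i \<in> xconv r s) \<Longrightarrow> xeval x (sum f A) = (\<Sum>i\<in>A. xeval x (f i))"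
  by (induction A rule: infinite_finite_induct) (auto simp: xeval_0 xeval_add xconv_sum)

lemma xeval_prod: "(\<And>i. i \<in> A \<Longrightarrow> f i \<in> xconv r s) \<Longrightarrow> xeval x (prod f A) = (\<Prod>i\<in>A. xeval x (f i))"
  by (induction A rule: infinite_finite_induct) (auto simp: xeval_1 xeval_mult xconv_prod)

lemma eval2_fps_const:
  assumes y: "norm y \<le> s" and a: "a \<in> xconv r s"
  shows "eval2 (fps_const a) (x, y) = xeval x a"
proof -
  have "(\<lambda>(i, j). coeff2 (fps_const a) i j * x ^ i * y ^ j) = (\<lambda>(i, j). coeff2 (fps_const a) i j * x ^ i * 0 ^ j)"
    by (auto simp: coeff2_fps_const fun_eq_iff)
  then show ?thesis
    by (simp add: xeval_def eval2_def)
qed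

lemma xeval_det:
  assumes A: "A \<in> carrier_mat n n" "\<And>i j. i < n \<Longrightarrow> j < n \<Longrightarrow> A $$ (i, j) \<in> xconv r s"
  shows "det (map_mat (xeval x) A) = xeval x (det A)"
proof -
  have A': "map_mat (xeval x) A \<in> carrier_mat n n"
    using A by simp
  have mem: "A $$ (i, p i) \<in> xconv r s" if "p permutes {0..<n}" "i \<in> {0..<n}" for p i
    using that A(2)[of i "p i"] permutes_in_image[of p "{0..<n}" i] by auto
  have "xeval x (det A) = (\<Sum>p | p permutes {0..<n}. xeval x (signof p * (\<Prod>i = 0..<n. A $$ (i, p i))))"
    unfolding det_def'[OF A(1)]
    by (rule xeval_sum) (auto intro!: xconv_ring xconv_signof xconv_prod mem)
  also have "\<dots> = (\<Sum>p | p permutes {0..<n}. signof p * (\<Prod>i = 0..<n. xeval x (A $$ (i, p i))))"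
  proof (intro sum.cong refl)
    fix p assume p: "p \<in> {p. p permutes {0..<n}}"
    have "xeval x (signof p) = signof p"
      by (simp add: sign_def xeval_1 xeval_neg_1)
    then show "xeval x (signof p * (\<Prod>i = 0..<n. A $$ (i, p i))) = signof p * (\<Prod>i = 0..<n. xeval x (A $$ (i, p i)))"
      using p xeval_mult[OF xconv_signof xconv_prod, of "{0..<n}" "\<lambda>i. A $$ (i, p i)" p]
        xeval_prod[of "{0..<n}" "\<lambda>i. A $$ (i, p i)"] mem by simp
  qed
  also have "\<dots> = (\<Sum>p | p permutes {0..<n}. signof p * (\<Prod>i = 0..<n. map_mat (xeval x) A $$ (i, p i)))"
    using A(1) by (intro sum.cong refl arg_cong2[of _ _ _ _ times] prod.cong)
      (auto dest: permutes_in_image)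
  also have "\<dots> = det (map_mat (xeval x) A)"
    by (rule det_def'[OF A', symmetric])
  finally show ?thesis
    by simp
qed

end

end

lemma xeval_holomorphic:
  assumes "a \<in> xconv r s" "0 < s"
  shows "(\<lambda>x. xeval x a) holomorphic_on ball 0 r"
proof -
  have "\<exists>d. ((\<lambda>x. xeval x a) has_field_derivative d) (at x)" if x: "norm x < r" for x
  proof -
    have "fps_const a \<in> conv_on r s"
      using assms by (simp add: xconv_def)
    then have d1: "(eval2 (fps_const a) has_derivative (\<lambda>(h, k). eval2 (deriv_x (fps_const a)) (x, 0) * h
        + eval2 (deriv_y (fps_const a)) (x, 0) * k)) (at (x, 0))"
      using x assms(2) by (intro conv_on_eval2_has_derivative) auto
    have d2: "((\<lambda>x. (x, 0 :: complex)) has_derivative (\<lambda>h. (h, 0))) (at x)"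
      by (auto intro!: derivative_eq_intros)
    have "((\<lambda>x. eval2 (fps_const a) (x, 0)) has_derivative
        (\<lambda>h. eval2 (deriv_x (fps_const a)) (x, 0) * h)) (at x)"
      using has_derivative_compose[OF d2 d1] by simp
    then show ?thesis
      by (auto simp: has_field_derivative_def xeval_def)
  qed
  then show ?thesis
    by (auto simp: holomorphic_on_open)
qed

context
  fixes r s :: real and n :: nat and R :: series2
  assumes R: "weierstrass_tail r s n R"
begin

lemma weierstrass_tailD:
  shows rpos: "0 < r" and spos: "0 < s" and "wt_ge 1 0 1 R" "mbound r s (s ^ n / 2) R"
    "\<And>i j. n \<le> j \<Longrightarrow> coeff2 R i j = 0" and R_conv: "R \<in> conv_on r s"
  using R by (auto simp: weierstrass_tail_def intro: conv_onI)

lemma P_conv: "Y2 ^ n - R \<in> conv_on r s"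
  using R_conv rpos spos by (intro conv_on_ring conv_on_power) auto

lemma wquot:
  assumes "g \<in> conv_on r s"
  shows "wquot r s n R g \<in> conv_on r s"
    and "n \<le> j \<Longrightarrow> coeff2 (g - wquot r s n R g * (Y2 ^ n - R)) i j = 0"
proof -
  have "wt_ge 1 0 1 (- R)" "mbound r s (s ^ n / 2) (- R)"
    using weierstrass_tailD by (auto intro: wt_ge_uminus mbound_uminus)
  then obtain q where "q \<in> conv_on r s" "\<And>i j. n \<le> j \<Longrightarrow> coeff2 (g - q * (Y2 ^ n + - R)) i j = 0"
    using weierstrass_division[OF rpos spos, of "- R" n g] assms by metis
  then have "\<exists>q. q \<in> conv_on r s \<and> (\<forall>i j. n \<le> j \<longrightarrow> coeff2 (g - q * (Y2 ^ n - R)) i j = 0)"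
    by auto
  from someI_ex[OF this] show "wquot r s n R g \<in> conv_on r s"
    "n \<le> j \<Longrightarrow> coeff2 (g - wquot r s n R g * (Y2 ^ n - R)) i j = 0"
    unfolding wquot_def by blast+
qed

context
  fixes h :: series2
  assumes h: "h \<in> conv_on r s"
begin

abbreviation (input) "M \<equiv> mult_mat r s n R h"

lemma hY_conv: "h * Y2 ^ j \<in> conv_on r s"
  using h rpos spos by (intro conv_on_ring conv_on_power) auto

lemma mult_mat_xconv:
  assumes "i < n" "j < n"
  shows "M $$ (i, j) \<in> xconv r s"
proof -
  have "h * Y2 ^ j - wquot r s n R (h * Y2 ^ j) * (Y2 ^ n - R) \<in> conv_on r s"
    using rpos spos by (intro conv_on_ring(2) hY_conv conv_on_ring(3)[OF _ _ wquot(1)[OF hY_conv] P_conv]) auto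
  then have "fps_nth (h * Y2 ^ j - wquot r s n R (h * Y2 ^ j) * (Y2 ^ n - R)) i \<in> xconv r s"
    using rpos spos by (intro xconv_row)
  then show ?thesis
    using assms by (simp add: mult_mat_def)
qed

lemma mult_mat_eq:
  assumes "j < n"
  shows "h * Y2 ^ j = wquot r s n R (h * Y2 ^ j) * (Y2 ^ n - R) + (\<Sum>i<n. fps_const (M $$ (i, j)) * Y2 ^ i)"
proof -
  have "h * Y2 ^ j - wquot r s n R (h * Y2 ^ j) * (Y2 ^ n - R) = (\<Sum>i<n. fps_const (M $$ (i, j)) * Y2 ^ i)"
    using poly_y_expand[of n "h * Y2 ^ j - wquot r s n R (h * Y2 ^ j) * (Y2 ^ n - R)"] wquot(2)[OF hY_conv] assms
    by (simp add: mult_mat_def)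
  then show ?thesis
    by (simp add: algebra_simps)
qed

lemma mult_mat_eval:
  assumes "j < n" "norm x \<le> r" "norm y \<le> s"
  shows "eval2 h (x, y) * y ^ j = eval2 (wquot r s n R (h * Y2 ^ j)) (x, y) * eval2 (Y2 ^ n - R) (x, y)
    + (\<Sum>i<n. xeval x (M $$ (i, j)) * y ^ i)"
proof -
  note mem = conv_on_ring[OF less_imp_le[OF rpos] less_imp_le[OF spos]] conv_on_power[OF less_imp_le[OF rpos] less_imp_le[OF spos]]
    conv_on_sum[OF less_imp_le[OF rpos] less_imp_le[OF spos]]
  note ev = eval2_add[OF assms(2,3)] eval2_mult[OF assms(2,3)] eval2_power[OF assms(2,3)] eval2_sum[OF assms(2,3)]
  have c: "fps_const (M $$ (i, j)) \<in> conv_on r s" if "i < n" for i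
    using mult_mat_xconv[OF that assms(1)] by (simp add: xconv_def)
  have "eval2 h (x, y) * y ^ j = eval2 (h * Y2 ^ j) (x, y)"
    using h assms by (simp add: ev mem)
  also have "\<dots> = eval2 (wquot r s n R (h * Y2 ^ j)) (x, y) * eval2 (Y2 ^ n - R) (x, y)
      + eval2 (\<Sum>i<n. fps_const (M $$ (i, j)) * Y2 ^ i) (x, y)"
  proof -
    have "eval2 (h * Y2 ^ j) (x, y) = eval2 (wquot r s n R (h * Y2 ^ j) * (Y2 ^ n - R)
        + (\<Sum>i<n. fps_const (M $$ (i, j)) * Y2 ^ i)) (x, y)"
      by (rule arg_cong[OF mult_mat_eq[OF assms(1)]])
    moreover have "wquot r s n R (h * Y2 ^ j) * (Y2 ^ n - R) \<in> conv_on r s"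
      using rpos spos by (intro conv_on_ring(3) wquot hY_conv P_conv) auto
    moreover have "(\<Sum>i<n. fps_const (M $$ (i, j)) * Y2 ^ i) \<in> conv_on r s"
      using c by (intro mem) auto
    ultimately show ?thesis
      by (simp only: ev(1) ev(2)[OF wquot(1)[OF hY_conv] P_conv])
  qed
  also have "eval2 (\<Sum>i<n. fps_const (M $$ (i, j)) * Y2 ^ i) (x, y)
      = (\<Sum>i<n. eval2 (fps_const (M $$ (i, j)) * Y2 ^ i) (x, y))"
    by (rule ev) (simp add: mem c)
  also have "\<dots> = (\<Sum>i<n. xeval x (M $$ (i, j)) * y ^ i)"
    using assms by (intro sum.cong refl)
      (simp add: ev mem c eval2_fps_const[OF rpos spos assms(2,3)] mult_mat_xconv)
  finally show ?thesis .
qed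

lemma det_mult_mat_xconv: "det M \<in> xconv r s"
  using rpos spos mult_mat_carrier mult_mat_xconv by (rule xconv_det)

text \<open>At a common zero \<open>(x, y)\<close> the row vector \<open>(1, y, \<dots>, y\<^sup>n\<^sup>-\<^sup>1)\<close> is killed by the matrix.\<close>

lemma det_mult_mat_eq_0:
  assumes xy: "norm x \<le> r" "norm y \<le> s" and n: "0 < n"
    and zero: "eval2 (Y2 ^ n - R) (x, y) = 0" "eval2 h (x, y) = 0"
  shows "xeval x (det M) = 0"
proof -
  define m where "m = map_mat (xeval x) M"
  have m: "m \<in> carrier_mat n n"
    using mult_mat_carrier by (simp add: m_def)
  define w where "w = vec n (\<lambda>i. y ^ i)"
  have "m\<^sup>T *\<^sub>v w = 0\<^sub>v n"
  proof (rule eq_vecI)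
    fix j assume "j < dim_vec (0\<^sub>v n :: complex vec)"
    then have j: "j < n"
      by simp
    have "vec_index (m\<^sup>T *\<^sub>v w) j = (\<Sum>i<n. xeval x (M $$ (i, j)) * y ^ i)"
      using j m mult_mat_carrier[of r s n R h]
      by (auto simp: scalar_prod_def w_def m_def lessThan_atLeast0 intro!: sum.cong)
    also have "\<dots> = 0"
      using mult_mat_eval[OF j xy] zero by simp
    finally show "vec_index (m\<^sup>T *\<^sub>v w) j = vec_index (0\<^sub>v n) j"
      using j by simp
  qed (use m in auto)
  moreover have "vec_index w 0 = 1"
    using n by (simp add: w_def)
  then have "w \<noteq> 0\<^sub>v n"
    using n by auto
  moreover have "w \<in> carrier_vec n"
    by (simp add: w_def)
  ultimately have "det m\<^sup>T = 0"
    using det_0_iff_vec_prod_zero[of "m\<^sup>T" n] m by auto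
  then have "det m = 0"
    using det_transpose[OF m] by simp
  then show ?thesis
    unfolding m_def using xeval_det[OF rpos spos xy(1) mult_mat_carrier mult_mat_xconv] by simp
qed

text \<open>The restriction of the Weierstrass polynomial \<open>y\<^sup>n - R\<close> to the fibre over \<open>x\<close>.\<close>

definition Ppoly :: "complex \<Rightarrow> complex poly" where
  "Ppoly x = Polynomial.monom 1 n - (\<Sum>j<n. Polynomial.monom (xeval x (fps_nth R j)) j)"

lemma degree_Ppoly: "degree (Ppoly x) = n"
proof (cases "n = 0")
  case False
  have "degree (\<Sum>j<n. Polynomial.monom (xeval x (fps_nth R j)) j) < n"
    using False by (intro degree_sum_less) (auto intro: le_less_trans[OF degree_monom_le])
  then show ?thesis
    unfolding Ppoly_def diff_conv_add_uminus by (subst degree_add_eq_left) (simp_all add: degree_monom_eq)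
next
  case True
  then show ?thesis
    unfolding Ppoly_def by (simp add: degree_monom_eq)
qed

lemma poly_Ppoly:
  assumes xy: "norm x \<le> r" "norm y \<le> s"
  shows "poly (Ppoly x) y = eval2 (Y2 ^ n - R) (x, y)"
proof -
  note mem = conv_on_ring[OF less_imp_le[OF rpos] less_imp_le[OF spos]] conv_on_power[OF less_imp_le[OF rpos] less_imp_le[OF spos]]
    conv_on_sum[OF less_imp_le[OF rpos] less_imp_le[OF spos]]
  note ev = eval2_add[OF xy] eval2_diff[OF xy] eval2_mult[OF xy] eval2_power[OF xy] eval2_sum[OF xy]
  have c: "fps_nth R j \<in> xconv r s" "fps_const (fps_nth R j) \<in> conv_on r s" for j
    using xconv_row[OF rpos spos R_conv, of j] by (simp_all add: xconv_def)
  have "eval2 R (x, y) = eval2 (\<Sum>j<n. fps_const (fps_nth R j) * Y2 ^ j) (x, y)"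
    using poly_y_expand[of n R] weierstrass_tailD(5) by simp
  also have "\<dots> = (\<Sum>j<n. eval2 (fps_const (fps_nth R j) * Y2 ^ j) (x, y))"
    by (rule ev) (simp add: mem c)
  also have "\<dots> = (\<Sum>j<n. xeval x (fps_nth R j) * y ^ j)"
    using xy by (intro sum.cong refl) (simp add: ev mem c eval2_fps_const[OF rpos spos xy])
  finally have "eval2 R (x, y) = (\<Sum>j<n. xeval x (fps_nth R j) * y ^ j)" .
  then show ?thesis
    using xy by (simp add: Ppoly_def poly_sum poly_monom ev mem R_conv)
qed

text \<open>The bound on \<open>R\<close> keeps all roots inside the polydisc: at a root with \<open>|y| \<ge> s\<close> the series with
  coefficients \<open>(s / y)\<^sup>n\<^sup>-\<^sup>j R\<^sub>i\<^sub>j\<close>, which satisfies the same bound as \<open>R\<close>, would have the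
  value \<open>s\<^sup>n\<close> at \<open>(x, s)\<close>.\<close>

lemma Ppoly_root_small:
  assumes x: "norm x \<le> r" and root: "poly (Ppoly x) y = 0"
  shows "norm y < s"
proof (rule ccontr)
  assume "\<not> norm y < s"
  then have y: "s \<le> norm y" "y \<noteq> 0"
    using spos by auto
  have c: "fps_nth R j \<in> xconv r s" for j
    using xconv_row[OF rpos spos R_conv, of j] by (simp_all add: xconv_def)
  define \<theta> where "\<theta> j = (of_real s / y) ^ (n - j)" for j
  have \<theta>: "norm (\<theta> j) \<le> 1" for j
    using y spos by (simp add: \<theta>_def norm_power norm_divide power_le_one)
  define T where "T = series_of_coeffs (\<lambda>i j. \<theta> j * coeff2 R i j)"
  have "mbound r s (s ^ n / 2 / (r ^ 0 * s ^ 0)) T"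
    by (rule mbound_shift[OF rpos spos weierstrass_tailD(4)])
      (use \<theta> in \<open>auto simp: T_def norm_mult intro: mult_left_le_one_le\<close>)
  then have T: "mbound r s (s ^ n / 2) T"
    by simp
  have xs: "norm x \<le> r" "norm (of_real s :: complex) \<le> s"
    using x spos by simp_all
  note mem = conv_on_ring[OF less_imp_le[OF rpos] less_imp_le[OF spos]] conv_on_power[OF less_imp_le[OF rpos] less_imp_le[OF spos]]
    conv_on_sum[OF less_imp_le[OF rpos] less_imp_le[OF spos]]
  note ev = eval2_mult[OF xs] eval2_power[OF xs] eval2_sum[OF xs]
  have "T = (\<Sum>j<n. const2 (\<theta> j) * (fps_const (fps_nth R j) * Y2 ^ j))"
  proof -
    have "fps_nth T j = fps_const (\<theta> j) * fps_nth R j" for j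
      by (simp add: T_def series_of_coeffs_def coeff2_def fps_eq_iff)
    then have "const2 (\<theta> j) * fps_const (fps_nth R j) = fps_const (fps_nth T j)" for j
      by (simp add: const2_def)
    then show ?thesis
      using poly_y_expand[of n T] weierstrass_tailD(5) by (simp add: T_def mult.assoc[symmetric])
  qed
  then have "eval2 T (x, of_real s) = (\<Sum>j<n. eval2 (const2 (\<theta> j) * (fps_const (fps_nth R j) * Y2 ^ j)) (x, of_real s))"
    using c by (simp add: ev mem xconv_def)
  also have "\<dots> = (\<Sum>j<n. \<theta> j * (xeval x (fps_nth R j) * of_real s ^ j))"
    using c xs eval2_fps_const[OF rpos spos xs c]
    by (intro sum.cong refl) (simp add: ev mem xconv_def eval2_const2[OF xs] eval2_Y2[OF xs])
  also have "\<dots> = (\<Sum>j<n. xeval x (fps_nth R j) * y ^ j) * (of_real s / y) ^ n"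
    unfolding sum_distrib_right
  proof (intro sum.cong refl)
    fix j assume "j \<in> {..<n}"
    then have "(of_real s / y) ^ n = \<theta> j * (of_real s / y) ^ j"
      by (simp add: \<theta>_def flip: power_add)
    then show "\<theta> j * (xeval x (fps_nth R j) * of_real s ^ j) = xeval x (fps_nth R j) * y ^ j * (of_real s / y) ^ n"
      using y(2) by (simp add: power_divide)
  qed
  also have "(\<Sum>j<n. xeval x (fps_nth R j) * y ^ j) = y ^ n"
    using root by (simp add: Ppoly_def poly_sum poly_monom)
  also have "y ^ n * (of_real s / y) ^ n = of_real s ^ n"
    using y(2) by (simp add: power_divide)
  finally have "norm (eval2 T (x, of_real s)) = s ^ n"
    using spos by (simp add: norm_power)
  moreover have "norm (eval2 T (x, of_real s)) \<le> s ^ n / 2"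
    by (rule norm_eval2_le[OF xs T])
  ultimately show False
    using spos by simp
qed

text \<open>Conversely, a kernel vector is a polynomial \<open>g\<close> of degree less than \<open>n\<close> in \<open>y\<close> with
  \<open>h g = H P\<close> on the fibre over \<open>x\<close>. Take such a \<open>g\<close> of minimal degree. Division with
  remainder shows that it divides \<open>P\<close>. So \<open>h\<close> vanishes at the zeros of \<open>P / g\<close>, which is not
  constant.\<close>

lemma common_zero_if_det_mult_mat_eq_0:
  assumes x: "norm x < r" and det: "xeval x (det M) = 0"
  obtains y where "norm y < s" "eval2 (Y2 ^ n - R) (x, y) = 0" "eval2 h (x, y) = 0"
proof -
  define m where "m = map_mat (xeval x) M"
  have m: "m \<in> carrier_mat n n"
    using mult_mat_carrier by (simp add: m_def)
  have "det m = 0"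
    unfolding m_def using det xeval_det[OF rpos spos less_imp_le[OF x] mult_mat_carrier mult_mat_xconv] by simp
  then obtain v where v: "v \<in> carrier_vec n" "v \<noteq> 0\<^sub>v n" "m *\<^sub>v v = 0\<^sub>v n"
    using det_0_iff_vec_prod_zero[OF m] by auto
  define k where "k y = eval2 h (x, y)" for y
  have cont: "continuous_on (ball 0 s) (\<lambda>y. eval2 g (x, y))" if g: "g \<in> conv_on r s" for g
  proof (rule continuous_at_imp_continuous_on, rule ballI)
    fix y :: complex assume "y \<in> ball 0 s"
    then have "isCont (eval2 g) (x, y)"
      using conv_on_eval2_has_derivative[OF g x, of y] has_derivative_continuous by auto
    then show "isCont (\<lambda>y. eval2 g (x, y)) y"
      by (intro isCont_o2[where f = "Pair x" and g = "eval2 g"]) (auto intro!: continuous_intros)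
  qed
  define g0 where "g0 = (\<Sum>j<n. Polynomial.monom (vec_index v j) j)"
  define H0 where "H0 y = (\<Sum>j<n. vec_index v j * eval2 (wquot r s n R (h * Y2 ^ j)) (x, y))" for y
  define good where "good g \<longleftrightarrow> g \<noteq> 0 \<and> (\<exists>H. continuous_on (ball 0 s) H \<and>
    (\<forall>y\<in>ball 0 s. k y * poly g y = H y * poly (Ppoly x) y))" for g
  have coeff_g0: "coeff g0 j = vec_index v j" if "j < n" for j
    using that by (simp add: g0_def coeff_sum)
  obtain j0 where j0: "j0 < n" "vec_index v j0 \<noteq> 0"
    using v(1,2) by (metis carrier_vecD eq_vecI index_zero_vec(1) index_zero_vec(2))
  have deg_g0: "degree g0 < n"
    unfolding g0_def using j0(1) by (intro degree_sum_less) (auto intro: le_less_trans[OF degree_monom_le])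
  have "good g0"
    unfolding good_def
  proof (intro conjI exI[of _ H0] ballI)
    show "g0 \<noteq> 0"
      using j0 coeff_g0[of j0] by auto
    show "continuous_on (ball 0 s) H0"
      unfolding H0_def by (intro continuous_intros cont wquot hY_conv)
    fix y assume "y \<in> ball (0 :: complex) s"
    then have y: "norm y \<le> s"
      by simp
    have mv: "(\<Sum>j<n. xeval x (M $$ (i, j)) * vec_index v j) = 0" if "i < n" for i
    proof -
      have "(\<Sum>j<n. xeval x (M $$ (i, j)) * vec_index v j) = vec_index (m *\<^sub>v v) i"
        using that m v(1) mult_mat_carrier[of r s n R h]
        by (auto simp: scalar_prod_def m_def lessThan_atLeast0 intro!: sum.cong)
      then show ?thesis
        using that by (simp add: v(3))
    qed
    have "k y * poly g0 y = (\<Sum>j<n. vec_index v j * (k y * y ^ j))"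
      by (simp add: g0_def poly_sum poly_monom sum_distrib_left mult_ac)
    also have "\<dots> = (\<Sum>j<n. vec_index v j * (eval2 (wquot r s n R (h * Y2 ^ j)) (x, y) * poly (Ppoly x) y
        + (\<Sum>i<n. xeval x (M $$ (i, j)) * y ^ i)))"
      unfolding k_def poly_Ppoly[OF less_imp_le[OF x] y] using mult_mat_eval[OF _ less_imp_le[OF x] y] by simp
    also have "\<dots> = H0 y * poly (Ppoly x) y + (\<Sum>j<n. \<Sum>i<n. xeval x (M $$ (i, j)) * vec_index v j * y ^ i)"
      by (simp add: H0_def distrib_left sum.distrib sum_distrib_left sum_distrib_right mult_ac)
    also have "(\<Sum>j<n. \<Sum>i<n. xeval x (M $$ (i, j)) * vec_index v j * y ^ i)
        = (\<Sum>i<n. (\<Sum>j<n. xeval x (M $$ (i, j)) * vec_index v j) * y ^ i)"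
      by (subst sum.swap) (simp add: sum_distrib_right)
    also have "\<dots> = 0"
      by (simp add: mv)
    finally show "k y * poly g0 y = H0 y * poly (Ppoly x) y"
      by simp
  qed
  then obtain g where g: "good g" and min: "\<And>g'. good g' \<Longrightarrow> degree g \<le> degree g'"
    using ex_has_least_nat[of good g0 degree] by blast
  then obtain H where H: "g \<noteq> 0" "continuous_on (ball 0 s) H"
    "\<And>y. y \<in> ball 0 s \<Longrightarrow> k y * poly g y = H y * poly (Ppoly x) y"
    by (auto simp: good_def)
  define S where "S = Ppoly x div g"
  have "Ppoly x mod g = 0"
  proof (rule ccontr)
    assume ne: "Ppoly x mod g \<noteq> 0"
    have "good (Ppoly x mod g)"
      unfolding good_def
    proof (intro conjI ne exI[of _ "\<lambda>y. k y - poly S y * H y"] ballI)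
      show "continuous_on (ball 0 s) (\<lambda>y. k y - poly S y * H y)"
        unfolding k_def by (intro continuous_intros cont h H)
      fix y assume y: "y \<in> ball (0 :: complex) s"
      have "poly (Ppoly x) y = poly S y * poly g y + poly (Ppoly x mod g) y"
        unfolding S_def by (metis div_mult_mod_eq poly_add poly_mult)
      then have "k y * poly (Ppoly x mod g) y = k y * poly (Ppoly x) y - poly S y * (k y * poly g y)"
        by (simp add: distrib_left)
      then show "k y * poly (Ppoly x mod g) y = (k y - poly S y * H y) * poly (Ppoly x) y"
        by (simp add: H(3)[OF y] left_diff_distrib mult.assoc)
    qed
    then show False
      using min degree_mod_less[OF H(1), of "Ppoly x"] ne by fastforce
  qed
  then have PS: "Ppoly x = S * g"
    unfolding S_def by (metis add.right_neutral div_mult_mod_eq)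
  moreover have "Ppoly x \<noteq> 0"
    using degree_Ppoly[of x] j0(1) by auto
  ultimately have "degree S + degree g = n"
    using degree_Ppoly[of x] by (auto simp: degree_mult_eq)
  then have "degree S \<noteq> 0"
    using min[OF \<open>good g0\<close>] deg_g0 by simp
  then obtain y0 where y0: "poly S y0 = 0"
    using Fundamental_Theorem_Algebra.fundamental_theorem_of_algebra[of S] by (auto simp: constant_degree)
  then have root: "poly (Ppoly x) y0 = 0"
    by (simp add: PS)
  then have y0s: "norm y0 < s"
    using Ppoly_root_small[of x y0] x by simp
  have "k y0 - H y0 * poly S y0 = 0"
  proof (rule ccontr)
    assume ne: "k y0 - H y0 * poly S y0 \<noteq> 0"
    let ?O = "ball 0 s \<inter> (\<lambda>y. k y - H y * poly S y) -` (- {0})"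
    have "open ?O"
      by (rule continuous_open_preimage) (auto simp: k_def intro!: continuous_intros cont h H)
    moreover have "?O \<subseteq> {y. poly g y = 0}"
    proof
      fix y assume "y \<in> ?O"
      then show "y \<in> {y. poly g y = 0}"
        using H(3)[of y] by (auto simp: PS)
    qed
    then have "finite ?O"
      using poly_roots_finite[OF H(1)] finite_subset by blast
    moreover have "y0 \<in> ?O"
      using ne y0s by simp
    ultimately show False
      using finite_imp_not_open by blast
  qed
  then have "eval2 h (x, y0) = 0"
    by (simp add: y0 k_def)
  then show ?thesis
    using that y0s root poly_Ppoly[of x y0] x by simp
qed

end

end

section \<open>Isolated singularities and the Jacobian ideal\<close>

text \<open>Otherwise \<open>Z\<close> is covered by open sets in which it is countable, and countably many of these
  suffice by Lindelof's theorem.\<close>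

lemma uncountable_condensation_point:
  fixes Z :: "'a :: second_countable_topology set"
  assumes "uncountable Z"
  obtains z where "z \<in> Z" "\<And>V. open V \<Longrightarrow> z \<in> V \<Longrightarrow> uncountable (Z \<inter> V)"
proof -
  have "\<exists>z\<in>Z. \<forall>V. open V \<longrightarrow> z \<in> V \<longrightarrow> uncountable (Z \<inter> V)"
  proof (rule ccontr)
    assume "\<not> ?thesis"
    then have *: "\<exists>V. open V \<and> z \<in> V \<and> countable (Z \<inter> V)" if "z \<in> Z" for z
      using that by blast
    define F where "F = {V. open V \<and> countable (Z \<inter> V)}"
    obtain F' where F': "F' \<subseteq> F" "countable F'" "\<Union>F' = \<Union>F"
      using Lindelof[of F] by (auto simp: F_def)
    have "Z \<subseteq> \<Union>F'"
      unfolding F'(3) using * by (fastforce simp: F_def)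
    then have "Z = (\<Union>V\<in>F'. Z \<inter> V)"
      by blast
    moreover have "countable (\<Union>V\<in>F'. Z \<inter> V)"
      using F' by (intro countable_UN) (auto simp: F_def)
    ultimately show False
      using assms by simp
  qed
  then show ?thesis
    using that by blast
qed

text \<open>An uncountable set of zeros accumulates at one of its points, and the identity theorem applies.\<close>

lemma holomorphic_uncountable_zeros:
  assumes "g holomorphic_on S" "open S" "connected S" "W \<subseteq> S" "uncountable W"
    and "\<And>x. x \<in> W \<Longrightarrow> g x = 0" and "x \<in> S"
  shows "g x = 0"
proof -
  obtain z where z: "z \<in> W" "\<And>V. open V \<Longrightarrow> z \<in> V \<Longrightarrow> uncountable (W \<inter> V)"
    using uncountable_condensation_point[OF assms(5)] by blast
  have "z islimpt W"
    unfolding islimpt_def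
  proof (intro allI impI)
    fix V assume "z \<in> V" "open V"
    then have "uncountable (W \<inter> V - {z})"
      using z by (intro uncountable_minus_countable) auto
    then show "\<exists>y\<in>W. y \<in> V \<and> y \<noteq> z"
      using countable_empty by (cases "W \<inter> V - {z} = {}") auto
  qed
  then show ?thesis
    using analytic_continuation[OF assms(1-4) subsetD[OF assms(4) z(1)] _ assms(6,7)] by blast
qed

text \<open>The implicit function theorem for a holomorphic function of two variables, from the inverse
  function theorem for \<open>(x, y) \<mapsto> (x, G (x, y))\<close>.\<close>

lemma holomorphic_implicit_function:
  fixes G Gx Gy :: "complex \<times> complex \<Rightarrow> complex"
  assumes \<Omega>: "open \<Omega>" "(x0, y0) \<in> \<Omega>"
    and G: "\<And>z. z \<in> \<Omega> \<Longrightarrow> (G has_derivative (\<lambda>(h, k). Gx z * h + Gy z * k)) (at z)"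
    and cont: "continuous_on \<Omega> Gx" "continuous_on \<Omega> Gy"
    and zero: "G (x0, y0) = 0" and ne: "Gy (x0, y0) \<noteq> 0"
  obtains V B \<phi> where "open V" "(x0, y0) \<in> V" "open B" "connected B"
    "\<And>x. x \<in> B \<Longrightarrow> (x, \<phi> x) \<in> \<Omega>" "\<phi> holomorphic_on B"
    "\<And>x y. (x, y) \<in> V \<Longrightarrow> G (x, y) = 0 \<Longrightarrow> x \<in> B \<and> y = \<phi> x"
proof -
  define T where "T z = (fst z, G z)" for z
  define L where "L a b = (\<lambda>(h, k). (h, a * h + b * k))" for a b :: complex
  have L: "bounded_linear (L a b)" for a b
    unfolding L_def case_prod_beta by (intro bounded_linear_intros)
  define T' where "T' z = Blinfun (L (Gx z) (Gy z))" for z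
  have T': "blinfun_apply (T' z) = L (Gx z) (Gy z)" for z
    unfolding T'_def by (rule bounded_linear_Blinfun_apply[OF L])
  have der: "(T has_derivative blinfun_apply (T' z)) (at z)" if "z \<in> \<Omega>" for z
  proof -
    have "((\<lambda>z. (fst z, G z)) has_derivative (\<lambda>u. (fst u, (\<lambda>(h, k). Gx z * h + Gy z * k) u))) (at z)"
      by (intro has_derivative_Pair G that has_derivative_fst has_derivative_ident)
    then show ?thesis
      unfolding T' T_def[abs_def] L_def by (simp add: case_prod_beta')
  qed
  have contT': "continuous_on \<Omega> T'"
  proof (rule continuous_on_blinfun_componentwise)
    fix u :: "complex \<times> complex"
    have eq: "(\<lambda>z. blinfun_apply (T' z) u) = (\<lambda>z. (fst u, Gx z * fst u + Gy z * snd u))"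
      by (auto simp: T' L_def case_prod_beta)
    show "continuous_on \<Omega> (\<lambda>z. blinfun_apply (T' z) u)"
      unfolding eq by (intro continuous_intros cont)
  qed
  define a0 b0 where "a0 = Gx (x0, y0)" and "b0 = Gy (x0, y0)"
  have inv: "Blinfun (L (- a0 / b0) (1 / b0)) o\<^sub>L T' (x0, y0) = id_blinfun"
  proof (rule blinfun_eqI)
    fix u
    show "blinfun_apply (Blinfun (L (- a0 / b0) (1 / b0)) o\<^sub>L T' (x0, y0)) u = blinfun_apply id_blinfun u"
      unfolding blinfun_apply_blinfun_compose bounded_linear_Blinfun_apply[OF L] T'
      using ne by (cases u) (simp add: L_def a0_def b0_def field_simps)
  qed
  obtain U' V' g g' where U': "open U'" "U' \<subseteq> \<Omega>" "(x0, y0) \<in> U'" and V': "open V'" "T (x0, y0) \<in> V'"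
    and hom: "homeomorphism U' V' T g"
    and g: "\<And>w. w \<in> V' \<Longrightarrow> (g has_derivative g' w) (at w)"
    and g': "\<And>w. w \<in> V' \<Longrightarrow> g' w = Hilbert_Choice.inv (blinfun_apply (T' (g w)))"
    and bij: "\<And>w. w \<in> V' \<Longrightarrow> bij (blinfun_apply (T' (g w)))"
    by (rule inverse_function_theorem[OF \<Omega>(1) der contT' \<Omega>(2) inv]) blast+
  define \<phi> where "\<phi> x = snd (g (x, 0))" for x
  have gx: "g (x, 0) = (x, \<phi> x)" "(x, \<phi> x) \<in> U'" if "(x, 0) \<in> V'" for x
  proof -
    have "T (g (x, 0)) = (x, 0)" and U: "g (x, 0) \<in> U'"
      using hom that by (auto simp: homeomorphism_def)
    then have "fst (g (x, 0)) = x"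
      by (simp add: T_def)
    then show "g (x, 0) = (x, \<phi> x)"
      by (simp add: \<phi>_def prod_eq_iff)
    then show "(x, \<phi> x) \<in> U'"
      using U by simp
  qed
  have "open ((\<lambda>x. (x, 0 :: complex)) -` V')"
    using V'(1) by (intro open_vimage) (auto intro!: continuous_intros)
  moreover have "x0 \<in> (\<lambda>x. (x, 0)) -` V'"
    using V'(2) zero by (simp add: T_def)
  ultimately obtain e where e: "0 < e" "ball x0 e \<subseteq> (\<lambda>x. (x, 0)) -` V'"
    using open_contains_ball by blast
  have B: "(x, 0) \<in> V'" if "x \<in> ball x0 e" for x
    using e that by auto
  show ?thesis
  proof (rule that)
    show "open (U' \<inter> (ball x0 e \<times> UNIV))"
      using U' by (intro open_Int open_Times) auto
    show "(x0, y0) \<in> U' \<inter> (ball x0 e \<times> UNIV)"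
      using U' e by auto
    show "open (ball x0 e)" "connected (ball x0 e)"
      by simp_all
    show "(x, \<phi> x) \<in> \<Omega>" if "x \<in> ball x0 e" for x
      using gx(2)[OF B[OF that]] U' by auto
    show "x \<in> ball x0 e \<and> y = \<phi> x" if "(x, y) \<in> U' \<inter> (ball x0 e \<times> UNIV)" "G (x, y) = 0" for x y
    proof -
      have "g (T (x, y)) = (x, y)"
        using hom that by (auto simp: homeomorphism_def)
      then show ?thesis
        using that by (simp add: T_def \<phi>_def)
    qed
    have "\<exists>d. (\<phi> has_field_derivative d) (at x)" if x: "x \<in> ball x0 e" for x
    proof -
      note V = B[OF x]
      have Lb: "bij (L (Gx (x, \<phi> x)) (Gy (x, \<phi> x)))"
        using bij[OF V] by (simp add: T' gx[OF V])
      have b: "Gy (x, \<phi> x) \<noteq> 0"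
      proof
        assume "Gy (x, \<phi> x) = 0"
        then have "L (Gx (x, \<phi> x)) (Gy (x, \<phi> x)) (0, 1) = L (Gx (x, \<phi> x)) (Gy (x, \<phi> x)) (0, 0)"
          by (simp add: L_def)
        then have "(0 :: complex, 1 :: complex) = (0, 0)"
          by (rule injD[OF bij_is_inj[OF Lb]])
        then show False
          by simp
      qed
      have "g' (x, 0) (h, 0) = (h, - Gx (x, \<phi> x) / Gy (x, \<phi> x) * h)" for h
      proof -
        have "L (Gx (x, \<phi> x)) (Gy (x, \<phi> x)) (h, - Gx (x, \<phi> x) / Gy (x, \<phi> x) * h) = (h, 0)"
          using b by (simp add: L_def)
        then show ?thesis
          unfolding g'[OF V] gx(1)[OF V] T'
          using inv_f_f[OF bij_is_inj[OF Lb], of "(h, - Gx (x, \<phi> x) / Gy (x, \<phi> x) * h)"] by simp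
      qed
      moreover have "((\<lambda>x. (x, 0 :: complex)) has_derivative (\<lambda>h. (h, 0))) (at x)"
        by (auto intro!: derivative_eq_intros)
      then have "((\<lambda>x. snd (g (x, 0))) has_derivative (\<lambda>h. snd (g' (x, 0) (h, 0)))) (at x)"
        using g[OF V]
        by (intro has_derivative_snd has_derivative_compose[where f = "\<lambda>x. (x, 0 :: complex)" and g = g])
      ultimately have "(\<phi> has_derivative (\<lambda>h. - Gx (x, \<phi> x) / Gy (x, \<phi> x) * h)) (at x)"
        by (simp add: \<phi>_def[abs_def])
      then show ?thesis
        unfolding has_field_derivative_def by (rule exI)
    qed
    then show "\<phi> holomorphic_on ball x0 e"
      by (auto simp: holomorphic_on_open)
  qed
qed

text \<open>The series converging on the open polydisc; unlike \<open>conv_on r s\<close> this set is closed under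
  derivatives.\<close>

definition conv_open :: "real \<Rightarrow> real \<Rightarrow> series2 set" where
  "conv_open r s = {f. \<forall>r' s'. 0 \<le> r' \<and> r' < r \<and> 0 \<le> s' \<and> s' < s \<longrightarrow> f \<in> conv_on r' s'}"

lemma conv_on_imp_conv_open: "f \<in> conv_on r s \<Longrightarrow> f \<in> conv_open r s"
  unfolding conv_open_def by (auto intro: conv_on_mono)

lemma conv_open_hasse:
  assumes "f \<in> conv_open r s"
  shows "hasse f a b \<in> conv_open r s"
  unfolding conv_open_def
proof (intro CollectI allI impI)
  fix r' s' assume *: "0 \<le> r' \<and> r' < r \<and> 0 \<le> s' \<and> s' < s"
  then obtain r1 s1 where "r' < r1" "r1 < r" "s' < s1" "s1 < s"
    by (meson dense)
  moreover from this * have "f \<in> conv_on r1 s1"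
    using assms by (auto simp: conv_open_def)
  then obtain C where "mbound r1 s1 C f"
    by (auto simp: conv_on_def)
  ultimately have "mbound r' s' (C / ((r1 - r') ^ a * (s1 - s') ^ b)) (hasse f a b)"
    using * by (intro mbound_hasse) auto
  then show "hasse f a b \<in> conv_on r' s'"
    by (rule conv_onI)
qed

lemma conv_open_deriv:
  "f \<in> conv_open r s \<Longrightarrow> deriv_x f \<in> conv_open r s" "f \<in> conv_open r s \<Longrightarrow> deriv_y f \<in> conv_open r s"
  using conv_open_hasse[of f r s 1 0] conv_open_hasse[of f r s 0 1] by (simp_all add: hasse_1_0 hasse_0_1 flip: One_nat_def)

lemma conv_openE:
  assumes "f \<in> conv_open r s" "norm (x :: complex) < r" "norm (y :: complex) < s"
  obtains r' s' where "norm x < r'" "r' < r" "norm y < s'" "s' < s" "f \<in> conv_on r' s'"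
proof -
  obtain r' s' where "norm x < r'" "r' < r" "norm y < s'" "s' < s"
    using assms by (meson dense)
  moreover from this have "0 \<le> r'" "0 \<le> s'"
    using norm_ge_zero[of x] norm_ge_zero[of y] by linarith+
  ultimately show ?thesis
    using that assms(1) by (auto simp: conv_open_def)
qed

lemma eval2_has_derivative:
  assumes "f \<in> conv_open r s" "norm x < r" "norm y < s"
  shows "(eval2 f has_derivative
    (\<lambda>(h, k). eval2 (deriv_x f) (x, y) * h + eval2 (deriv_y f) (x, y) * k)) (at (x, y))"
  using assms by (rule conv_openE) (rule conv_on_eval2_has_derivative)

lemma continuous_on_eval2:
  assumes "f \<in> conv_open r s"
  shows "continuous_on (ball 0 r \<times> ball 0 s) (eval2 f)"
proof (rule continuous_at_imp_continuous_on, rule ballI)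
  fix z :: "complex \<times> complex" assume "z \<in> ball 0 r \<times> ball 0 s"
  then show "isCont (eval2 f) z"
    using eval2_has_derivative[OF assms, of "fst z" "snd z"] has_derivative_continuous by auto
qed

lemma eval2_curve_has_field_derivative:
  assumes "f \<in> conv_open r s" "norm x < r" "norm (\<phi> x) < s" "(\<phi> has_field_derivative d) (at x)"
  shows "((\<lambda>x. eval2 f (x, \<phi> x)) has_field_derivative
    eval2 (deriv_x f) (x, \<phi> x) + eval2 (deriv_y f) (x, \<phi> x) * d) (at x)"
proof -
  have 1: "((\<lambda>x. (x, \<phi> x)) has_derivative (\<lambda>h. (h, d * h))) (at x)"
    using assms(4) unfolding has_field_derivative_def by (intro has_derivative_Pair has_derivative_ident)
  have "(\<lambda>h. eval2 (deriv_x f) (x, \<phi> x) * h + eval2 (deriv_y f) (x, \<phi> x) * (d * h))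
      = (*) (eval2 (deriv_x f) (x, \<phi> x) + eval2 (deriv_y f) (x, \<phi> x) * d)"
    by (auto simp: fun_eq_iff algebra_simps)
  then show ?thesis
    using has_derivative_compose[OF 1 eval2_has_derivative[OF assms(1-3)]]
    by (simp add: has_field_derivative_def)
qed

lemma deriv_y_hasse: "deriv_y (hasse f 0 k) = const2 (of_nat (Suc k)) * hasse f 0 (Suc k)"
proof (rule series2_eqI)
  fix i j
  have "of_nat (Suc j) * (of_nat (Suc (j + k) choose k) :: complex) = of_nat (Suc k) * of_nat (Suc (k + j) choose Suc k)"
    using Suc_times_binomial_add[of k j] by (simp only: of_nat_mult[symmetric] add.commute)
  then show "coeff2 (deriv_y (hasse f 0 k)) i j = coeff2 (const2 (of_nat (Suc k)) * hasse f 0 (Suc k)) i j"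
    by (simp add: deriv_y_def hasse_def add.commute mult.assoc[symmetric] del: of_nat_Suc binomial_Suc_Suc)
qed

lemma eval2_x_divisible:
  assumes "wt_ge 1 0 1 f"
  shows "eval2 f (0, y) = 0"
proof -
  have "coeff2 f i j * 0 ^ i * y ^ j = 0" for i j
    using wt_geD[OF assms, of 0 j] by (cases i) auto
  then have "(\<lambda>(i, j). coeff2 f i j * 0 ^ i * y ^ j) = (\<lambda>_. 0)"
    by (simp only: fun_eq_iff split_paired_All split_conv) simp
  then show ?thesis
    by (simp add: eval2_def)
qed

lemma eval2_0_0: "eval2 f (0, 0) = coeff2 f 0 0"
proof -
  have "eval2 f (0, 0) = infsum (\<lambda>(i, j). coeff2 f i j) {(0, 0)}"
    unfolding eval2_def split_conv by (rule infsum_cong_neutral) (auto simp: power_0_left split: if_splits)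
  then show ?thesis
    by simp
qed

text \<open>If the determinant vanished identically, there would be a common zero \<open>(x, Y(x))\<close> of
  \<open>f\<^sub>x\<close> and \<open>f\<^sub>y\<close> over every \<open>x\<close>. Sort these by the multiplicity \<open>k\<close> of \<open>Y(x)\<close> as a root of \<open>P(x, \<sqdot>)\<close>.
  For some \<open>k\<close> there are uncountably many, and near a condensation point they lie on the
  smooth curve \<open>\<partial>\<^sub>y\<^sup>k\<^sup>-\<^sup>1 P = 0\<close>, the graph of a function \<open>\<phi>\<close>. By the identity theorem the whole
  graph consists of common zeros, so \<open>f\<close> has a constant value \<open>T\<close> on it. Now the determinant for
  \<open>f - T\<close> vanishes near a point, hence everywhere, in particular at \<open>x = 0\<close>, where the only
  zero of \<open>P\<close> is the origin. Thus \<open>T = f(0, 0) = 0\<close>, and the points of the graph are singular.\<close>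

lemma det_mult_mat_ne_0:
  assumes R: "weierstrass_tail r s n R" and n: "0 < n"
    and f: "f \<in> conv_on r s" "coeff2 f 0 0 = 0" and b: "b \<in> conv_on r s"
    and deriv_zero: "\<And>x y. norm x < r \<Longrightarrow> norm y < s \<Longrightarrow> eval2 (Y2 ^ n - R) (x, y) = 0 \<Longrightarrow>
      eval2 b (x, y) = 0 \<Longrightarrow> eval2 (deriv_x f) (x, y) = 0 \<and> eval2 (deriv_y f) (x, y) = 0"
    and nonsing: "\<And>x y. x \<noteq> 0 \<Longrightarrow> norm x < r \<Longrightarrow> norm y < s \<Longrightarrow> \<not> singular_point f (x, y)"
  shows "det (mult_mat r s n R b) \<noteq> 0"
proof
  assume det0: "det (mult_mat r s n R b) = 0"
  define P where "P = Y2 ^ n - R"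
  note rp = rpos[OF R] and sp = spos[OF R]
  have P_conv: "P \<in> conv_on r s"
    unfolding P_def by (rule P_conv[OF R])
  note open_conv = conv_on_imp_conv_open[OF P_conv] conv_on_imp_conv_open[OF b] conv_on_imp_conv_open[OF f(1)]
  define D where "D = ball (0 :: complex) r - {0}"
  have "\<exists>y. norm y < s \<and> eval2 P (x, y) = 0 \<and> eval2 b (x, y) = 0" if "x \<in> D" for x
  proof -
    have "xeval x (det (mult_mat r s n R b)) = 0"
      using det0 that xeval_0[OF rp sp, of x] by (simp add: D_def)
    then show ?thesis
      using common_zero_if_det_mult_mat_eq_0[OF R b, of x] that by (auto simp: D_def P_def)
  qed
  then obtain Y where Y: "\<And>x. x \<in> D \<Longrightarrow> norm (Y x) < s"
    "\<And>x. x \<in> D \<Longrightarrow> eval2 P (x, Y x) = 0" "\<And>x. x \<in> D \<Longrightarrow> eval2 b (x, Y x) = 0"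
    by metis
  \<comment> \<open>the order of vanishing of \<open>P(x, \<sqdot>)\<close> at \<open>Y x\<close>\<close>
  define \<kappa> where "\<kappa> x = (LEAST k. eval2 (hasse P 0 k) (x, Y x) \<noteq> 0)" for x
  have hasse_n: "hasse P 0 n = 1"
  proof (rule series2_eqI)
    fix i j
    have "coeff2 P i (j + n) = (if i = 0 \<and> j = 0 then 1 else 0)"
      using weierstrass_tailD(5)[OF R, of "j + n" i] coeff2_monomial[of 1 0 n i "j + n"] by (simp add: P_def)
    then show "coeff2 (hasse P 0 n) i j = coeff2 1 i j"
      by (simp add: hasse_def coeff2_1)
  qed
  have \<kappa>: "\<kappa> x \<le> n" "eval2 (hasse P 0 (\<kappa> x)) (x, Y x) \<noteq> 0" "\<kappa> x \<noteq> 0"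
    "eval2 (hasse P 0 (\<kappa> x - 1)) (x, Y x) = 0" if "x \<in> D" for x
  proof -
    have 1: "eval2 (hasse P 0 n) (x, Y x) \<noteq> 0"
      unfolding hasse_n using that Y(1)[OF that] by (subst eval2_1[of x r "Y x" s]) (auto simp: D_def)
    then show 2: "\<kappa> x \<le> n" "eval2 (hasse P 0 (\<kappa> x)) (x, Y x) \<noteq> 0"
      unfolding \<kappa>_def by (rule Least_le, rule LeastI)
    then show 3: "\<kappa> x \<noteq> 0"
      using Y(2)[OF that] by (metis hasse_0_0)
    then show "eval2 (hasse P 0 (\<kappa> x - 1)) (x, Y x) = 0"
      using not_less_Least[of "\<kappa> x - 1" "\<lambda>k. eval2 (hasse P 0 k) (x, Y x) \<noteq> 0"] by (simp add: \<kappa>_def)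
  qed
  have unc: "uncountable D"
    unfolding D_def using rp by (intro uncountable_minus_countable uncountable_ball) auto
  have Dun: "D = (\<Union>k\<le>n. {x \<in> D. \<kappa> x = k})"
    using \<kappa>(1) by auto
  obtain k where k: "uncountable {x \<in> D. \<kappa> x = k}"
  proof (rule ccontr)
    assume no: "\<not> thesis"
    have "countable {x \<in> D. \<kappa> x = k}" for k
      using no that[of k] by blast
    then have "countable (\<Union>k\<le>n. {x \<in> D. \<kappa> x = k})"
      by (intro countable_UN) auto
    then show False
      using unc Dun by simp
  qed
  define Dk where "Dk = {x \<in> D. \<kappa> x = k}"
  define Z where "Z = (\<lambda>x. (x, Y x)) ` Dk"
  have "uncountable Z"
    using k countable_image[of Z fst] by (auto simp: Z_def Dk_def image_image)
  then obtain z0 where z0: "z0 \<in> Z" "\<And>V. open V \<Longrightarrow> z0 \<in> V \<Longrightarrow> uncountable (Z \<inter> V)"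
    using uncountable_condensation_point by blast
  then obtain x0 where x0: "x0 \<in> D" "\<kappa> x0 = k" "z0 = (x0, Y x0)"
    by (auto simp: Z_def Dk_def)
  define G where "G = hasse P 0 (k - 1)"
  have k0: "k \<noteq> 0"
    using \<kappa>(3)[OF x0(1)] x0(2) by simp
  have G_conv: "G \<in> conv_open r s"
    unfolding G_def by (rule conv_open_hasse[OF open_conv(1)])
  have Gy: "deriv_y G = const2 (of_nat k) * hasse P 0 k"
    using deriv_y_hasse[of P "k - 1"] k0 by (simp add: G_def)
  define \<Omega> where "\<Omega> = ball (0 :: complex) r \<times> ball (0 :: complex) s"
  have \<Omega>: "open \<Omega>" "(x0, Y x0) \<in> \<Omega>"
    using x0 Y by (auto simp: \<Omega>_def D_def intro!: open_Times)
  have Gder: "(eval2 G has_derivative (\<lambda>(h, k). eval2 (deriv_x G) z * h + eval2 (deriv_y G) z * k)) (at z)"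
    if "z \<in> \<Omega>" for z
    using eval2_has_derivative[OF G_conv, of "fst z" "snd z"] that by (auto simp: \<Omega>_def)
  have Gcont: "continuous_on \<Omega> (eval2 (deriv_x G))" "continuous_on \<Omega> (eval2 (deriv_y G))"
    unfolding \<Omega>_def by (intro continuous_on_eval2 conv_open_deriv G_conv)+
  have G0: "eval2 G (x0, Y x0) = 0"
    using \<kappa>(4)[OF x0(1)] by (simp add: G_def x0(2))
  have Gy0: "eval2 (deriv_y G) (x0, Y x0) \<noteq> 0"
  proof -
    have xy: "norm x0 < r" "norm (Y x0) < s"
      using x0 Y by (auto simp: D_def)
    obtain r' s' where rs': "norm x0 < r'" "r' < r" "norm (Y x0) < s'" "s' < s" "hasse P 0 k \<in> conv_on r' s'"
      using conv_open_hasse[OF open_conv(1)] xy by (rule conv_openE)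
    then have le: "norm x0 \<le> r'" "norm (Y x0) \<le> s'"
      by auto
    have "eval2 (deriv_y G) (x0, Y x0) = of_nat k * eval2 (hasse P 0 k) (x0, Y x0)"
      unfolding Gy using eval2_mult[OF le conv_on_ring(5)[OF rs_nonneg[OF le]] rs'(5)] eval2_const2[OF le] by simp
    then show ?thesis
      using \<kappa>(2)[OF x0(1)] x0(2) k0 by simp
  qed
  obtain V B \<phi> where V: "open V" "(x0, Y x0) \<in> V" and B: "open B" "connected B"
    and \<phi>: "\<And>x. x \<in> B \<Longrightarrow> (x, \<phi> x) \<in> \<Omega>" "\<phi> holomorphic_on B"
    and graph: "\<And>x y. (x, y) \<in> V \<Longrightarrow> eval2 G (x, y) = 0 \<Longrightarrow> x \<in> B \<and> y = \<phi> x"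
    by (rule holomorphic_implicit_function[OF \<Omega> Gder Gcont G0 Gy0]) blast+
  define W where "W = {x \<in> Dk. (x, Y x) \<in> V}"
  have "Z \<inter> V = (\<lambda>x. (x, Y x)) ` W"
    by (auto simp: Z_def W_def)
  then have W: "uncountable W"
    using z0(2)[OF V(1)] V(2) x0(3) by auto
  have WB: "x \<in> B" "\<phi> x = Y x" if "x \<in> W" for x
    using that graph[of x "Y x"] \<kappa>(4)[of x] by (auto simp: W_def Dk_def G_def)
  have in\<Omega>: "norm x < r" "norm (\<phi> x) < s" if "x \<in> B" for x
    using \<phi>(1)[OF that] by (auto simp: \<Omega>_def)
  have der: "((\<lambda>x. eval2 g (x, \<phi> x)) has_field_derivative
      eval2 (deriv_x g) (x, \<phi> x) + eval2 (deriv_y g) (x, \<phi> x) * deriv \<phi> x) (at x)"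
    if "g \<in> conv_open r s" "x \<in> B" for g x
    using that in\<Omega> holomorphic_derivI[OF \<phi>(2) B(1)] by (intro eval2_curve_has_field_derivative) auto
  have hol: "(\<lambda>x. eval2 g (x, \<phi> x)) holomorphic_on B" if "g \<in> conv_open r s" for g
    using der[OF that] B(1) by (auto simp: holomorphic_on_open)
  have zeros: "eval2 P (x, \<phi> x) = 0" "eval2 b (x, \<phi> x) = 0" if "x \<in> B" for x
    by (rule holomorphic_uncountable_zeros[OF hol[OF open_conv(1)] B _ W _ that];
        use WB Y in \<open>auto simp: W_def Dk_def\<close>)
      (rule holomorphic_uncountable_zeros[OF hol[OF open_conv(2)] B _ W _ that];
        use WB Y in \<open>auto simp: W_def Dk_def\<close>)
  have derivs: "eval2 (deriv_x f) (x, \<phi> x) = 0" "eval2 (deriv_y f) (x, \<phi> x) = 0" if "x \<in> B" for x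
    using deriv_zero[OF in\<Omega>[OF that]] zeros[OF that] by (simp_all add: P_def)
  obtain w where w: "w \<in> W"
    using W by (metis countable_empty ex_in_conv)
  define T where "T = eval2 f (w, \<phi> w)"
  have T: "eval2 f (x, \<phi> x) = T" if "x \<in> B" for x
  proof -
    have "((\<lambda>x. eval2 f (x, \<phi> x)) has_field_derivative 0) (at x)" if "x \<in> B" for x
      using der[OF open_conv(3) that] derivs[OF that] by simp
    then show ?thesis
      unfolding T_def using DERIV_zero_connected_constant[OF B(2,1) finite.emptyI, of "\<lambda>x. eval2 f (x, \<phi> x)"]
        holomorphic_on_imp_continuous_on[OF hol[OF open_conv(3)]] that WB(1)[OF w] by (metis Diff_empty)
  qed
  define h where "h = f - const2 T"
  have h: "h \<in> conv_on r s"
    unfolding h_def using rp sp f by (intro conv_on_ring) auto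
  have ev_h: "eval2 h (x, y) = eval2 f (x, y) - T" if "norm x \<le> r" "norm y \<le> s" for x y
    unfolding h_def using eval2_diff[OF that f(1) conv_on_ring(5)] eval2_const2[OF that] rp sp by simp
  have "xeval x (det (mult_mat r s n R h)) = 0" if "x \<in> W" for x
  proof -
    have "x \<in> B"
      using WB that by simp
    then show ?thesis
      using in\<Omega>[of x] zeros[of x] T[of x] ev_h[of x "\<phi> x"]
      by (intro det_mult_mat_eq_0[OF R h, of x "\<phi> x"]) (auto simp: P_def n)
  qed
  moreover have "W \<subseteq> ball 0 r"
    by (auto simp: W_def Dk_def D_def)
  ultimately have "xeval 0 (det (mult_mat r s n R h)) = 0"
    using holomorphic_uncountable_zeros[OF xeval_holomorphic[OF det_mult_mat_xconv[OF R h] sp] open_ball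
        connected_ball _ W, of 0] rp by auto
  then obtain y where y: "norm y < s" "eval2 P (0, y) = 0" "eval2 h (0, y) = 0"
    using common_zero_if_det_mult_mat_eq_0[OF R h, of 0] rp by (auto simp: P_def)
  have le: "norm (0 :: complex) \<le> r" "norm y \<le> s"
    using rp y by auto
  have "Y2 ^ n \<in> conv_on r s"
    using rp sp by (intro conv_on_power conv_on_ring) auto
  then have "eval2 P (0, y) = y ^ n - eval2 R (0, y)"
    unfolding P_def using eval2_diff[OF le _ R_conv[OF R], of "Y2 ^ n"] eval2_power[OF le, of Y2 n]
      eval2_Y2[OF le] conv_on_ring(9)[of r s] rp sp by simp
  then have "y = 0"
    using y(2) eval2_x_divisible[OF weierstrass_tailD(3)[OF R]] by simp
  then have "T = 0"
    using y(3) ev_h[OF le] f(2) by (simp add: eval2_0_0)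
  then have "singular_point f (w, \<phi> w)"
    using T[OF WB(1)[OF w]] derivs[OF WB(1)[OF w]] by (simp add: singular_point_def)
  moreover have "w \<noteq> 0" "norm w < r" "norm (\<phi> w) < s"
    using w in\<Omega>[OF WB(1)[OF w]] by (auto simp: W_def Dk_def D_def)
  ultimately show False
    using nonsing by blast
qed

definition conv_ideal :: "series2 \<Rightarrow> series2 \<Rightarrow> series2 set" where
  "conv_ideal a b = {\<alpha> * a + \<beta> * b | \<alpha> \<beta>. \<alpha> \<in> convergent_series \<and> \<beta> \<in> convergent_series}"

lemma conv_ideal_add: "g \<in> conv_ideal a b \<Longrightarrow> g' \<in> conv_ideal a b \<Longrightarrow> g + g' \<in> conv_ideal a b"
proof -
  assume "g \<in> conv_ideal a b" "g' \<in> conv_ideal a b"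
  then obtain \<alpha> \<beta> \<alpha>' \<beta>' where *: "g = \<alpha> * a + \<beta> * b" "g' = \<alpha>' * a + \<beta>' * b"
    "\<alpha> \<in> convergent_series" "\<beta> \<in> convergent_series" "\<alpha>' \<in> convergent_series" "\<beta>' \<in> convergent_series"
    by (auto simp: conv_ideal_def)
  then have "g + g' = (\<alpha> + \<alpha>') * a + (\<beta> + \<beta>') * b"
    by (simp add: algebra_simps)
  with * show ?thesis
    unfolding conv_ideal_def using convergent_ring(1) by blast
qed

lemma conv_ideal_mult: "g \<in> conv_ideal a b \<Longrightarrow> c \<in> convergent_series \<Longrightarrow> c * g \<in> conv_ideal a b"
proof -
  assume "g \<in> conv_ideal a b" "c \<in> convergent_series"
  then obtain \<alpha> \<beta> where *: "g = \<alpha> * a + \<beta> * b" "\<alpha> \<in> convergent_series" "\<beta> \<in> convergent_series"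
    by (auto simp: conv_ideal_def)
  then have "c * g = (c * \<alpha>) * a + (c * \<beta>) * b"
    by (simp add: algebra_simps)
  with * \<open>c \<in> convergent_series\<close> show ?thesis
    unfolding conv_ideal_def using convergent_ring(3) by blast
qed

lemma conv_ideal_gens: "a \<in> conv_ideal a b" "b \<in> conv_ideal a b"
proof -
  have "a = 1 * a + 0 * b" "b = 0 * a + 1 * b"
    by simp_all
  then show "a \<in> conv_ideal a b" "b \<in> conv_ideal a b"
    unfolding conv_ideal_def using convergent_ring(6,7) by blast+
qed

lemma conv_ideal_swap: "conv_ideal a b = conv_ideal b a"
  unfolding conv_ideal_def by (metis (no_types, lifting) add.commute)

text \<open>The determinant of the multiplication by \<open>b\<close> lies in the ideal \<open>(P, b)\<close> by Cramer's rule. Being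
  a nonzero series in \<open>x\<close> alone, it is a unit times a power of \<open>x\<close>.\<close>

lemma x_power_in_conv_ideal:
  assumes R: "weierstrass_tail r s n R" and n: "0 < n" and b: "b \<in> conv_on r s"
    and det: "det (mult_mat r s n R b) \<noteq> 0"
  obtains k where "X2 ^ k \<in> conv_ideal (Y2 ^ n - R) b"
proof -
  define P where "P = Y2 ^ n - R"
  define M where "M = mult_mat r s n R b"
  define \<delta> where "\<delta> = det M"
  note rp = rpos[OF R] and sp = spos[OF R]
  have M: "M \<in> carrier_mat n n"
    unfolding M_def by (rule mult_mat_carrier)
  have conv: "g \<in> convergent_series" if "g \<in> conv_on r s" for g
    using that rp sp by (rule conv_on_imp_convergent)
  define c where "c j = fps_const (adj_mat M $$ (j, 0))" for j
  have c: "c j \<in> convergent_series" if "j < n" for j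
  proof -
    have "adj_mat M $$ (j, 0) \<in> xconv r s"
      using rp sp M mult_mat_xconv[OF R b] that n by (intro xconv_adj_mat) (auto simp: M_def)
    then show ?thesis
      by (intro conv) (simp add: c_def xconv_def)
  qed
  define q where "q j = wquot r s n R (b * Y2 ^ j)" for j
  have q: "q j \<in> convergent_series" for j
    unfolding q_def by (rule conv[OF wquot(1)[OF R hY_conv[OF R b]]])
  have adj: "(\<Sum>j<n. M $$ (i, j) * adj_mat M $$ (j, 0)) = (if i = 0 then \<delta> else 0)" if "i < n" for i
  proof -
    have "(\<Sum>j<n. M $$ (i, j) * adj_mat M $$ (j, 0)) = (M * adj_mat M) $$ (i, 0)"
      using that n M adj_mat(1)[OF M] by (auto simp: scalar_prod_def lessThan_atLeast0 intro!: sum.cong)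
    also have "\<dots> = (if i = 0 then \<delta> else 0)"
      unfolding adj_mat(2)[OF M] using that n by (simp add: \<delta>_def)
    finally show ?thesis .
  qed
  have "(\<Sum>j<n. c j * (b * Y2 ^ j)) = (\<Sum>j<n. c j * (q j * P + (\<Sum>i<n. fps_const (M $$ (i, j)) * Y2 ^ i)))"
  proof (intro sum.cong refl)
    fix j assume "j \<in> {..<n}"
    then show "c j * (b * Y2 ^ j) = c j * (q j * P + (\<Sum>i<n. fps_const (M $$ (i, j)) * Y2 ^ i))"
      using mult_mat_eq[OF R b, of j] by (simp add: q_def P_def M_def)
  qed
  also have "\<dots> = (\<Sum>j<n. c j * q j) * P + (\<Sum>j<n. \<Sum>i<n. fps_const (M $$ (i, j) * adj_mat M $$ (j, 0)) * Y2 ^ i)"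
    by (simp add: distrib_left sum.distrib sum_distrib_right sum_distrib_left c_def mult_ac
        flip: fps_const_mult)
  also have "(\<Sum>j<n. \<Sum>i<n. fps_const (M $$ (i, j) * adj_mat M $$ (j, 0)) * Y2 ^ i)
      = (\<Sum>i<n. fps_const (\<Sum>j<n. M $$ (i, j) * adj_mat M $$ (j, 0)) * Y2 ^ i)"
  proof -
    have "fps_const (sum g A) = (\<Sum>a\<in>A. fps_const (g a))" for g :: "nat \<Rightarrow> complex fps" and A
      by (induction A rule: infinite_finite_induct) (simp_all flip: fps_const_add)
    then show ?thesis
      by (subst sum.swap) (simp add: sum_distrib_right)
  qed
  also have "\<dots> = (\<Sum>i<n. if i = 0 then fps_const \<delta> else 0)"
    by (intro sum.cong refl) (simp add: adj)
  also have "\<dots> = fps_const \<delta>"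
    using n by simp
  finally have *: "(\<Sum>j<n. c j * (b * Y2 ^ j)) = (\<Sum>j<n. c j * q j) * P + fps_const \<delta>" .
  have "fps_const \<delta> = (- (\<Sum>j<n. c j * q j)) * P + (\<Sum>j<n. c j * Y2 ^ j) * b"
  proof -
    have "(\<Sum>j<n. c j * (b * Y2 ^ j)) = (\<Sum>j<n. c j * Y2 ^ j) * b"
      by (simp only: sum_distrib_right) (simp add: mult_ac)
    then show ?thesis
      using * by (simp add: algebra_simps)
  qed
  moreover have "- (\<Sum>j<n. c j * q j) \<in> convergent_series" "(\<Sum>j<n. c j * Y2 ^ j) \<in> convergent_series"
    using c q by (auto intro!: convergent_ring convergent_sum convergent_power)
  ultimately have \<delta>: "fps_const \<delta> \<in> conv_ideal P b"
    unfolding conv_ideal_def by blast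
  define k where "k = subdegree \<delta>"
  define u where "u = fps_const (fps_shift k \<delta>)"
  have "\<delta> \<noteq> 0"
    using det by (simp add: \<delta>_def M_def)
  have \<delta>u: "fps_const \<delta> = X2 ^ k * u"
    using subdegree_decompose[of \<delta>]
    by (simp add: X2_def u_def k_def fps_const_power mult.commute flip: fps_const_mult)
  have "\<delta> \<in> xconv r s"
    unfolding \<delta>_def M_def by (rule det_mult_mat_xconv[OF R b])
  then have "fps_const \<delta> \<in> convergent_series"
    by (intro conv) (simp add: xconv_def)
  then have "u \<in> convergent_series"
    by (rule convergent_shift[of _ _ k 0]) (auto simp: u_def coeff2_fps_const)
  moreover have "coeff2 u 0 0 \<noteq> 0"
    using \<open>\<delta> \<noteq> 0\<close> by (simp add: u_def coeff2_fps_const k_def)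
  ultimately obtain u' where u': "u' \<in> convergent_series" "u * u' = 1"
    by (rule convergent_unit)
  have "X2 ^ k = u' * fps_const \<delta>"
    using u'(2) by (simp add: \<delta>u mult_ac)
  then show ?thesis
    using that[of k] conv_ideal_mult[OF \<delta> u'(1)] by (simp add: P_def)
qed

text \<open>As \<open>R = x S\<close>, one has \<open>y\<^sup>n \<equiv> x S\<close> modulo \<open>P\<close>, whence \<open>y\<^sup>n\<^sup>k \<equiv> x\<^sup>k S\<^sup>k\<close>.\<close>

lemma y_power_in_conv_ideal:
  assumes R: "weierstrass_tail r s n R" and k: "X2 ^ k \<in> conv_ideal (Y2 ^ n - R) b"
  shows "Y2 ^ (n * k) \<in> conv_ideal (Y2 ^ n - R) b"
proof -
  define P where "P = Y2 ^ n - R"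
  define S where "S = series_of_coeffs (\<lambda>i j. coeff2 R (i + 1) j)"
  have R_conv: "R \<in> convergent_series"
    using R_conv[OF R] rpos[OF R] spos[OF R] by (rule conv_on_imp_convergent)
  have S: "S \<in> convergent_series"
    by (rule convergent_shift[OF R_conv, of _ 1 0]) (simp add: S_def)
  have "R = X2 ^ 1 * S"
  proof (rule series2_eqI)
    fix i j
    show "coeff2 R i j = coeff2 (X2 ^ 1 * S) i j"
      unfolding coeff2_X2_power_mult using wt_geD[OF weierstrass_tailD(3)[OF R], of 0 j]
      by (cases i) (simp_all add: S_def)
  qed
  then have Yn: "Y2 ^ n = P + X2 * S"
    by (simp add: P_def)
  have P_conv: "P \<in> convergent_series"
    unfolding P_def using R_conv by (intro convergent_ring convergent_power)
  have "\<exists>A\<in>convergent_series. (P + X2 * S) ^ k = A * P + X2 ^ k * S ^ k"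
  proof (induction k)
    case 0
    then show ?case
      by (intro bexI[of _ 0]) (simp_all add: convergent_ring)
  next
    case (Suc k)
    then obtain A where A: "A \<in> convergent_series" "(P + X2 * S) ^ k = A * P + X2 ^ k * S ^ k"
      by blast
    have "(P + X2 * S) ^ Suc k = ((P + X2 * S) * A + X2 ^ k * S ^ k) * P + X2 ^ Suc k * S ^ Suc k"
      by (simp add: A(2) algebra_simps)
    moreover have "(P + X2 * S) * A + X2 ^ k * S ^ k \<in> convergent_series"
      using A(1) S P_conv by (intro convergent_ring convergent_power)
    ultimately show ?case
      by blast
  qed
  then obtain A where A: "A \<in> convergent_series" "Y2 ^ (n * k) = A * P + S ^ k * X2 ^ k"
    by (metis Yn mult.commute power_mult)
  then show ?thesis
    using k conv_ideal_gens(1)[of P b] S unfolding P_def[symmetric]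
    by (auto intro!: conv_ideal_add conv_ideal_mult convergent_power)
qed

text \<open>By preparation \<open>a\<close> and a Weierstrass polynomial \<open>P\<close> generate the same ideal and have the same
  zeros in a small polydisc. So a common zero of \<open>P\<close> and \<open>b\<close> is one of both partial derivatives,
  as the nonvanishing of the determinant requires. If \<open>n = 0\<close>, then \<open>P = 1\<close>, and the ideal is the
  whole ring.\<close>

lemma isolated_singularity_jacobian_aux:
  assumes f: "f \<in> convergent_series" "coeff2 f 0 0 = 0"
    and \<rho>: "0 < \<rho>" "\<And>x y. x \<noteq> 0 \<Longrightarrow> norm x < \<rho> \<Longrightarrow> norm y < \<rho> \<Longrightarrow> \<not> singular_point f (x, y)"
    and ab: "a = deriv_x f \<and> b = deriv_y f \<or> a = deriv_y f \<and> b = deriv_x f"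
    and reg: "coeff2 a 0 j \<noteq> 0"
  obtains K where "X2 ^ K \<in> conv_ideal a b" "Y2 ^ K \<in> conv_ideal a b"
proof -
  have ab_conv: "a \<in> convergent_series" "b \<in> convergent_series"
    using ab f by (auto simp: convergent_deriv)
  define n where "n = (LEAST j. coeff2 a 0 j \<noteq> 0)"
  have n: "coeff2 a 0 n \<noteq> 0" "\<And>j. j < n \<Longrightarrow> coeff2 a 0 j = 0"
    unfolding n_def using LeastI[of "\<lambda>j. coeff2 a 0 j \<noteq> 0", OF reg] not_less_Least by auto
  have sub3: "finite {f, a, b}" "{f, a, b} \<subseteq> convergent_series"
    using f ab_conv by auto
  obtain r s R U V where R: "weierstrass_tail r s n R" "r < \<rho>" "s < \<rho>" and mem: "{f, a, b} \<subseteq> conv_on r s"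
    "U \<in> conv_on r s" "V \<in> conv_on r s" and aP: "a = U * (Y2 ^ n - R)" "Y2 ^ n - R = V * a"
    by (rule weierstrass_preparation[OF ab_conv(1) n sub3 \<rho>(1)])
  have V: "V \<in> convergent_series"
    using mem(3) rpos[OF R(1)] spos[OF R(1)] by (rule conv_on_imp_convergent)
  have "\<exists>k. X2 ^ k \<in> conv_ideal (Y2 ^ n - R) b"
  proof (cases "n = 0")
    case True
    then have "R = 0"
      using weierstrass_tailD(5)[OF R(1)] by (intro series2_eqI) simp
    then show ?thesis
      using True conv_ideal_gens(1)[of 1 b] by (intro exI[of _ 0]) simp
  next
    case False
    have "det (mult_mat r s n R b) \<noteq> 0"
    proof (rule det_mult_mat_ne_0[OF R(1)])
      show "eval2 (deriv_x f) (x, y) = 0 \<and> eval2 (deriv_y f) (x, y) = 0"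
        if "norm x < r" "norm y < s" "eval2 (Y2 ^ n - R) (x, y) = 0" "eval2 b (x, y) = 0" for x y
      proof -
        have "eval2 a (x, y) = 0"
          unfolding aP(1) using eval2_mult[of x r y s U "Y2 ^ n - R"] mem(2) P_conv[OF R(1)] that by simp
        then show ?thesis
          using ab that by auto
      qed
    qed (use False mem f \<rho>(2) R in auto)
    then show ?thesis
      using False mem by (auto intro: x_power_in_conv_ideal[OF R(1)])
  qed
  then obtain k where k: "X2 ^ k \<in> conv_ideal (Y2 ^ n - R) b"
    by blast
  have sub: "g \<in> conv_ideal a b" if g: "g \<in> conv_ideal (Y2 ^ n - R) b" for g
  proof -
    obtain \<alpha> \<beta> where *: "g = \<alpha> * (Y2 ^ n - R) + \<beta> * b" "\<alpha> \<in> convergent_series" "\<beta> \<in> convergent_series"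
      using g by (auto simp: conv_ideal_def)
    have "\<alpha> * (V * a) + \<beta> * b \<in> conv_ideal a b"
      by (intro conv_ideal_add conv_ideal_mult conv_ideal_gens * V)
    then show ?thesis
      unfolding *(1) aP(2) .
  qed
  have "X2 ^ (n * k) * X2 ^ k \<in> conv_ideal a b" "Y2 ^ k * Y2 ^ (n * k) \<in> conv_ideal a b"
    using sub[OF k] sub[OF y_power_in_conv_ideal[OF R(1) k]]
    by (auto intro!: conv_ideal_mult convergent_power convergent_ring)
  then show ?thesis
    using that[of "n * k + k"] by (simp add: power_add mult.commute)
qed

text \<open>At least one of the partial derivatives does not vanish identically on the line \<open>x = 0\<close>, since
  otherwise \<open>f\<close> would vanish there, too, and all points of that line would be singular.\<close>

lemma isolated_singularity_jacobian:
  assumes f: "f \<in> convergent_series" and iso: "isolated_singularity f"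
  obtains K where "X2 ^ K \<in> conv_ideal (deriv_x f) (deriv_y f)" "Y2 ^ K \<in> conv_ideal (deriv_x f) (deriv_y f)"
proof -
  have f0: "coeff2 f 0 0 = 0"
    using iso by (simp add: isolated_singularity_def eval2_0_0)
  obtain d where d: "0 < d" "\<And>z. z \<noteq> (0, 0) \<Longrightarrow> dist z (0, 0) < d \<Longrightarrow> \<not> singular_point f z"
    using iso unfolding isolated_singularity_def eventually_at by auto
  define \<rho> where "\<rho> = d / 2"
  have \<rho>: "0 < \<rho>"
    using d by (simp add: \<rho>_def)
  have nonsing: "\<not> singular_point f (x, y)" if "(x, y) \<noteq> (0, 0)" "norm x < \<rho>" "norm y < \<rho>" for x y
  proof -
    have "dist (x, y) (0, 0) \<le> norm x + norm y"
      using sqrt_sum_squares_le_sum[of "norm x" "norm y"] by (simp add: dist_Pair_Pair)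
    then show ?thesis
      using that by (intro d) (auto simp: \<rho>_def)
  qed
  have "\<exists>j. coeff2 (deriv_x f) 0 j \<noteq> 0 \<or> coeff2 (deriv_y f) 0 j \<noteq> 0"
  proof (rule ccontr)
    assume "\<not> ?thesis"
    then have z: "wt_ge 1 0 1 (deriv_x f)" "wt_ge 1 0 1 (deriv_y f)"
      unfolding wt_ge_10_1 by auto
    have "coeff2 f 0 j = 0" for j
    proof (cases j)
      case (Suc i)
      then show ?thesis
        using z(2)[unfolded wt_ge_10_1, rule_format, of i] by (simp add: deriv_y_def del: of_nat_Suc)
    qed (simp add: f0)
    then have "wt_ge 1 0 1 f"
      unfolding wt_ge_10_1 by blast
    then have "singular_point f (0, of_real (\<rho> / 2))"
      using z by (simp add: singular_point_def eval2_x_divisible)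
    then show False
      using nonsing[of 0 "of_real (\<rho> / 2)"] \<rho> by simp
  qed
  then obtain j where "coeff2 (deriv_x f) 0 j \<noteq> 0 \<or> coeff2 (deriv_y f) 0 j \<noteq> 0"
    by blast
  then show ?thesis
  proof
    assume j: "coeff2 (deriv_x f) 0 j \<noteq> 0"
    show ?thesis
      by (rule isolated_singularity_jacobian_aux[OF f f0 \<rho> _ _ j, of "deriv_y f"])
        (use nonsing that in auto)
  next
    assume j: "coeff2 (deriv_y f) 0 j \<noteq> 0"
    show ?thesis
      by (rule isolated_singularity_jacobian_aux[OF f f0 \<rho> _ _ j, of "deriv_x f"])
        (use nonsing that in \<open>auto simp: conv_ideal_swap[of "deriv_y f"]\<close>)
  qed
qed


section \<open>Shears and leading forms\<close>

definition swap2 :: "series2 \<Rightarrow> series2" where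
  "swap2 f = series_of_coeffs (\<lambda>i j. coeff2 f j i)"

lemma coeff2_swap2 [simp]: "coeff2 (swap2 f) i j = coeff2 f j i"
  by (simp add: swap2_def)

lemma swap2_swap2 [simp]: "swap2 (swap2 f) = f"
  and swap2_add: "swap2 (f + g) = swap2 f + swap2 g"
  and swap2_const2: "swap2 (const2 c) = const2 c"
  and swap2_X2: "swap2 X2 = Y2" and swap2_Y2: "swap2 Y2 = X2"
  and swap2_0 [simp]: "swap2 0 = 0" and swap2_1 [simp]: "swap2 1 = 1"
  by (rule series2_eqI; auto simp: coeff2_const2 coeff2_X2 coeff2_Y2 coeff2_1)+

lemma swap2_diff: "swap2 (f - g) = swap2 f - swap2 g"
  by (rule series2_eqI) simp

lemma swap2_eq_0_iff [simp]: "swap2 f = 0 \<longleftrightarrow> f = 0"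
  by (metis swap2_0 swap2_swap2)

lemma swap2_mult: "swap2 (f * g) = swap2 f * swap2 g"
proof (rule series2_eqI)
  fix i j
  show "coeff2 (swap2 (f * g)) i j = coeff2 (swap2 f * swap2 g) i j"
    by (simp add: coeff2_mult) (rule sum.swap)
qed

lemma swap2_power: "swap2 (f ^ n) = swap2 f ^ n"
  by (induction n) (simp_all add: swap2_mult)

lemma wt_ge_swap2: "wt_ge u v n (swap2 f) \<longleftrightarrow> wt_ge v u n f"
  unfolding wt_ge_def coeff2_swap2 by (metis add.commute)

lemma swap2_subst:
  assumes "coeff2 p 0 0 = 0" "coeff2 q 0 0 = 0"
  shows "swap2 (subst f p q) = subst (swap2 f) (swap2 q) (swap2 p)"
proof (rule additive_continuous_eqI[where f = f])
  fix c a b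
  have eq: "swap2 (const2 c * X2 ^ a * Y2 ^ b) = const2 c * X2 ^ b * Y2 ^ a"
    by (simp add: swap2_mult swap2_power swap2_const2 swap2_X2 swap2_Y2 mult_ac)
  show "swap2 (subst (const2 c * X2 ^ a * Y2 ^ b) p q)
      = subst (swap2 (const2 c * X2 ^ a * Y2 ^ b)) (swap2 q) (swap2 p)"
    by (simp only: eq subst_monomial assms coeff2_swap2)
      (simp add: swap2_mult swap2_power swap2_const2 mult_ac)
qed (use assms in \<open>simp_all add: swap2_add subst_add wt_ge_swap2 wt_ge_subst_11 del: One_nat_def\<close>)

text \<open>The substitution \<open>y \<mapsto> y + \<phi>(x)\<close>.\<close>

definition yshear :: "complex fps \<Rightarrow> series2 \<Rightarrow> series2" where
  "yshear \<phi> f = subst f X2 (Y2 + fps_const \<phi>)"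

definition xshear :: "complex fps \<Rightarrow> series2 \<Rightarrow> series2" where
  "xshear \<phi> f = swap2 (yshear \<phi> (swap2 f))"

lemma shear_0_0: "fps_nth \<phi> 0 = 0 \<Longrightarrow> coeff2 (Y2 + fps_const \<phi>) 0 0 = 0"
  "coeff2 X2 0 0 = 0" "coeff2 Y2 0 0 = 0"
  by (simp_all add: coeff2_X2 coeff2_Y2 coeff2_fps_const)

lemma xshear_eq_subst:
  assumes "fps_nth \<phi> 0 = 0"
  shows "xshear \<phi> f = subst f (X2 + swap2 (fps_const \<phi>)) Y2"
  unfolding xshear_def yshear_def swap2_subst[OF shear_0_0(2) shear_0_0(1)[OF assms]]
  by (simp add: swap2_add swap2_X2 swap2_Y2)

lemma subst_fps_const: "subst (fps_const \<phi>) X2 q = fps_const \<phi>"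
proof -
  have "subst (fps_const \<phi>) X2 q = subst (fps_const \<phi>) X2 Y2"
    unfolding subst_def psubst_def
    by (intro arg_cong[of _ _ series_of_coeffs] ext arg_cong2[of _ _ _ _ "\<lambda>f i. coeff2 f i _"] sum.cong refl)
      (auto simp: coeff2_fps_const)
  then show ?thesis
    by simp
qed

lemma yshear_yshear:
  assumes "fps_nth \<phi> 0 = 0" "fps_nth \<psi> 0 = 0"
  shows "yshear \<phi> (yshear \<psi> f) = yshear (\<phi> + \<psi>) f"
  unfolding yshear_def using assms shear_0_0
  by (subst subst_subst)
    (simp_all add: subst_add subst_fps_const add_ac del: coeff2_add flip: fps_const_add)

lemma yshear_0 [simp]: "yshear 0 f = f"
  by (simp add: yshear_def)

lemma yshear_mult: "fps_nth \<phi> 0 = 0 \<Longrightarrow> yshear \<phi> (f * g) = yshear \<phi> f * yshear \<phi> g"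
  unfolding yshear_def using shear_0_0 by (intro subst_mult)

lemma yshear_power: "fps_nth \<phi> 0 = 0 \<Longrightarrow> yshear \<phi> (f ^ n) = yshear \<phi> f ^ n"
  unfolding yshear_def using shear_0_0 by (intro subst_power)

lemma yshear_inverse:
  assumes "fps_nth \<phi> 0 = 0"
  shows "yshear (- \<phi>) (yshear \<phi> f) = f" "yshear \<phi> (yshear (- \<phi>) f) = f"
  using assms by (simp_all add: yshear_yshear)

lemma yshear_X2: "fps_nth \<phi> 0 = 0 \<Longrightarrow> yshear \<phi> X2 = X2"
  and yshear_Y2: "fps_nth \<phi> 0 = 0 \<Longrightarrow> yshear \<phi> Y2 = Y2 + fps_const \<phi>"
  using shear_0_0(1)[of \<phi>] shear_0_0(2,3) by (simp_all add: yshear_def)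

lemma yshear_automorphism:
  assumes A: "A = UNIV \<or> A = convergent_series" and \<phi>: "fps_nth \<phi> 0 = 0"
    and mem: "fps_const \<phi> \<in> A"
  shows "algebra_automorphism A (yshear \<phi>)"
proof -
  have \<phi>': "fps_nth (- \<phi>) 0 = 0"
    using \<phi> by simp
  have A': "X2 \<in> A" "Y2 \<in> A" "a \<in> A \<Longrightarrow> b \<in> A \<Longrightarrow> a + b \<in> A" "a \<in> A \<Longrightarrow> - a \<in> A" for a b
    using A by (auto simp: convergent_ring)
  have "- fps_const \<phi> = fps_const (- \<phi>)"
    by simp
  then have "algebra_automorphism A (\<lambda>f. subst f X2 (Y2 + fps_const \<phi>))"
    using A mem yshear_inverse[OF \<phi>, of Y2] shear_0_0(1)[OF \<phi>] shear_0_0(1)[OF \<phi>'] shear_0_0(2,3) A'(1,2) A'(3)[of Y2] A'(4)[OF mem]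
    by (intro algebra_automorphism_substI[where p' = X2 and q' = "Y2 + fps_const (- \<phi>)"])
      (simp_all only: yshear_X2[OF \<phi>] yshear_Y2[OF \<phi>] yshear_X2[OF \<phi>'] yshear_Y2[OF \<phi>'] subst_X2
        yshear_def[of _ "Y2 + _"])
  then show ?thesis
    by (simp add: yshear_def[abs_def])
qed

lemma xshear_X2: "fps_nth \<psi> 0 = 0 \<Longrightarrow> xshear \<psi> X2 = X2 + swap2 (fps_const \<psi>)"
  by (simp add: xshear_def swap2_X2 swap2_Y2 yshear_Y2 swap2_add)

lemma xshear_inverse:
  assumes "fps_nth \<psi> 0 = 0"
  shows "xshear (- \<psi>) (xshear \<psi> f) = f" "xshear \<psi> (xshear (- \<psi>) f) = f"
  by (simp_all add: xshear_def yshear_inverse[OF assms])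

lemma xshear_automorphism:
  assumes A: "A = UNIV \<or> A = convergent_series" and \<psi>: "fps_nth \<psi> 0 = 0"
    and mem: "swap2 (fps_const \<psi>) \<in> A"
  shows "algebra_automorphism A (xshear \<psi>)"
proof -
  have \<psi>': "fps_nth (- \<psi>) 0 = 0"
    using \<psi> by simp
  have A': "X2 \<in> A" "Y2 \<in> A" "a \<in> A \<Longrightarrow> b \<in> A \<Longrightarrow> a + b \<in> A" "a \<in> A \<Longrightarrow> - a \<in> A" for a b
    using A by (auto simp: convergent_ring)
  let ?p = "\<lambda>\<psi>. X2 + swap2 (fps_const \<psi>)"
  have neg: "- swap2 (fps_const \<psi>) = swap2 (fps_const (- \<psi>))"
    by (rule series2_eqI) (simp add: coeff2_fps_const)
  have p0: "coeff2 (?p \<psi>) 0 0 = 0" "coeff2 (?p (- \<psi>)) 0 0 = 0"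
    using \<psi> by (simp_all add: coeff2_X2 coeff2_fps_const)
  have inv: "subst (?p \<psi>) (?p (- \<psi>)) Y2 = X2" "subst (?p (- \<psi>)) (?p \<psi>) Y2 = X2"
    using xshear_inverse[OF \<psi>, of X2] xshear_X2[OF \<psi>] xshear_X2[OF \<psi>']
    by (simp_all add: xshear_eq_subst[OF \<psi>] xshear_eq_subst[OF \<psi>'])
  have "algebra_automorphism A (\<lambda>f. subst f (?p \<psi>) Y2)"
    by (rule algebra_automorphism_substI[where p' = "?p (- \<psi>)" and q' = Y2])
      (use A A'(1,2) A'(3)[OF A'(1) mem] A'(3)[OF A'(1) A'(4)[OF mem]] p0 inv in
        \<open>simp_all add: coeff2_Y2 neg\<close>)
  then show ?thesis
    by (simp add: xshear_eq_subst[OF \<psi>, abs_def])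
qed

text \<open>Shears with close parameters have close values.\<close>

lemma wt_ge_yshear_diff:
  assumes "wt_ge 1 1 (Suc n) (fps_const (\<phi> - \<phi>'))" "fps_nth \<phi> 0 = 0" "fps_nth \<phi>' 0 = 0"
  shows "wt_ge 1 1 n (yshear \<phi> f - yshear \<phi>' f)"
proof -
  have "wt_ge 1 1 (0 + n) (subst f X2 (Y2 + fps_const \<phi>) - subst f X2 (Y2 + fps_const \<phi>'))"
    using assms shear_0_0(1)[of \<phi>] shear_0_0(1)[of \<phi>'] shear_0_0(2,3)
    by (intro wt_ge_subst_diff) (simp_all add: wt_ge_11_1 del: One_nat_def flip: Suc_eq_plus1_left)
  then show ?thesis
    by (simp add: yshear_def)
qed

lemma wt_ge_xshear_diff:
  assumes "wt_ge 1 1 (Suc n) (fps_const (\<psi> - \<psi>'))" "fps_nth \<psi> 0 = 0" "fps_nth \<psi>' 0 = 0"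
  shows "wt_ge 1 1 n (xshear \<psi> f - xshear \<psi>' f)"
proof -
  have "xshear \<psi> f - xshear \<psi>' f = swap2 (yshear \<psi> (swap2 f) - yshear \<psi>' (swap2 f))"
    by (rule series2_eqI) (simp add: xshear_def)
  then show ?thesis
    using wt_ge_yshear_diff[OF assms] by (simp only: wt_ge_swap2)
qed

lemma wt_ge_11_yshear: "wt_ge 1 1 n f \<Longrightarrow> fps_nth \<phi> 0 = 0 \<Longrightarrow> wt_ge 1 1 n (yshear \<phi> f)"
  unfolding yshear_def by (intro wt_ge_subst_11 shear_0_0)

lemma wt_ge_11_xshear: "wt_ge 1 1 n f \<Longrightarrow> fps_nth \<psi> 0 = 0 \<Longrightarrow> wt_ge 1 1 n (xshear \<psi> f)"
  unfolding xshear_def wt_ge_swap2 by (rule wt_ge_11_yshear) (simp_all only: wt_ge_swap2)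

lemma yshear_diff: "yshear \<phi> (f - g) = yshear \<phi> f - yshear \<phi> g"
  by (simp add: yshear_def subst_diff)

lemma xshear_diff: "xshear \<psi> (f - g) = xshear \<psi> f - xshear \<psi> g"
  by (simp add: xshear_def swap2_diff yshear_diff)

text \<open>For \<open>f\<close> of weight at least \<open>n\<close>, where \<open>x\<close> has weight 1 and \<open>y\<close> has weight \<open>k\<close>, the part of
  weight \<open>n\<close> is \<open>x\<^sup>n L(y / x\<^sup>k)\<close> with the polynomial \<open>L = lead_poly k n f\<close>.\<close>

definition lead_poly :: "nat \<Rightarrow> nat \<Rightarrow> series2 \<Rightarrow> complex poly" where
  "lead_poly k n f = (\<Sum>j\<le>n. monom (if k * j \<le> n then coeff2 f (n - k * j) j else 0) j)"

lemma coeff_lead_poly: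
  assumes "0 < k"
  shows "coeff (lead_poly k n f) j = (if k * j \<le> n then coeff2 f (n - k * j) j else 0)"
proof -
  have "j \<le> n" if "k * j \<le> n"
    using that assms by (metis le_trans mult_le_mono1 nat_mult_1 Suc_leI One_nat_def)
  then show ?thesis
    by (auto simp: lead_poly_def coeff_sum)
qed

lemma lead_poly_add: "lead_poly k n (f + g) = lead_poly k n f + lead_poly k n g"
  by (auto simp: lead_poly_def add_monom simp flip: sum.distrib intro!: sum.cong)

lemma lead_poly_0 [simp]: "lead_poly k n 0 = 0"
  by (simp add: lead_poly_def cong: if_cong)

lemma lead_poly_sum: "lead_poly k n (sum g A) = (\<Sum>a\<in>A. lead_poly k n (g a))"
  by (induction A rule: infinite_finite_induct) (simp_all add: lead_poly_add)

lemma lead_poly_cong: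
  assumes "wt_ge 1 k (Suc n) (f - g)"
  shows "lead_poly k n f = lead_poly k n g"
proof -
  have "coeff2 f (n - k * j) j = coeff2 g (n - k * j) j" if "k * j \<le> n" for j
    using wt_geD[OF assms, of "n - k * j" j] that by simp
  then show ?thesis
    by (auto simp: lead_poly_def intro!: sum.cong)
qed

lemma lead_poly_monomial:
  assumes "0 < k" "k * l \<le> n"
  shows "lead_poly k n (const2 a * X2 ^ (n - k * l) * Y2 ^ l) = monom a l"
  using assms by (intro poly_eqI) (auto simp: coeff_lead_poly coeff2_monomial)

lemma lead_form_decomp:
  assumes "wt_ge 1 k n f" "0 < k"
  shows "wt_ge 1 k (Suc n) (f - (\<Sum>j | k * j \<le> n. const2 (coeff (lead_poly k n f) j) * X2 ^ (n - k * j) * Y2 ^ j))"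
proof -
  have fin: "finite {j. k * j \<le> n}"
    by (rule finite_subset[of _ "{..n}"]) (use assms(2) in \<open>auto intro: order.trans[rotated]\<close>)
  have "coeff2 (\<Sum>j | k * j \<le> n. const2 (coeff (lead_poly k n f) j) * X2 ^ (n - k * j) * Y2 ^ j) i l
      = coeff2 f i l" if "i + k * l < Suc n" for i l
  proof -
    have "coeff2 (\<Sum>j | k * j \<le> n. const2 (coeff (lead_poly k n f) j) * X2 ^ (n - k * j) * Y2 ^ j) i l
        = (\<Sum>j | k * j \<le> n. if j = l then (if i = n - k * l then coeff2 f i l else 0) else 0)"
      unfolding coeff2_sum by (intro sum.cong refl) (auto simp: coeff2_monomial coeff_lead_poly assms(2))
    also have "\<dots> = (if i = n - k * l then coeff2 f i l else 0)"
      using fin that by simp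
    also have "\<dots> = coeff2 f i l"
      using that wt_geD[OF assms(1), of i l] by auto
    finally show ?thesis .
  qed
  then show ?thesis
    by (simp add: wt_ge_def)
qed

lemma wt_ge_fps_const: "(\<And>i. i < n \<Longrightarrow> fps_nth \<phi> i = 0) \<Longrightarrow> wt_ge 1 k n (fps_const \<phi>)"
  by (auto simp: wt_ge_def coeff2_fps_const)

text \<open>Terms of \<open>\<phi>\<close> of order greater than \<open>k\<close> do not affect the leading form for the weights
  \<open>(1, k)\<close>, and the term \<open>c x\<^sup>k\<close> translates the roots of the leading polynomial.\<close>

lemma yshear_lead_poly:
  assumes f: "wt_ge 1 k n f" and k: "0 < k" and \<phi>: "\<And>i. i < k \<Longrightarrow> fps_nth \<phi> i = 0"
  shows "wt_ge 1 k n (yshear \<phi> f)"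
    and "lead_poly k n (yshear \<phi> f) = pcompose (lead_poly k n f) [:fps_nth \<phi> k, 1:]"
proof -
  define c L where "c = fps_nth \<phi> k" and "L = lead_poly k n f"
  define q where "q = Y2 + const2 c * X2 ^ k"
  have wX: "wt_ge 1 k 1 X2" and wY: "wt_ge 1 k k Y2"
    by (rule wt_ge_X2 wt_ge_Y2)+
  have w\<phi>: "wt_ge 1 k k (fps_const \<phi>)"
    by (intro wt_ge_fps_const \<phi>)
  have w1: "wt_ge 1 k k (Y2 + fps_const \<phi>)"
    by (intro wt_ge_add wY w\<phi>)
  have "wt_ge 1 k (1 * k) (X2 ^ k)"
    by (rule wt_ge_power[OF wX])
  then have wq: "wt_ge 1 k k q"
    unfolding q_def by (intro wt_ge_add wY wt_ge_mult_right) simp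
  have q0: "coeff2 q 0 0 = 0"
    using wt_geD[OF wq, of 0 0] k by simp
  show "wt_ge 1 k n (yshear \<phi> f)"
    unfolding yshear_def by (rule wt_ge_subst[OF f wX w1])
  have "fps_const \<phi> - const2 c * X2 ^ k = fps_const (\<phi> - fps_const c * fps_X ^ k)"
    by (simp add: const2_def X2_def fps_const_power)
  moreover have "wt_ge 1 k (k + 1) (fps_const (\<phi> - fps_const c * fps_X ^ k))"
    using \<phi> by (intro wt_ge_fps_const) (auto simp: c_def less_Suc_eq fps_X_power_nth)
  ultimately have "wt_ge 1 k (k + 1) ((Y2 + fps_const \<phi>) - q)"
    by (simp add: q_def algebra_simps)
  then have "wt_ge 1 k (n + 1) (yshear \<phi> f - subst f X2 q)"
    unfolding yshear_def by (intro wt_ge_subst_diff f wX w1 wq) simp_all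
  then have 1: "lead_poly k n (yshear \<phi> f) = lead_poly k n (subst f X2 q)"
    by (intro lead_poly_cong) simp
  define F where "F = (\<Sum>j | k * j \<le> n. const2 (coeff L j) * X2 ^ (n - k * j) * Y2 ^ j)"
  have "wt_ge 1 k (Suc n) (subst (f - F) X2 q)"
    unfolding F_def L_def by (intro wt_ge_subst lead_form_decomp f k wX wq)
  then have 2: "lead_poly k n (subst f X2 q) = lead_poly k n (subst F X2 q)"
    by (intro lead_poly_cong) (simp add: subst_diff)
  have fin: "finite {j. k * j \<le> n}"
    by (rule finite_subset[of _ "{..n}"]) (use k in \<open>auto intro: order.trans[rotated]\<close>)
  have "subst F X2 q = (\<Sum>j | k * j \<le> n. subst (const2 (coeff L j) * X2 ^ (n - k * j) * Y2 ^ j) X2 q)"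
    unfolding F_def using fin by (induction rule: finite_induct) (simp_all add: subst_add)
  also have "lead_poly k n \<dots> = (\<Sum>j | k * j \<le> n. Polynomial.smult (coeff L j) ([:c, 1:] ^ j))"
    unfolding lead_poly_sum
  proof (intro sum.cong refl)
    fix j assume "j \<in> {j. k * j \<le> n}"
    then have j: "k * j \<le> n"
      by simp
    let ?a = "\<lambda>l. coeff L j * (of_nat (j choose l) * c ^ (j - l))"
    have of_nat: "of_nat m = const2 (of_nat m)" for m
      by (simp add: const2_def fps_of_nat)
    have "subst (const2 (coeff L j) * X2 ^ (n - k * j) * Y2 ^ j) X2 q
        = const2 (coeff L j) * X2 ^ (n - k * j) * q ^ j"
      using q0 shear_0_0(2) by (rule subst_monomial[rotated])
    also have "q ^ j = (\<Sum>l\<le>j. of_nat (j choose l) * Y2 ^ l * (const2 c * X2 ^ k) ^ (j - l))"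
      unfolding q_def by (rule binomial_ring)
    also have "const2 (coeff L j) * X2 ^ (n - k * j) * \<dots>
        = (\<Sum>l\<le>j. const2 (?a l) * X2 ^ (n - k * l) * Y2 ^ l)"
      unfolding sum_distrib_left
    proof (intro sum.cong refl)
      fix l assume "l \<in> {..j}"
      then have "n - k * l = (n - k * j) + k * (j - l)"
        using j by (simp add: diff_mult_distrib2)
      then have "X2 ^ (n - k * l) = X2 ^ (n - k * j) * (X2 ^ k) ^ (j - l)"
        by (simp add: power_add power_mult)
      moreover have "const2 (c ^ (j - l)) = const2 c ^ (j - l)"
        by (induction "j - l") (simp_all add: const2_def fps_const_power)
      ultimately show "const2 (coeff L j) * X2 ^ (n - k * j) *
          (of_nat (j choose l) * Y2 ^ l * (const2 c * X2 ^ k) ^ (j - l)) = const2 (?a l) * X2 ^ (n - k * l) * Y2 ^ l"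
        by (simp add: of_nat const2_mult power_mult_distrib mult_ac)
    qed
    finally have "lead_poly k n (subst (const2 (coeff L j) * X2 ^ (n - k * j) * Y2 ^ j) X2 q)
        = (\<Sum>l\<le>j. lead_poly k n (const2 (?a l) * X2 ^ (n - k * l) * Y2 ^ l))"
      by (simp only: lead_poly_sum)
    also have "\<dots> = (\<Sum>l\<le>j. monom (?a l) l)"
    proof (intro sum.cong refl lead_poly_monomial k)
      fix l assume "l \<in> {..j}"
      then show "k * l \<le> n"
        using j by (auto intro: order.trans[OF mult_le_mono2])
    qed
    also have "\<dots> = Polynomial.smult (coeff L j) ([:c, 1:] ^ j)"
    proof -
      have pc: "[:c:] ^ m = [:c ^ m:]" for m
        by (induction m) simp_all
      have "[:c, 1:] ^ j = (\<Sum>l\<le>j. of_nat (j choose l) * (monom 1 1) ^ l * [:c:] ^ (j - l))"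
        using binomial_ring[of "monom 1 1" "[:c:]" j] by (simp add: monom_altdef)
      also have "\<dots> = (\<Sum>l\<le>j. monom (of_nat (j choose l) * c ^ (j - l)) l)"
        by (intro sum.cong refl)
          (simp add: of_nat_poly monom_power pc smult_monom mult.commute)
      finally show ?thesis
        by (auto simp: poly_eq_iff coeff_sum sum_distrib_left intro!: sum.cong)
    qed
    finally show "lead_poly k n (subst (const2 (coeff L j) * X2 ^ (n - k * j) * Y2 ^ j) X2 q)
        = Polynomial.smult (coeff L j) ([:c, 1:] ^ j)" .
  qed
  also have "\<dots> = pcompose L [:c, 1:]"
  proof -
    have "pcompose L [:c, 1:] = (\<Sum>j\<le>degree L. Polynomial.smult (coeff L j) ([:c, 1:] ^ j))"
      by (simp add: pcompose_altdef poly_altdef coeff_map_poly degree_map_poly)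
    also have "\<dots> = (\<Sum>j | k * j \<le> n. Polynomial.smult (coeff L j) ([:c, 1:] ^ j))"
    proof (rule sum.mono_neutral_cong)
      show "Polynomial.smult (coeff L j) ([:c, 1:] ^ j) = 0" if "j \<in> {j. k * j \<le> n} - {..degree L}" for j
        using that coeff_eq_0[of L j] by simp
      show "Polynomial.smult (coeff L j) ([:c, 1:] ^ j) = 0" if "j \<in> {..degree L} - {j. k * j \<le> n}" for j
        using that by (simp add: L_def coeff_lead_poly[OF k])
    qed (simp_all add: fin)
    finally show ?thesis
      by simp
  qed
  finally show "lead_poly k n (yshear \<phi> f) = pcompose (lead_poly k n f) [:fps_nth \<phi> k, 1:]"
    using 1 2 by (simp add: c_def L_def)
qed

text \<open>A shear in the other direction only changes terms of higher weight if \<open>k \<ge> 2\<close>.\<close>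

lemma xshear_lead_poly:
  assumes f: "wt_ge 1 k n f" and k: "2 \<le> k" and \<phi>: "fps_nth \<phi> 0 = 0"
  shows "wt_ge 1 k n (xshear \<phi> f)" "lead_poly k n (xshear \<phi> f) = lead_poly k n f"
proof -
  have wX: "wt_ge 1 k 1 X2" and wY: "wt_ge 1 k k Y2"
    by (rule wt_ge_X2 wt_ge_Y2)+
  have w: "wt_ge 1 k 2 (swap2 (fps_const \<phi>))"
    unfolding wt_ge_def
  proof (intro allI impI)
    fix i j assume "1 * i + k * j < 2"
    then have "j = 0"
      using k by (cases j) auto
    then show "coeff2 (swap2 (fps_const \<phi>)) i j = 0"
      using \<phi> by (simp add: coeff2_fps_const)
  qed
  have w1: "wt_ge 1 k 1 (X2 + swap2 (fps_const \<phi>))"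
    using w by (intro wt_ge_add wX) (auto elim: wt_ge_mono)
  show "wt_ge 1 k n (xshear \<phi> f)"
    unfolding xshear_eq_subst[OF \<phi>] by (rule wt_ge_subst[OF f w1 wY])
  have "wt_ge 1 k (n + 1) (subst f (X2 + swap2 (fps_const \<phi>)) Y2 - subst f X2 Y2)"
    using w by (intro wt_ge_subst_diff f w1 wX wY) (simp_all add: numeral_2_eq_2)
  then show "lead_poly k n (xshear \<phi> f) = lead_poly k n f"
    unfolding xshear_eq_subst[OF \<phi>] by (intro lead_poly_cong) simp
qed


section \<open>Normal form under shears\<close>

lemma weight_eqI:
  assumes "wt_ge wx wy n f" "coeff2 f i j \<noteq> 0" "wx * i + wy * j = n"
  shows "weight wx wy f = n"
  unfolding weight_def
proof (rule Least_equality)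
  show "\<exists>i j. coeff2 f i j \<noteq> 0 \<and> n = i * wx + j * wy"
    using assms by (auto simp: mult.commute)
  show "n \<le> m" if "\<exists>i j. coeff2 f i j \<noteq> 0 \<and> m = i * wx + j * wy" for m
    using that assms(1) by (auto simp: wt_ge_def mult.commute not_less[symmetric])
qed

lemma weightE:
  assumes "f \<noteq> 0"
  obtains i j where "wt_ge wx wy (weight wx wy f) f" "coeff2 f i j \<noteq> 0" "wx * i + wy * j = weight wx wy f"
proof -
  obtain i0 j0 where "coeff2 f i0 j0 \<noteq> 0"
    using assms series2_eqI[of f 0] by auto
  then have ex: "\<exists>n i j. coeff2 f i j \<noteq> 0 \<and> n = i * wx + j * wy"
    by blast
  have "\<exists>i j. coeff2 f i j \<noteq> 0 \<and> weight wx wy f = i * wx + j * wy"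
    unfolding weight_def by (rule LeastI_ex[OF ex])
  moreover have "wt_ge wx wy (weight wx wy f) f"
    unfolding wt_ge_def
  proof (intro allI impI)
    fix i j assume "wx * i + wy * j < weight wx wy f"
    then show "coeff2 f i j = 0"
      unfolding weight_def using not_less_Least[of "wx * i + wy * j"] by (auto simp: mult.commute)
  qed
  ultimately show ?thesis
    using that by (auto simp: mult.commute)
qed

abbreviation leading_poly :: "nat \<Rightarrow> series2 \<Rightarrow> complex poly" where
  "leading_poly k f \<equiv> lead_poly k (weight 1 k f) f"

lemma leading_poly_eqI:
  assumes "wt_ge 1 k n f" "lead_poly k n f \<noteq> 0" "0 < k"
  shows "weight 1 k f = n"
proof -
  obtain j where "coeff (lead_poly k n f) j \<noteq> 0"
    using assms(2) by (auto simp: poly_eq_iff)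
  then have "k * j \<le> n" "coeff2 f (n - k * j) j \<noteq> 0"
    using assms(3) by (auto simp: coeff_lead_poly split: if_splits)
  then show ?thesis
    by (intro weight_eqI[OF assms(1)]) auto
qed

lemma leading_poly_ne_0:
  assumes "f \<noteq> 0" "0 < k"
  shows "leading_poly k f \<noteq> 0" "wt_ge 1 k (weight 1 k f) f"
proof -
  obtain i j where *: "wt_ge 1 k (weight 1 k f) f" "coeff2 f i j \<noteq> 0" "1 * i + k * j = weight 1 k f"
    using weightE[OF assms(1), of 1 k] by blast
  then have "coeff (leading_poly k f) j \<noteq> 0"
    unfolding coeff_lead_poly[OF assms(2)] *(3)[symmetric] by simp
  then show "leading_poly k f \<noteq> 0" "wt_ge 1 k (weight 1 k f) f"
    using * by auto
qed

text \<open>The normal form at \<open>(1, k)\<close>: no linear factor \<open>y - c x\<^sup>k\<close> of the leading form has larger multiplicity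
  than \<open>y\<close>.\<close>

definition y_normal :: "nat \<Rightarrow> series2 \<Rightarrow> bool" where
  "y_normal k f \<longleftrightarrow> (\<forall>c. order c (leading_poly k f) \<le> order 0 (leading_poly k f))"

lemma pcompose_power: "pcompose (p ^ n) q = pcompose p q ^ n"
  for p :: "complex poly"
  by (induction n) (simp_all add: pcompose_mult pcompose_1)

lemma order_pcompose_shift:
  fixes p :: "complex poly"
  assumes "p \<noteq> 0"
  shows "order t (pcompose p [:c, 1:]) = order (t + c) p"
proof -
  obtain q where q: "p = [:- (t + c), 1:] ^ order (t + c) p * q" "\<not> [:- (t + c), 1:] dvd q"
    using order_decomp[OF assms] by blast
  have "poly q (t + c) \<noteq> 0"
    using q(2) by (simp add: poly_eq_0_iff_dvd)
  then have q': "poly (pcompose q [:c, 1:]) t \<noteq> 0"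
    by (simp add: poly_pcompose add.commute)
  have "pcompose p [:c, 1:] = [:- t, 1:] ^ order (t + c) p * pcompose q [:c, 1:]"
    by (subst q(1)) (simp add: pcompose_mult pcompose_power pcompose_pCons)
  moreover have "pcompose q [:c, 1:] \<noteq> 0"
    using q' by auto
  ultimately show ?thesis
    using q' by (simp add: order_mult order_power_n_n order_0I)
qed

lemma pcompose_shift_ne_0: "p \<noteq> 0 \<Longrightarrow> pcompose p [:c, 1:] \<noteq> (0 :: complex poly)"
  by (simp add: pcompose_eq_0_iff)

lemma ex_max_order:
  fixes p :: "complex poly"
  assumes "p \<noteq> 0"
  shows "\<exists>c. \<forall>t. order t p \<le> order c p"
proof -
  have "\<forall>t. order t p < Suc (degree p)"
    using order_degree[OF assms] by (simp add: less_Suc_eq_le)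
  then show ?thesis
    using ex_has_greatest_nat[of "\<lambda>_. True" 0 "\<lambda>t. order t p" "Suc (degree p)"] by auto
qed

lemma leading_poly_yshear:
  assumes f: "f \<noteq> 0" and k: "0 < k" and \<phi>: "\<And>i. i < k \<Longrightarrow> fps_nth \<phi> i = 0"
  shows "leading_poly k (yshear \<phi> f) = pcompose (leading_poly k f) [:fps_nth \<phi> k, 1:]"
proof -
  note L = leading_poly_ne_0[OF f k]
  note s = yshear_lead_poly[OF L(2) k \<phi>]
  have "weight 1 k (yshear \<phi> f) = weight 1 k f"
    using s pcompose_shift_ne_0[OF L(1)] k by (intro leading_poly_eqI) auto
  then show ?thesis
    using s(2) by simp
qed

text \<open>The coefficient of \<open>x\<^sup>k\<close> that makes the leading form normal at \<open>(1, k)\<close>.\<close>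

definition shear_coeff :: "nat \<Rightarrow> series2 \<Rightarrow> complex" where
  "shear_coeff k f = (SOME c. \<forall>t. order t (leading_poly k f) \<le> order c (leading_poly k f))"

lemma order_shear_coeff:
  assumes "f \<noteq> 0" "0 < k"
  shows "order t (leading_poly k f) \<le> order (shear_coeff k f) (leading_poly k f)"
  unfolding shear_coeff_def
  using someI_ex[OF ex_max_order[OF leading_poly_ne_0(1)[OF assms]]] by blast

primrec shear_upto :: "series2 \<Rightarrow> nat \<Rightarrow> complex fps" where
  "shear_upto f 0 = 0"
| "shear_upto f (Suc k) = shear_upto f k
     + fps_const (shear_coeff (Suc k) (yshear (shear_upto f k) f)) * fps_X ^ Suc k"

lemma shear_upto_nth_gt: "k < i \<Longrightarrow> fps_nth (shear_upto f k) i = 0"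
  by (induction k) (simp_all add: fps_X_power_nth del: power_Suc)

lemma shear_upto_nth: "i \<le> k \<Longrightarrow> fps_nth (shear_upto f k) i = fps_nth (shear_upto f i) i"
  by (induction k rule: dec_induct) (simp_all add: fps_X_power_nth del: power_Suc)

lemma yshear_eq_0_iff: "fps_nth \<phi> 0 = 0 \<Longrightarrow> yshear \<phi> f = 0 \<longleftrightarrow> f = 0"
  by (metis yshear_inverse(1) subst_0 yshear_def)

text \<open>The coefficients of the shear are chosen one after the other; later ones do not affect the leading
  forms treated before.\<close>

lemma ex_normalising_yshear:
  assumes f: "f \<noteq> 0"
  obtains \<phi> where "fps_nth \<phi> 0 = 0" "\<And>k. 0 < k \<Longrightarrow> y_normal k (yshear \<phi> f)"
proof -
  define \<phi> where "\<phi> = Abs_fps (\<lambda>k. fps_nth (shear_upto f k) k)"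
  have \<phi>0: "fps_nth \<phi> 0 = 0"
    by (simp add: \<phi>_def)
  have up0: "fps_nth (shear_upto f k) 0 = 0" for k
    using shear_upto_nth[of 0 k f] by simp
  show ?thesis
  proof (rule that[OF \<phi>0])
    fix k :: nat assume k: "0 < k"
    define h where "h = yshear (shear_upto f (k - 1)) f"
    define \<eta> where "\<eta> = \<phi> - shear_upto f (k - 1)"
    have h: "h \<noteq> 0"
      unfolding h_def using f up0 by (simp add: yshear_eq_0_iff)
    have \<eta>: "fps_nth \<eta> i = 0" if "i < k" for i
      using that shear_upto_nth[of i "k - 1" f] by (simp add: \<eta>_def \<phi>_def)
    have "shear_upto f k = shear_upto f (k - 1) + fps_const (shear_coeff k h) * fps_X ^ k"
      using k by (cases k) (simp_all add: h_def)
    then have \<eta>k: "fps_nth \<eta> k = shear_coeff k h"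
      using shear_upto_nth_gt[of "k - 1" k f] k by (simp add: \<eta>_def \<phi>_def fps_X_power_nth)
    have "yshear \<phi> f = yshear \<eta> h"
      unfolding h_def using \<eta>[OF k] up0 by (simp add: yshear_yshear \<eta>_def)
    then have L: "leading_poly k (yshear \<phi> f) = pcompose (leading_poly k h) [:shear_coeff k h, 1:]"
      using leading_poly_yshear[OF h k, of \<eta>] \<eta> \<eta>k by simp
    show "y_normal k (yshear \<phi> f)"
      unfolding y_normal_def L order_pcompose_shift[OF leading_poly_ne_0(1)[OF h k]]
      using order_shear_coeff[OF h k] by simp
  qed
qed

lemma order_0_coeff:
  fixes p :: "complex poly"
  assumes "p \<noteq> 0"
  shows "coeff p (order 0 p) \<noteq> 0" "\<And>i. i < order 0 p \<Longrightarrow> coeff p i = 0"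
proof -
  show *: "coeff p i = 0" if "i < order 0 p" for i
    using monom_1_dvd_iff[OF assms, of "order 0 p"] monom_1_dvd_iff'[of "order 0 p" p] that by simp
  show "coeff p (order 0 p) \<noteq> 0"
  proof
    assume "coeff p (order 0 p) = 0"
    then have "monom 1 (Suc (order 0 p)) dvd p"
      using * by (auto simp: monom_1_dvd_iff' less_Suc_eq)
    then show False
      using monom_1_dvd_iff[OF assms] by fastforce
  qed
qed

text \<open>The leading forms of \<open>f\<close> and \<open>swap2 f\<close> at \<open>(1, 1)\<close> are homogenisations of mutually reversed
  polynomials.\<close>

lemma reversed_poly:
  fixes p q :: "complex poly"
  assumes p: "p \<noteq> 0" and pq: "\<And>i. i \<le> n \<Longrightarrow> coeff q i = coeff p (n - i)"
    and deg: "degree p \<le> n" "degree q \<le> n"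
  shows "degree q = n - order 0 p" "order 0 p \<le> n"
    and "c \<noteq> 0 \<Longrightarrow> order c q = order (1 / c) p"
proof -
  let ?m = "order 0 p"
  note o = order_0_coeff[OF p]
  show m: "?m \<le> n"
    using deg(1) le_degree[OF o(1)] by simp
  have qm: "coeff q (n - ?m) \<noteq> 0"
    using pq[of "n - ?m"] m o(1) by simp
  have "coeff q i = 0" if "n - ?m < i" for i
  proof (cases "i \<le> n")
    case True
    then show ?thesis
      using pq o(2)[of "n - i"] that m by simp
  next
    case False
    then show ?thesis
      using deg(2) by (simp add: coeff_eq_0)
  qed
  then show "degree q = n - ?m"
    using qm by (intro antisym degree_le le_degree) auto
  assume c: "c \<noteq> 0"
  have q_eq: "q = monom 1 (n - degree p) * reflect_poly p"
  proof (rule poly_eqI)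
    fix i
    show "coeff q i = coeff (monom 1 (n - degree p) * reflect_poly p) i"
    proof (cases "i \<le> n")
      case True
      then show ?thesis
        using pq[OF True] deg(1)
        by (auto simp: coeff_monom_mult coeff_reflect_poly coeff_eq_0 intro!: arg_cong[of _ _ "coeff p"])
    next
      case False
      then show ?thesis
        using deg by (auto simp: coeff_monom_mult coeff_reflect_poly coeff_eq_0)
    qed
  qed
  obtain r where r: "p = [:- (1 / c), 1:] ^ order (1 / c) p * r" "\<not> [:- (1 / c), 1:] dvd r"
    using order_decomp[OF p] by blast
  define m where "m = order (1 / c) p"
  have "poly r (1 / c) \<noteq> 0"
    using r(2) by (simp add: poly_eq_0_iff_dvd)
  then have rr: "poly (reflect_poly r) c \<noteq> 0"
    using c by (simp add: poly_reflect_poly_nz inverse_eq_divide)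
  have rp: "reflect_poly [:- (1 / c), 1:] = Polynomial.smult (- (1 / c)) [:- c, 1:]"
    using c by (simp add: reflect_poly_pCons)
  have "reflect_poly p = Polynomial.smult ((- (1 / c)) ^ m) ([:- c, 1:] ^ m * reflect_poly r)"
    by (subst r(1)) (simp only: reflect_poly_mult reflect_poly_power m_def[symmetric] rp
        smult_power mult_smult_left)
  then have "q = [:- c, 1:] ^ m * (Polynomial.smult ((- (1 / c)) ^ m) (monom 1 (n - degree p) * reflect_poly r))"
    unfolding q_eq by (simp add: mult_ac)
  moreover have "poly (Polynomial.smult ((- (1 / c)) ^ m) (monom 1 (n - degree p) * reflect_poly r)) c \<noteq> 0"
    using rr c by (simp add: poly_monom)
  moreover from this have "Polynomial.smult ((- (1 / c)) ^ m) (monom 1 (n - degree p) * reflect_poly r) \<noteq> 0"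
    by (metis poly_0)
  ultimately show "order c q = order (1 / c) p"
    unfolding m_def[symmetric] by (simp add: order_mult order_power_n_n order_0I del: mult_smult_right smult_eq_0_iff poly_smult poly_mult)
qed

lemma weight_swap2: "weight u v (swap2 f) = weight v u f"
  unfolding weight_def coeff2_swap2 by (metis add.commute)

lemma leading_poly_swap2:
  assumes "f \<noteq> 0"
  shows "degree (leading_poly 1 f) \<le> weight 1 1 f"
    and "i \<le> weight 1 1 f \<Longrightarrow> coeff (leading_poly 1 (swap2 f)) i = coeff (leading_poly 1 f) (weight 1 1 f - i)"
proof -
  show "degree (leading_poly 1 f) \<le> weight 1 1 f"
    by (intro degree_le) (simp add: coeff_lead_poly)
  show "i \<le> weight 1 1 f \<Longrightarrow> coeff (leading_poly 1 (swap2 f)) i = coeff (leading_poly 1 f) (weight 1 1 f - i)"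
    by (simp add: coeff_lead_poly weight_swap2)
qed

lemma leading_poly_swap2_order:
  assumes f: "f \<noteq> 0"
  shows "degree (leading_poly 1 (swap2 f)) = weight 1 1 f - order 0 (leading_poly 1 f)"
    and "order 0 (leading_poly 1 f) \<le> weight 1 1 f"
    and "c \<noteq> 0 \<Longrightarrow> order c (leading_poly 1 (swap2 f)) = order (1 / c) (leading_poly 1 f)"
proof -
  have d: "degree (leading_poly 1 (swap2 f)) \<le> weight 1 1 f"
    using leading_poly_swap2(1)[of "swap2 f"] f by (simp add: weight_swap2)
  have "leading_poly 1 f \<noteq> 0"
    using leading_poly_ne_0(1)[OF f, of 1] by simp
  note * = reversed_poly[OF this leading_poly_swap2(2)[OF f] leading_poly_swap2(1)[OF f] d]
  show "degree (leading_poly 1 (swap2 f)) = weight 1 1 f - order 0 (leading_poly 1 f)"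
    "order 0 (leading_poly 1 f) \<le> weight 1 1 f"
    "c \<noteq> 0 \<Longrightarrow> order c (leading_poly 1 (swap2 f)) = order (1 / c) (leading_poly 1 f)"
    using * by blast+
qed

text \<open>The weights \<open>(k, 1)\<close> are reduced to \<open>(1, k)\<close> by exchanging the variables. All other weights impose no
  condition on a normalised series.\<close>

definition normal :: "series2 \<Rightarrow> bool" where
  "normal f \<longleftrightarrow> (\<forall>k>0. y_normal k f \<and> y_normal k (swap2 f))"

text \<open>First \<open>y\<close> and then \<open>x\<close> are sheared. The second shear does not affect the leading forms at
  \<open>(1, k)\<close> with \<open>k \<ge> 2\<close>. At \<open>(1, 1)\<close> the leading form is a product of lines, and the shear makes a line of
  maximal multiplicity among those different from \<open>y = 0\<close> the line \<open>x = 0\<close>. Either the shear has no linear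
  term, and nothing changes, or that line was not \<open>x = 0\<close> before; then its multiplicity is at most that of
  \<open>y = 0\<close> by the first step. In both cases \<open>y - c x\<close> has at most the multiplicity of \<open>y\<close> for all \<open>c\<close>.\<close>

lemma ex_normalising_shears:
  assumes f: "f \<noteq> 0"
  obtains \<phi> \<psi> where "fps_nth \<phi> 0 = 0" "fps_nth \<psi> 0 = 0" "normal (xshear \<psi> (yshear \<phi> f))"
proof -
  obtain \<phi> where \<phi>: "fps_nth \<phi> 0 = 0" "\<And>k. 0 < k \<Longrightarrow> y_normal k (yshear \<phi> f)"
    using ex_normalising_yshear[OF f] by blast
  define g where "g = yshear \<phi> f"
  have g: "g \<noteq> 0"
    using f \<phi> by (simp add: g_def yshear_eq_0_iff)
  then have sg: "swap2 g \<noteq> 0"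
    by simp
  obtain \<psi> where \<psi>: "fps_nth \<psi> 0 = 0" "\<And>k. 0 < k \<Longrightarrow> y_normal k (yshear \<psi> (swap2 g))"
    using ex_normalising_yshear[OF sg] by blast
  define h where "h = xshear \<psi> g"
  have sh: "swap2 h = yshear \<psi> (swap2 g)"
    by (simp add: h_def xshear_def)
  have h: "h \<noteq> 0"
    using sg \<psi>(1) sh yshear_eq_0_iff[of \<psi> "swap2 g"] by force
  have "y_normal k h" if k: "0 < k" for k
  proof (cases "k = 1")
    case False
    with k have k2: "2 \<le> k"
      by simp
    note L = leading_poly_ne_0[OF g k]
    note s = xshear_lead_poly[OF L(2) k2 \<psi>(1)]
    have "weight 1 k h = weight 1 k g"
      unfolding h_def using s L k by (intro leading_poly_eqI) auto
    then show ?thesis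
      using \<phi>(2)[OF k] s(2) by (simp add: y_normal_def h_def g_def)
  next
    case True
    define P Q P' Q' where "P = leading_poly 1 g" and "Q = leading_poly 1 (swap2 g)"
      and "P' = leading_poly 1 h" and "Q' = leading_poly 1 (swap2 h)"
    define s where "s = fps_nth \<psi> 1"
    have Q': "Q' = pcompose Q [:s, 1:]"
      unfolding Q'_def Q_def sh s_def by (rule leading_poly_yshear[OF sg]) (simp_all add: \<psi>(1))
    have Q0: "Q \<noteq> 0"
      unfolding Q_def by (rule leading_poly_ne_0[OF sg]) simp
    have ordQ': "order t Q' = order (t + s) Q" for t
      unfolding Q' by (rule order_pcompose_shift[OF Q0])
    have wt: "weight 1 1 h = weight 1 1 g"
    proof -
      have "weight 1 1 (yshear \<psi> (swap2 g)) = weight 1 1 (swap2 g)"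
        using yshear_lead_poly[OF leading_poly_ne_0(2)[OF sg], of 1 \<psi>] pcompose_shift_ne_0[OF Q0] \<psi>(1)
        by (intro leading_poly_eqI) (auto simp: Q_def)
      then show ?thesis
        using weight_swap2[of 1 1 h] weight_swap2[of 1 1 g] by (simp add: sh)
    qed
    have P_max: "order c P \<le> order 0 P" for c
      using \<phi>(2)[of 1] by (simp add: y_normal_def P_def g_def)
    have "degree Q' = degree Q"
      by (simp add: Q' degree_pcompose)
    moreover have "degree Q' = weight 1 1 h - order 0 P'" "order 0 P' \<le> weight 1 1 h"
      unfolding P'_def Q'_def by (rule leading_poly_swap2_order[OF h])+
    moreover have "degree Q = weight 1 1 g - order 0 P" "order 0 P \<le> weight 1 1 g"
      unfolding P_def Q_def by (rule leading_poly_swap2_order[OF g])+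
    ultimately have "order 0 P' = order 0 P"
      using wt by simp
    moreover have "order c P' \<le> order 0 P" if c: "c \<noteq> 0" for c
    proof (cases "s = 0")
      case True
      have "order c P' = order (1 / c) Q'"
        using leading_poly_swap2_order(3)[OF h, of "1 / c"] c by (simp add: P'_def Q'_def)
      also have "\<dots> = order c P"
        using leading_poly_swap2_order(3)[OF g, of "1 / c"] c True by (simp add: P_def Q_def ordQ')
      finally show ?thesis
        using P_max by simp
    next
      case False
      have "order c P' = order (1 / c) Q'"
        using leading_poly_swap2_order(3)[OF h, of "1 / c"] c by (simp add: P'_def Q'_def)
      also have "\<dots> \<le> order 0 Q'"
        using \<psi>(2)[of 1] by (simp add: y_normal_def Q'_def sh)
      also have "\<dots> = order (1 / s) P"
        using leading_poly_swap2_order(3)[OF g False] by (simp add: ordQ' P_def Q_def)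
      also have "\<dots> \<le> order 0 P"
        by (rule P_max)
      finally show ?thesis .
    qed
    ultimately show ?thesis
      unfolding y_normal_def True P'_def[symmetric] by (metis order.refl)
  qed
  moreover have "y_normal k (swap2 h)" if "0 < k" for k
    using \<psi>(2)[OF that] by (simp add: sh)
  ultimately show ?thesis
    using that \<phi>(1) \<psi>(1) by (simp add: normal_def h_def g_def)
qed


section \<open>Normal series are normalised\<close>

lemma Y2_power_dvd_iff: "Y2 ^ b dvd h \<longleftrightarrow> (\<forall>i j. j < b \<longrightarrow> coeff2 h i j = 0)"
proof
  assume *: "\<forall>i j. j < b \<longrightarrow> coeff2 h i j = 0"
  have "h = Y2 ^ b * y_shift b h"
    by (rule series2_eqI) (simp add: coeff2_Y2_power_mult y_shift_def *)
  then show "Y2 ^ b dvd h"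
    by (rule dvdI)
qed (auto simp: coeff2_Y2_power_mult elim!: dvdE)

lemma swap2_dvd_iff: "swap2 a dvd swap2 b \<longleftrightarrow> a dvd b"
proof -
  have "swap2 a dvd swap2 b" if "a dvd b" for a b
    using that by (auto simp: swap2_mult elim!: dvdE)
  from this[of a b] this[of "swap2 a" "swap2 b"] show ?thesis
    by auto
qed

lemma X2_power_dvd_iff: "X2 ^ a dvd h \<longleftrightarrow> (\<forall>i j. i < a \<longrightarrow> coeff2 h i j = 0)"
proof -
  have "X2 ^ a dvd h \<longleftrightarrow> Y2 ^ a dvd swap2 h"
    using swap2_dvd_iff[of "X2 ^ a" h] by (simp add: swap2_power swap2_X2)
  then show ?thesis
    unfolding Y2_power_dvd_iff by auto
qed

lemma X2_Y2_ne_0: "X2 \<noteq> 0" "Y2 \<noteq> 0"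
  by (simp_all add: X2_def Y2_def)

lemma saturation_eqI:
  assumes h: "h = X2 ^ a * Y2 ^ b * s" and s: "\<not> X2 dvd s" "\<not> Y2 dvd s"
  shows "x_exponent h = a" "y_exponent h = b" "saturation h = s"
proof -
  have co: "coeff2 h i j = (if i < a \<or> j < b then 0 else coeff2 s (i - a) (j - b))" for i j
    unfolding h mult.assoc by (simp add: coeff2_X2_power_mult coeff2_Y2_power_mult)
  obtain j where j: "coeff2 s 0 j \<noteq> 0"
    using s(1) X2_power_dvd_iff[of 1 s] by auto
  obtain i where i: "coeff2 s i 0 \<noteq> 0"
    using s(2) Y2_power_dvd_iff[of 1 s] by auto
  show a: "x_exponent h = a"
    unfolding x_exponent_def
  proof (rule Greatest_equality)
    show "X2 ^ a dvd h"
      unfolding h mult.assoc by simp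
    show "a' \<le> a" if "X2 ^ a' dvd h" for a'
      using that j co[of a "j + b"] unfolding X2_power_dvd_iff by (metis add_diff_cancel_right' diff_self_eq_0 less_irrefl not_add_less2 not_le)
  qed
  show b: "y_exponent h = b"
    unfolding y_exponent_def
  proof (rule Greatest_equality)
    show "Y2 ^ b dvd h"
      unfolding h by simp
    show "b' \<le> b" if "Y2 ^ b' dvd h" for b'
      using that i co[of "i + a" b] unfolding Y2_power_dvd_iff by (metis add_diff_cancel_right' diff_self_eq_0 less_irrefl not_add_less2 not_le)
  qed
  show "saturation h = s"
    unfolding saturation_def a b using X2_Y2_ne_0 by (auto simp: h)
qed

lemma prime_Y2: "prime_elem Y2"
proof (rule prime_elemI)
  have d: "Y2 dvd g \<longleftrightarrow> fps_nth g 0 = 0" for g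
    using Y2_power_dvd_iff[of 1 g] by (auto simp: coeff2_def fps_eq_iff)
  show "Y2 \<noteq> 0"
    using X2_Y2_ne_0(2) by simp
  show "\<not> Y2 dvd 1"
    by (simp add: d)
  show "Y2 dvd a \<or> Y2 dvd b" if "Y2 dvd a * b" for a b
    using that by (simp add: d)
qed

text \<open>A shear is an automorphism taking \<open>y - c x\<^sup>k\<close> to \<open>y\<close>.\<close>

definition lin :: "nat \<Rightarrow> complex \<Rightarrow> series2" where
  "lin k c = Y2 - const2 c * X2 ^ k"

lemma yshear_lin:
  assumes "0 < k"
  shows "yshear (fps_const c * fps_X ^ k) (lin k c) = Y2" "fps_nth (fps_const c * fps_X ^ k) 0 = 0"
proof -
  show 0: "fps_nth (fps_const c * fps_X ^ k) 0 = 0"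
    using assms by (simp add: fps_X_power_nth)
  have "const2 c * X2 ^ k = fps_const (fps_const c * fps_X ^ k)"
    by (simp add: const2_def X2_def fps_const_power)
  then show "yshear (fps_const c * fps_X ^ k) (lin k c) = Y2"
    unfolding lin_def yshear_def subst_diff
    using subst_fps_const subst_Y2[OF shear_0_0(2) shear_0_0(1)[OF 0]] by simp
qed

lemma prime_lin:
  assumes "0 < k"
  shows "prime_elem (lin k c)"
proof (rule prime_elemI)
  define \<phi> where "\<phi> = fps_const c * fps_X ^ k"
  have l: "yshear \<phi> (lin k c) = Y2" and \<phi>: "fps_nth \<phi> 0 = 0" "fps_nth (- \<phi>) 0 = 0"
    using yshear_lin[OF assms, of c] by (auto simp: \<phi>_def)
  have d: "lin k c dvd g \<longleftrightarrow> Y2 dvd yshear \<phi> g" for g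
  proof
    show "Y2 dvd yshear \<phi> g" if "lin k c dvd g"
      using that l by (metis dvd_def yshear_mult[OF \<phi>(1)])
    assume "Y2 dvd yshear \<phi> g"
    then obtain t where "yshear \<phi> g = Y2 * t"
      by blast
    then have "g = yshear (- \<phi>) (Y2 * t)"
      using yshear_inverse(1)[OF \<phi>(1), of g] by simp
    also have "\<dots> = yshear (- \<phi>) (yshear \<phi> (lin k c)) * yshear (- \<phi>) t"
      unfolding l by (rule yshear_mult[OF \<phi>(2)])
    finally show "lin k c dvd g"
      by (simp add: yshear_inverse(1)[OF \<phi>(1)])
  qed
  show "lin k c \<noteq> 0"
    using l prime_Y2 by (metis prime_elem_not_zeroI subst_0 yshear_def)
  have "yshear \<phi> 1 = 1"
    using \<phi> by (simp add: yshear_def shear_0_0 del: coeff2_add)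
  then show "\<not> lin k c dvd 1"
    using prime_Y2 by (simp add: d prime_elem_def)
  show "lin k c dvd a \<or> lin k c dvd b" if "lin k c dvd a * b" for a b
    using that prime_elem_dvd_mult_iff[OF prime_Y2] by (simp add: d yshear_mult[OF \<phi>(1)])
qed

text \<open>The quasihomogeneous form \<open>x\<^bsup>k deg P\<^esup> P(y / x\<^sup>k)\<close>.\<close>

definition homog :: "nat \<Rightarrow> complex poly \<Rightarrow> series2" where
  "homog k P = series_of_coeffs (\<lambda>i j. if j \<le> degree P \<and> i = k * (degree P - j) then coeff P j else 0)"

lemma homog_linear_mult:
  assumes "P \<noteq> 0"
  shows "homog k ([:- c, 1:] * P) = lin k c * homog k P"
proof (rule series2_eqI)
  fix i j
  have deg: "degree ([:- c, 1:] * P) = Suc (degree P)"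
    using assms by (subst degree_mult_eq) auto
  have co: "coeff ([:- c, 1:] * P) j = (if j = 0 then 0 else coeff P (j - 1)) - c * coeff P j"
    by (cases j) simp_all
  have "lin k c * homog k P = Y2 ^ 1 * homog k P - const2 c * (X2 ^ k * homog k P)"
    by (simp add: lin_def algebra_simps)
  then have rhs: "coeff2 (lin k c * homog k P) i j = (if j < 1 then 0 else coeff2 (homog k P) i (j - 1))
      - c * (if i < k then 0 else coeff2 (homog k P) (i - k) j)"
    by (simp only: coeff2_diff coeff2_const2_mult coeff2_X2_power_mult coeff2_Y2_power_mult)
  have lhs: "coeff2 (homog k ([:- c, 1:] * P)) i j
      = (if j \<le> Suc (degree P) \<and> i = k * (Suc (degree P) - j)
         then (if j = 0 then 0 else coeff P (j - 1)) - c * coeff P j else 0)"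
    unfolding homog_def coeff2_series_of_coeffs deg co ..
  show "coeff2 (homog k ([:- c, 1:] * P)) i j = coeff2 (lin k c * homog k P) i j"
  proof (cases "j \<le> degree P")
    case True
    then have "k * (Suc (degree P) - j) = k * (degree P - j) + k"
      by (simp add: Suc_diff_le)
    then show ?thesis
      unfolding lhs rhs unfolding homog_def coeff2_series_of_coeffs using True
      by (cases j) (auto simp: Suc_diff_le)
  next
    case False
    then show ?thesis
      unfolding lhs rhs unfolding homog_def coeff2_series_of_coeffs
      by (cases j) (auto simp: coeff_eq_0)
  qed
qed

text \<open>As the factors \<open>y - c x\<^sup>k\<close> are prime, every nonunit divisor is divisible by one of them.\<close>

lemma nonunit_dvd_homog:
  assumes "P \<noteq> 0" "0 < k" "p dvd homog k P" "\<not> p dvd 1"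
  shows "\<exists>c. poly P c = 0 \<and> lin k c dvd p"
  using assms(1,3)
proof (induction "degree P" arbitrary: P)
  case 0
  then obtain a where a: "P = [:a:]"
    using degree_eq_zeroE by (metis)
  have "homog k P = const2 a"
    by (rule series2_eqI) (auto simp: homog_def a coeff2_const2)
  moreover have "const2 a dvd 1"
    using 0(2) a by (intro dvdI[of _ _ "const2 (1 / a)"]) (simp flip: const2_mult)
  ultimately show ?case
    using 0(3) assms(4) dvd_trans by metis
next
  case (Suc m)
  have "\<not> constant (poly P)"
    using Suc(2) by (simp add: constant_degree)
  then obtain c where c: "poly P c = 0"
    using Fundamental_Theorem_Algebra.fundamental_theorem_of_algebra[of P] by blast
  then obtain Q where Q: "P = [:- c, 1:] * Q"
    by (metis dvdE poly_eq_0_iff_dvd)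
  have Q0: "Q \<noteq> 0"
    using Suc(3) Q by auto
  have "degree P = Suc (degree Q)"
    unfolding Q using Q0 by (subst degree_mult_eq) auto
  then have m: "m = degree Q"
    using Suc(2) by simp
  obtain t where t: "homog k P = p * t"
    using Suc(4) by blast
  have pt: "p * t = lin k c * homog k Q"
    using t homog_linear_mult[OF Q0, of k c] by (simp add: Q)
  then have "lin k c dvd p * t"
    by simp
  then have "lin k c dvd p \<or> lin k c dvd t"
    using prime_elem_dvd_mult_iff[OF prime_lin[OF assms(2)]] by blast
  then show ?case
  proof
    assume "lin k c dvd t"
    then obtain t' where "t = lin k c * t'"
      by blast
    then have "lin k c * (p * t') = lin k c * homog k Q"
      using pt by (simp add: mult_ac)
    then have "p dvd homog k Q"
      using prime_lin[OF assms(2), of c] by (metis dvd_triv_left mult_cancel_left prime_elem_not_zeroI)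
    then have "\<exists>c. poly Q c = 0 \<and> lin k c dvd p"
      using Suc(1)[OF m Q0] by blast
    then show ?case
      by (auto simp: Q)
  qed (use c in blast)
qed

text \<open>The shear that takes \<open>y - c x\<^sup>k\<close> to \<open>y\<close> also takes the root \<open>c\<close> of the leading polynomial to \<open>0\<close>,
  whose multiplicity can be read off from divisibility by powers of \<open>y\<close>.\<close>

lemma lin_power_dvd_order:
  assumes f: "f \<noteq> 0" and k: "0 < k" and dvd: "lin k c ^ d dvd leading_term 1 k f"
  shows "d \<le> order c (leading_poly k f)"
proof -
  define n h \<phi> where "n = weight 1 k f" and "h = leading_term 1 k f" and "\<phi> = fps_const c * fps_X ^ k"
  have \<phi>: "yshear \<phi> (lin k c) = Y2" "fps_nth \<phi> 0 = 0"
    using yshear_lin[OF k, of c] by (auto simp: \<phi>_def)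
  have co: "coeff2 h i j = (if i + k * j = n then coeff2 f i j else 0)" for i j
    by (simp add: h_def n_def leading_term_def mult.commute)
  have wt: "wt_ge 1 k n h"
    by (simp add: wt_ge_def co)
  have L: "lead_poly k n h = leading_poly k f"
    using k by (intro poly_eqI) (simp add: coeff_lead_poly co n_def)
  have "lead_poly k n (yshear \<phi> h) = pcompose (leading_poly k f) [:c, 1:]"
    using yshear_lead_poly(2)[OF wt k, of \<phi>] k by (simp add: L \<phi>_def fps_X_power_nth)
  moreover have "Y2 ^ d dvd yshear \<phi> h"
    using dvd \<phi> unfolding h_def[symmetric] by (metis dvd_def yshear_mult yshear_power)
  then have "\<forall>j<d. coeff (lead_poly k n (yshear \<phi> h)) j = 0"
    using k by (simp add: Y2_power_dvd_iff coeff_lead_poly)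
  ultimately have "monom 1 d dvd pcompose (leading_poly k f) [:c, 1:]"
    by (simp add: monom_1_dvd_iff')
  then show ?thesis
    using monom_1_dvd_iff[OF pcompose_shift_ne_0[OF leading_poly_ne_0(1)[OF f k]], of d c]
      order_pcompose_shift[OF leading_poly_ne_0(1)[OF f k], of 0 c] by simp
qed

text \<open>The saturation \<open>s\<close> is the quasihomogeneous form of \<open>L\<close> without its root \<open>0\<close>. A nonunit \<open>p\<close> whose \<open>d\<close>-th
  power divides \<open>s\<close> has a factor \<open>y - c x\<^sup>k\<close> with \<open>c \<noteq> 0\<close>, so that \<open>d\<close> is at most the multiplicity of \<open>c\<close>.\<close>

lemma leading_term_factorisation:
  assumes f: "f \<noteq> 0" and k: "0 < k"
  defines "L \<equiv> leading_poly k f"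
  obtains s where "leading_term 1 k f = X2 ^ (weight 1 k f - k * degree L) * Y2 ^ order 0 L * s"
    "\<not> X2 dvd s" "\<not> Y2 dvd s" "\<And>p d. \<not> p dvd 1 \<Longrightarrow> p ^ d dvd s \<Longrightarrow> d = 0 \<or> (\<exists>c. c \<noteq> 0 \<and> d \<le> order c L)"
proof -
  define n b where "n = weight 1 k f" and "b = order 0 L"
  have L0: "L \<noteq> 0"
    unfolding L_def by (rule leading_poly_ne_0[OF f k])
  have "monom 1 b dvd L"
    using L0 by (simp add: monom_1_dvd_iff b_def)
  then obtain S where S: "L = monom 1 b * S"
    by blast
  have S0: "S \<noteq> 0"
    using L0 S by auto
  have coS: "coeff S j = coeff L (j + b)" for j
    by (simp add: S coeff_monom_mult)
  have degL: "degree L = b + degree S"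
    unfolding S using S0 by (subst degree_mult_eq) (auto simp: degree_monom_eq monom_eq_0_iff)
  have coL: "coeff L j = (if k * j \<le> n then coeff2 f (n - k * j) j else 0)" for j
    unfolding L_def n_def by (rule coeff_lead_poly[OF k])
  have degn: "k * degree L \<le> n"
    using coL[of "degree L"] L0 by (metis leading_coeff_0_iff)
  have coS0: "coeff S 0 \<noteq> 0"
    using order_0_coeff(1)[OF L0] by (simp add: coS b_def)
  show ?thesis
  proof (rule that)
    show "leading_term 1 k f = X2 ^ (weight 1 k f - k * degree L) * Y2 ^ order 0 L * homog k S"
      unfolding n_def[symmetric] b_def[symmetric]
    proof (rule series2_eqI)
      fix i j
      have lhs: "coeff2 (leading_term 1 k f) i j = (if i + k * j = n then coeff L j else 0)"
      proof (cases "i + k * j = n")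
        case True
        then have "coeff L j = coeff2 f i j"
          by (auto simp: coL)
        then show ?thesis
          using True by (simp add: leading_term_def n_def mult.commute)
      qed (simp add: leading_term_def n_def mult.commute)
      have "coeff2 (X2 ^ (n - k * degree L) * Y2 ^ b * homog k S) i j
          = (if i < n - k * degree L \<or> j < b then 0 else coeff2 (homog k S) (i - (n - k * degree L)) (j - b))"
        unfolding mult.assoc by (simp add: coeff2_X2_power_mult coeff2_Y2_power_mult)
      also have "\<dots> = (if i + k * j = n then coeff L j else 0)"
      proof (cases "b \<le> j \<and> j \<le> degree L")
        case True
        then obtain j' where j': "j = b + j'"
          using le_Suc_ex by blast
        then have le: "j' \<le> degree S"
          using True degL by simp
        then obtain m where m: "degree S = j' + m"
          using le_Suc_ex by blast
        obtain n' where n': "n = k * degree L + n'"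
          using degn le_Suc_ex by blast
        have "i + k * j = n \<longleftrightarrow> i = n' + k * m"
          by (auto simp: j' n' degL m algebra_simps)
        then show ?thesis
          using le by (auto simp: homog_def coS j' n' m add.commute)
      next
        case False
        have "coeff L j = 0" if "j < b"
          using order_0_coeff(2)[OF L0] that by (simp add: b_def)
        moreover have "coeff L j = 0" if "degree L < j"
          using that by (rule coeff_eq_0)
        moreover have "\<not> j - b \<le> degree S" if "degree L < j"
          using that degL by simp
        ultimately show ?thesis
          using False by (auto simp: homog_def)
      qed
      finally show "coeff2 (leading_term 1 k f) i j = coeff2 (X2 ^ (n - k * degree L) * Y2 ^ b * homog k S) i j"
        using lhs by simp
    qed
    have "coeff2 (homog k S) 0 (degree S) \<noteq> 0"
      using S0 by (simp add: homog_def)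
    then show "\<not> X2 dvd homog k S"
      using X2_power_dvd_iff[of 1 "homog k S"] by auto
    have "coeff2 (homog k S) (k * degree S) 0 \<noteq> 0"
      using coS0 by (simp add: homog_def)
    then show "\<not> Y2 dvd homog k S"
      using Y2_power_dvd_iff[of 1 "homog k S"] by auto
    fix p d assume p: "\<not> p dvd 1" "p ^ d dvd homog k S"
    show "d = 0 \<or> (\<exists>c. c \<noteq> 0 \<and> d \<le> order c L)"
    proof (cases "d = 0")
      case False
      then have "p dvd homog k S"
        using p(2) by (metis dvd_power dvd_trans neq0_conv)
      then obtain c where c: "poly S c = 0" "lin k c dvd p"
        using nonunit_dvd_homog[OF S0 k _ p(1)] by blast
      have "c \<noteq> 0"
        using c(1) coS0 by (auto simp: poly_0_coeff_0)
      moreover have "lin k c ^ d dvd leading_term 1 k f"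
        using dvd_trans[OF dvd_power_same[OF c(2)] p(2)]
          \<open>leading_term 1 k f = X2 ^ (weight 1 k f - k * degree L) * Y2 ^ order 0 L * homog k S\<close> by simp
      then have "d \<le> order c L"
        unfolding L_def by (rule lin_power_dvd_order[OF f k])
      ultimately show ?thesis
        by blast
    qed simp
  qed
qed

lemma max_irreducible_power_le:
  assumes "\<And>p d. \<not> p dvd 1 \<Longrightarrow> p ^ d dvd s \<Longrightarrow> d \<le> B"
  shows "max_irreducible_power s \<le> B"
proof -
  let ?P = "\<lambda>d. \<exists>p. irreducible p \<and> p ^ d dvd s"
  have "?P 0"
    using prime_elem_imp_irreducible[OF prime_Y2] by auto
  moreover have "d \<le> B" if "?P d" for d
    using that assms by (auto simp: irreducible_def)
  ultimately have "?P (GREATEST d. ?P d)"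
    by (rule GreatestI_nat)
  then show ?thesis
    unfolding max_irreducible_power_def using \<open>\<And>d. ?P d \<Longrightarrow> d \<le> B\<close> by blast
qed

lemma leading_term_swap2: "leading_term u v (swap2 f) = swap2 (leading_term v u f)"
  by (rule series2_eqI) (simp add: leading_term_def weight_swap2 add.commute)

text \<open>The second statement is the condition for the weights \<open>(k, 1)\<close>: \<open>swap2 h\<close> is the leading term of
  \<open>swap2 f\<close> there.\<close>

lemma y_normal_max_irreducible_power:
  assumes f: "f \<noteq> 0" and k: "0 < k" and normal: "y_normal k f"
  defines "h \<equiv> leading_term 1 k f"
  shows "max_irreducible_power (saturation h) \<le> y_exponent h"
    and "max_irreducible_power (saturation (swap2 h)) \<le> x_exponent (swap2 h)"
proof -
  define L where "L = leading_poly k f"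
  obtain s where s: "h = X2 ^ (weight 1 k f - k * degree L) * Y2 ^ order 0 L * s" "\<not> X2 dvd s" "\<not> Y2 dvd s"
    "\<And>p d. \<not> p dvd 1 \<Longrightarrow> p ^ d dvd s \<Longrightarrow> d = 0 \<or> (\<exists>c. c \<noteq> 0 \<and> d \<le> order c L)"
    unfolding h_def L_def by (rule leading_term_factorisation[OF f k]) blast
  have le: "d \<le> order 0 L" if "\<not> p dvd 1" "p ^ d dvd s" for p d
    using s(4)[OF that] normal unfolding y_normal_def L_def by (metis le0 order.trans)
  note e = saturation_eqI[OF s(1-3)]
  show "max_irreducible_power (saturation h) \<le> y_exponent h"
    unfolding e by (rule max_irreducible_power_le) (rule le)
  have h': "swap2 h = X2 ^ order 0 L * Y2 ^ (weight 1 k f - k * degree L) * swap2 s"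
    unfolding s(1) by (simp add: swap2_mult swap2_power swap2_X2 swap2_Y2 mult_ac)
  have s': "\<not> X2 dvd swap2 s" "\<not> Y2 dvd swap2 s"
    using s(2,3) swap2_dvd_iff[of X2 s] swap2_dvd_iff[of Y2 s] by (simp_all add: swap2_X2 swap2_Y2)
  note e' = saturation_eqI[OF h' s']
  show "max_irreducible_power (saturation (swap2 h)) \<le> x_exponent (swap2 h)"
    unfolding e'
  proof (rule max_irreducible_power_le)
    fix p d assume p: "\<not> p dvd 1" "p ^ d dvd swap2 s"
    have "\<not> swap2 p dvd 1"
      using p(1) swap2_dvd_iff[of p 1] by simp
    moreover have "swap2 p ^ d dvd s"
      using p(2) swap2_dvd_iff[of "p ^ d" "swap2 s"] by (simp add: swap2_power)
    ultimately show "d \<le> order 0 L"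
      by (rule le)
  qed
qed

text \<open>Every compact facet of the Newton polyhedron lies on a supporting line with normal vector \<open>(u, v)\<close>,
  where \<open>u, v > 0\<close> because otherwise the facet would contain a ray. A point of the facet is a convex combination of
  exponents of \<open>f\<close> on this line, so there are two different ones. Their difference shows that the slope
  is rational.\<close>

lemma compact_facet_normal:
  assumes facet: "\<Delta> facet_of newton_polyhedron f" and comp: "compact \<Delta>"
  obtains wx wy where "0 < wx" "0 < wy" "primitive_normal \<Delta> wx wy"
proof -
  define Q where "Q = (\<Union>(i, j)\<in>{(i, j). coeff2 f i j \<noteq> 0}. {(real i + s, real j + t) | s t. 0 \<le> s \<and> 0 \<le> t})"
  define N where "N = newton_polyhedron f"
  have NQ: "N = convex hull Q"
    by (simp add: N_def Q_def newton_polyhedron_def)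
  have convN: "convex N"
    by (simp add: NQ)
  have face: "\<Delta> face_of N" and ne: "\<Delta> \<noteq> {}" and dim: "aff_dim \<Delta> = aff_dim N - 1"
    using facet by (auto simp: facet_of_def N_def)
  have sub: "\<Delta> \<subseteq> N"
    using face by (rule face_of_imp_subset)
  have QI: "(real i + s, real j + t) \<in> Q" if "coeff2 f i j \<noteq> 0" "0 \<le> s" "0 \<le> t" for i j s t
    using that by (auto simp: Q_def)
  have quad: "p + (s, t) \<in> N" if "p \<in> N" "0 \<le> s" "0 \<le> t" for p s t
  proof -
    have "(\<lambda>x. (s, t) + x) ` Q \<subseteq> Q"
    proof (rule image_subsetI)
      fix z assume "z \<in> Q"
      then obtain i j s' t' where "coeff2 f i j \<noteq> 0" "z = (real i + s', real j + t')" "0 \<le> s'" "0 \<le> t'"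
        by (auto simp: Q_def)
      then show "(s, t) + z \<in> Q"
        using QI[of i j "s + s'" "t + t'"] that by (simp add: add.left_commute)
    qed
    then have "convex hull ((\<lambda>x. (s, t) + x) ` Q) \<subseteq> convex hull Q"
      by (rule hull_mono)
    then show ?thesis
      using that(1) unfolding NQ convex_hull_translation by (auto simp: add.commute)
  qed
  have dimN: "aff_dim N = 2"
  proof -
    obtain p where p: "p \<in> N"
      using ne sub by blast
    have "box p (p + (1, 1)) \<subseteq> N"
    proof
      fix x assume "x \<in> box p (p + (1, 1))"
      then have "fst p < fst x" "snd p < snd x"
        by (auto simp: box_def Basis_prod_def inner_prod_def)
      then show "x \<in> N"
        using quad[OF p, of "fst x - fst p" "snd x - snd p"] by (cases p; cases x) simp
    qed
    moreover have "box p (p + (1, 1)) \<noteq> {}"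
      by (simp add: box_ne_empty Basis_prod_def inner_prod_def inner_add_left)
    ultimately have "interior N \<noteq> {}"
      by (metis interior_maximal open_box subset_empty)
    then show ?thesis
      by (simp add: aff_dim_nonempty_interior)
  qed
  have "\<Delta> \<noteq> N"
    using dim by auto
  then have disj: "\<Delta> \<inter> rel_interior N = {}"
    using face_of_disjoint_rel_interior[OF face] by blast
  have conv\<Delta>: "convex \<Delta>"
    using face by (rule face_of_imp_convex)
  then obtain x where x: "x \<in> rel_interior \<Delta>"
    using ne rel_interior_eq_empty by blast
  have x\<Delta>: "x \<in> \<Delta>"
    using x rel_interior_subset by blast
  then have "x \<in> N" "x \<notin> rel_interior N"
    using sub disj by auto
  then obtain a where a: "a \<noteq> 0" "\<And>y. y \<in> N \<Longrightarrow> a \<bullet> x \<le> a \<bullet> y"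
    using supporting_hyperplane_rel_boundary[OF convN, of x] by metis
  define u v where "u = fst a" and "v = snd a"
  have a_inner: "a \<bullet> y = u * fst y + v * snd y" for y
    by (simp add: u_def v_def inner_prod_def)
  have on_line: "a \<bullet> y = a \<bullet> x" if y: "y \<in> \<Delta>" for y
  proof (rule antisym)
    obtain e where e: "1 < e" "(1 - e) *\<^sub>R y + e *\<^sub>R x \<in> \<Delta>"
      using convex_rel_interior_iff[OF conv\<Delta> ne, of x] x y by auto
    then have "a \<bullet> x \<le> a \<bullet> ((1 - e) *\<^sub>R y + e *\<^sub>R x)"
      using a(2) sub by blast
    then have "(e - 1) * (a \<bullet> y) \<le> (e - 1) * (a \<bullet> x)"
      by (simp add: inner_add_right algebra_simps)
    then show "a \<bullet> y \<le> a \<bullet> x"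
      using e(1) by simp
    show "a \<bullet> x \<le> a \<bullet> y"
      using a(2) y sub by blast
  qed
  have uv0: "0 \<le> u" "0 \<le> v"
    using a(2)[OF quad[OF \<open>x \<in> N\<close>, of 1 0]] a(2)[OF quad[OF \<open>x \<in> N\<close>, of 0 1]]
    by (simp_all add: a_inner algebra_simps)
  have "aff_dim \<Delta> = 1"
    using dim dimN by simp
  then have "\<not> (\<exists>z. \<Delta> = {z})"
    by auto
  then obtain q1 q2 where q: "q1 \<in> \<Delta>" "q2 \<in> \<Delta>" "q1 \<noteq> q2"
    using ne by blast
  \<comment> \<open>a face containing a segment in a direction of the quadrant contains the ray\<close>
  have ray: False if q: "q1 \<in> \<Delta>" "q2 \<in> \<Delta>" and d: "d = q2 - q1" "d \<noteq> 0" "0 \<le> fst d" "0 \<le> snd d" for q1 q2 d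
  proof -
    have mem: "q2 + m *\<^sub>R d \<in> \<Delta>" if m: "0 < m" for m
    proof -
      have "q2 + m *\<^sub>R d \<in> N"
        using quad[of q2 "m * fst d" "m * snd d"] subsetD[OF sub q(2)] d m by (simp add: scaleR_prod_def)
      moreover have "q2 \<in> open_segment q1 (q2 + m *\<^sub>R d)"
        unfolding in_segment
      proof (intro conjI exI[of _ "1 / (1 + m)"])
        show "q1 \<noteq> q2 + m *\<^sub>R d"
        proof
          assume eq: "q1 = q2 + m *\<^sub>R d"
          have "(1 + m) *\<^sub>R d = q2 + m *\<^sub>R d - q1"
            using d(1) by (simp add: scaleR_add_left)
          then have "(1 + m) *\<^sub>R d = 0"
            using eq by (metis right_minus_eq)
          then show False
            using d m by simp
        qed
        have q2: "q2 = q1 + d"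
          using d by simp
        have "(1 + m) *\<^sub>R q2 = m *\<^sub>R q1 + (q2 + m *\<^sub>R d)"
          unfolding q2 by (simp add: algebra_simps)
        then have "q2 = (1 / (1 + m)) *\<^sub>R (m *\<^sub>R q1 + (q2 + m *\<^sub>R d))"
          using m by (simp flip: \<open>(1 + m) *\<^sub>R q2 = _\<close>)
        moreover have "1 - 1 / (1 + m) = m / (1 + m)"
          using m by (simp add: field_simps)
        ultimately show "q2 = (1 - 1 / (1 + m)) *\<^sub>R q1 + (1 / (1 + m)) *\<^sub>R (q2 + m *\<^sub>R d)"
          by (metis scaleR_add_right scaleR_scaleR times_divide_eq_left mult_1)
      qed (use m in auto)
      ultimately show ?thesis
        using face q sub unfolding face_of_def by blast
    qed
    obtain B where B: "\<And>z. z \<in> \<Delta> \<Longrightarrow> norm z \<le> B"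
      using compact_imp_bounded[OF comp] by (auto simp: bounded_iff)
    define m where "m = (B + norm q2 + 1) / norm d"
    have nd: "0 < norm d"
      using d(2) by simp
    have "0 \<le> B"
      using B[OF q(1)] norm_ge_zero order.trans by blast
    then have m: "0 < m"
      unfolding m_def using nd by (intro divide_pos_pos add_nonneg_pos) auto
    have "norm (q2 + m *\<^sub>R d) \<le> B"
      using B[OF mem[OF m]] .
    moreover have "norm (m *\<^sub>R d) = B + norm q2 + 1"
      using nd \<open>0 \<le> B\<close> by (simp add: m_def)
    ultimately show False
      using norm_triangle_ineq2[of "m *\<^sub>R d" "- q2"] by (simp add: add.commute)
  qed
  have uv: "0 < u" "0 < v"
  proof -
    have line: "u * (fst q2 - fst q1) + v * (snd q2 - snd q1) = 0"
      using on_line[OF q(1)] on_line[OF q(2)] by (simp add: a_inner algebra_simps)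
    have ne12: "q2 - q1 \<noteq> 0" "q1 - q2 \<noteq> 0"
      using q(3) by auto
    have a0: "u \<noteq> 0 \<or> v \<noteq> 0"
      using a(1) by (auto simp: u_def v_def prod_eq_iff)
    have False if "u = 0"
    proof -
      have "snd q2 = snd q1"
        using line a0 that by simp
      then show False
        using ray[OF q(1,2) refl ne12(1)] ray[OF q(2,1) refl ne12(2)] by (cases "fst q1 \<le> fst q2") auto
    qed
    moreover have False if "v = 0"
    proof -
      have "fst q2 = fst q1"
        using line a0 that by simp
      then show False
        using ray[OF q(1,2) refl ne12(1)] ray[OF q(2,1) refl ne12(2)] by (cases "snd q1 \<le> snd q2") auto
    qed
    ultimately show "0 < u" "0 < v"
      using uv0 by (auto simp: less_le)
  qed
  define E where "E = {(real i, real j) | i j. coeff2 f i j \<noteq> 0 \<and> u * real i + v * real j = a \<bullet> x}"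
  have "\<Delta> \<subseteq> convex hull E"
  proof
    fix y assume y: "y \<in> \<Delta>"
    have "Q \<subseteq> {z. a \<bullet> z \<ge> a \<bullet> x}"
      using a(2) hull_subset[of Q convex] by (auto simp: NQ)
    then have Qge: "a \<bullet> z \<ge> a \<bullet> x" if "z \<in> Q" for z
      using that by blast
    obtain S w where S: "finite S" "S \<subseteq> Q" "\<forall>z\<in>S. 0 \<le> w z" "sum w S = 1" "(\<Sum>z\<in>S. w z *\<^sub>R z) = y"
      using y sub unfolding NQ convex_hull_explicit by blast
    have "(\<Sum>z\<in>S. w z * (a \<bullet> z - a \<bullet> x)) = a \<bullet> y - a \<bullet> x"
      using S by (auto simp: inner_sum_right right_diff_distrib sum_subtractf simp flip: sum_distrib_right)
    also have "\<dots> = 0"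
      using on_line[OF y] by simp
    finally have zero: "w z * (a \<bullet> z - a \<bullet> x) = 0" if "z \<in> S" for z
      using sum_nonneg_eq_0_iff[OF S(1), of "\<lambda>z. w z * (a \<bullet> z - a \<bullet> x)"] that S Qge by (auto simp: subset_iff)
    define S' where "S' = {z \<in> S. w z \<noteq> 0}"
    have "S' \<subseteq> E"
    proof
      fix z assume z: "z \<in> S'"
      then have az: "a \<bullet> z = a \<bullet> x"
        using zero[of z] by (auto simp: S'_def)
      obtain i j s t where z': "coeff2 f i j \<noteq> 0" "z = (real i + s, real j + t)" "0 \<le> s" "0 \<le> t"
        using z S(2) by (auto simp: S'_def Q_def)
      have "(real i, real j) \<in> Q"
        using QI[OF z'(1), of 0 0] by simp
      then have "a \<bullet> x \<le> u * real i + v * real j"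
        using Qge by (fastforce simp: a_inner)
      moreover have "u * real i + v * real j + (u * s + v * t) = a \<bullet> x"
        using az by (simp add: z'(2) a_inner algebra_simps)
      moreover have "0 \<le> u * s" "0 \<le> v * t"
        using uv z' by simp_all
      ultimately have "u * s = 0" "v * t = 0" "u * real i + v * real j = a \<bullet> x"
        by linarith+
      then show "z \<in> E"
        using uv z' by (auto simp: E_def)
    qed
    moreover have "finite S'" "sum w S' = 1" "(\<Sum>z\<in>S'. w z *\<^sub>R z) = y"
    proof -
      show "finite S'"
        using S(1) by (simp add: S'_def)
      have "sum w S' = sum w S" "(\<Sum>z\<in>S'. w z *\<^sub>R z) = (\<Sum>z\<in>S. w z *\<^sub>R z)"
        by (intro sum.mono_neutral_left ballI; use S(1) in \<open>auto simp: S'_def simp del: scaleR_eq_0_iff\<close>)+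
      then show "sum w S' = 1" "(\<Sum>z\<in>S'. w z *\<^sub>R z) = y"
        using S by auto
    qed
    ultimately show "y \<in> convex hull E"
      unfolding convex_hull_explicit using S(3) by (auto simp: S'_def intro!: exI[of _ S'] exI[of _ w])
  qed
  then have "\<not> E \<subseteq> {z}" for z
    using hull_mono[of E "{z}" convex] q by auto
  then obtain z1 z2 where z12: "z1 \<in> E" "z2 \<in> E" "z1 \<noteq> z2"
    by blast
  then obtain i1 j1 i2 j2 where ij: "z1 = (real i1, real j1)" "z2 = (real i2, real j2)"
    "u * real i1 + v * real j1 = a \<bullet> x" "u * real i2 + v * real j2 = a \<bullet> x"
    by (auto simp: E_def)
  then have eq: "u * (real i1 - real i2) = v * (real j2 - real j1)"
    by (simp add: algebra_simps)
  have "i1 \<noteq> i2"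
  proof
    assume "i1 = i2"
    then have "j1 = j2"
      using eq uv by simp
    then show False
      using z12(3) ij \<open>i1 = i2\<close> by simp
  qed
  define mx my where "mx = nat \<bar>int j2 - int j1\<bar>" and "my = nat \<bar>int i1 - int i2\<bar>"
  have m: "u * real my = v * real mx" "0 < my"
  proof -
    have "real my = \<bar>real i1 - real i2\<bar>" "real mx = \<bar>real j2 - real j1\<bar>"
      by (simp_all add: mx_def my_def)
    then show "u * real my = v * real mx"
      using arg_cong[OF eq, of abs] uv by (simp add: abs_mult)
    show "0 < my"
      using \<open>i1 \<noteq> i2\<close> by (simp add: my_def)
  qed
  have "0 < v * real mx"
    using m(2) uv by (simp flip: m(1))
  then have mx: "0 < mx"
    using uv by (simp add: zero_less_mult_iff)
  define g where "g = gcd mx my"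
  obtain wx wy where w: "mx = wx * g" "my = wy * g" "coprime wx wy"
    using gcd_coprime_exists[of mx my] mx unfolding g_def by (metis gcd_eq_0_iff less_irrefl)
  have g: "0 < g"
    using mx by (simp add: g_def)
  have wpos: "0 < wx" "0 < wy"
    using w mx m(2) by (auto intro: Nat.gr0I)
  have uw: "u * real wy = v * real wx"
    using m(1) g by (simp add: w)
  show ?thesis
  proof (rule that[OF wpos])
    show "primitive_normal \<Delta> wx wy"
      unfolding primitive_normal_def
    proof (intro conjI ballI w(3))
      fix p p' assume p: "p \<in> \<Delta>" "p' \<in> \<Delta>"
      have line: "u * (fst p - fst p') + v * (snd p - snd p') = 0"
        using on_line[OF p(1)] on_line[OF p(2)] by (simp add: a_inner algebra_simps)
      have "v * (real wx * (fst p - fst p') + real wy * (snd p - snd p'))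
          = (v * real wx) * (fst p - fst p') + real wy * (v * (snd p - snd p'))"
        by (simp only: distrib_left mult.assoc mult.left_commute)
      also have "\<dots> = real wy * (u * (fst p - fst p') + v * (snd p - snd p'))"
        by (simp only: uw[symmetric] distrib_left mult.assoc mult.left_commute)
      also have "\<dots> = 0"
        using line by simp
      finally have "v * (real wx * (fst p - fst p') + real wy * (snd p - snd p')) = 0" .
      then show "(real wx, real wy) \<bullet> (p - p') = 0"
        using uv by (simp add: inner_prod_def)
    qed
  qed
qed

lemma normal_imp_normalised_compact_facets:
  assumes f: "f \<noteq> 0" and normal: "normal f"
  shows "normalised_compact_facets f"
  unfolding normalised_compact_facets_def
proof (intro allI impI)
  fix \<Delta> assume "\<Delta> facet_of newton_polyhedron f \<and> compact \<Delta>"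
  then obtain wx wy where w: "0 < wx" "0 < wy" "primitive_normal \<Delta> wx wy"
    using compact_facet_normal by blast
  define h where "h = leading_term wx wy f"
  have y: "max_irreducible_power (saturation h) \<le> y_exponent h" if "wx = 1"
    using y_normal_max_irreducible_power(1)[OF f w(2)] normal w(2) that by (simp add: h_def normal_def)
  have x: "max_irreducible_power (saturation h) \<le> x_exponent h" if "wy = 1"
  proof -
    have "h = swap2 (leading_term 1 wx (swap2 f))"
      using that by (simp add: h_def leading_term_swap2)
    then show ?thesis
      using y_normal_max_irreducible_power(2)[of "swap2 f" wx] normal w(1) f by (simp add: normal_def)
  qed
  have "wx = 1 \<or> 1 < wx" "wy = 1 \<or> 1 < wy"
    using w by linarith+
  then show "normalised f \<Delta>"
    unfolding normalised_def Let_def h_def[symmetric]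
    using w(3) x y by (intro exI[of _ wx] exI[of _ wy]) (auto simp: h_def)
qed


section \<open>Polynomial representatives and the normal form theorem\<close>

text \<open>As both weights are positive, a monomial of minimal weight that is divisible by another
  monomial of \<open>h\<close> equals the latter. So the assumption makes all monomials of the leading form survive the
  truncation.\<close>

lemma leading_poly_box_part:
  assumes h: "h \<noteq> 0" and k: "0 < k"
    and dom: "\<And>i j. coeff2 h i j \<noteq> 0 \<Longrightarrow> \<exists>i' j'. coeff2 h i' j' \<noteq> 0 \<and> i' \<le> i \<and> j' \<le> j \<and> i' < K \<and> j' < K"
  shows "leading_poly k (box_part K h) = leading_poly k h"
proof -
  define n where "n = weight 1 k h"
  have wt: "wt_ge 1 k n h" and ne: "lead_poly k n h \<noteq> 0"
    using leading_poly_ne_0[OF h k] by (simp_all add: n_def)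
  have eq: "lead_poly k n (box_part K h) = lead_poly k n h"
  proof (rule poly_eqI)
    fix j
    have "n - k * j < K \<and> j < K" if j: "k * j \<le> n" "coeff2 h (n - k * j) j \<noteq> 0"
    proof -
      obtain i' j' where ij: "coeff2 h i' j' \<noteq> 0" "i' \<le> n - k * j" "j' \<le> j" "i' < K" "j' < K"
        using dom[OF j(2)] by blast
      have "n \<le> i' + k * j'"
        using wt_geD[OF wt, of i' j'] ij(1) by (simp add: not_less[symmetric]) blast
      moreover have "k * j' \<le> k * j"
        using ij(3) by simp
      ultimately have "i' = n - k * j" "k * j' = k * j"
        using ij(2) j(1) by linarith+
      then show ?thesis
        using ij k by simp
    qed
    then show "coeff (lead_poly k n (box_part K h)) j = coeff (lead_poly k n h) j"
      by (auto simp: coeff_lead_poly[OF k] coeff2_box_part)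
  qed
  have "wt_ge 1 k n (box_part K h)"
    using wt by (auto simp: wt_ge_def coeff2_box_part)
  then have "weight 1 k (box_part K h) = n"
    using ne k by (intro leading_poly_eqI) (simp_all add: eq)
  then show ?thesis
    using eq by (simp add: n_def)
qed

text \<open>Truncation keeps the Newton polyhedron once the finitely many minimal exponents survive
  (Dickson's lemma), and then also all leading forms.\<close>

lemma normal_box_part:
  assumes h: "h \<noteq> 0" and normal: "normal h"
  obtains K0 where "\<And>K. K0 \<le> K \<Longrightarrow> box_part K h \<noteq> 0 \<and> normal (box_part K h)"
proof -
  obtain i0 j0 where ij0: "coeff2 h i0 j0 \<noteq> 0"
    using h series2_eqI[of h 0] by auto
  define m where "m j = (LEAST i. coeff2 h i j \<noteq> 0)" for j
  define n where "n i = (LEAST j. coeff2 h i j \<noteq> 0)" for i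
  define K0 where "K0 = Suc (i0 + j0 + (\<Sum>j<j0. m j) + (\<Sum>i<i0. n i))"
  have dom: "\<exists>i' j'. coeff2 h i' j' \<noteq> 0 \<and> i' \<le> i \<and> j' \<le> j \<and> i' < K \<and> j' < K"
    if K: "K0 \<le> K" and ij: "coeff2 h i j \<noteq> 0" for K i j
  proof -
    consider "j < j0" | "i < i0" | "i0 \<le> i" "j0 \<le> j"
      by linarith
    then show ?thesis
    proof cases
      case 1
      then have "m j \<le> (\<Sum>j<j0. m j)"
        by (intro member_le_sum) auto
      moreover have "coeff2 h (m j) j \<noteq> 0" "m j \<le> i"
        unfolding m_def using ij by (rule LeastI Least_le)+
      ultimately show ?thesis
        using 1 K by (intro exI[of _ "m j"] exI[of _ j]) (simp add: K0_def)
    next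
      case 2
      then have "n i \<le> (\<Sum>i<i0. n i)"
        by (intro member_le_sum) auto
      moreover have "coeff2 h i (n i) \<noteq> 0" "n i \<le> j"
        unfolding n_def using ij by (rule LeastI Least_le)+
      ultimately show ?thesis
        using 2 K by (intro exI[of _ i] exI[of _ "n i"]) (simp add: K0_def)
    next
      case 3
      then show ?thesis
        using ij0 K by (intro exI[of _ i0] exI[of _ j0]) (simp add: K0_def)
    qed
  qed
  show ?thesis
  proof (rule that)
    fix K assume K: "K0 \<le> K"
    have "coeff2 (box_part K h) i0 j0 \<noteq> 0"
      using ij0 K by (simp add: coeff2_box_part K0_def)
    then have "box_part K h \<noteq> 0"
      by auto
    moreover have "normal (box_part K h)"
      unfolding normal_def
    proof (intro allI impI)
      fix k :: nat assume k: "0 < k"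
      have swap: "swap2 (box_part K h) = box_part K (swap2 h)"
        by (rule series2_eqI) (simp add: coeff2_box_part)
      have "leading_poly k (box_part K h) = leading_poly k h"
        using dom[OF K] by (rule leading_poly_box_part[OF h k])
      moreover have "leading_poly k (box_part K (swap2 h)) = leading_poly k (swap2 h)"
      proof (rule leading_poly_box_part[OF _ k])
        show "swap2 h \<noteq> 0"
          using h by simp
        show "\<exists>i' j'. coeff2 (swap2 h) i' j' \<noteq> 0 \<and> i' \<le> i \<and> j' \<le> j \<and> i' < K \<and> j' < K"
          if "coeff2 (swap2 h) i j \<noteq> 0" for i j
          using dom[OF K, of j i] that by auto
      qed
      ultimately show "y_normal k (box_part K h) \<and> y_normal k (swap2 (box_part K h))"
        using normal k by (simp add: normal_def y_normal_def swap)
    qed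
    ultimately show "box_part K h \<noteq> 0 \<and> normal (box_part K h)"
      by blast
  qed
qed

lemma ex_poly_box_part: "\<exists>p. series_of_poly p = box_part n f"
proof -
  define p where "p = (\<Sum>j<n. monom (\<Sum>i<n. monom (coeff2 f i j) i) j)"
  have "series_of_poly p = box_part n f"
  proof (rule series2_eqI)
    fix i j
    have "coeff2 (series_of_poly p) i j = coeff (coeff p j) i"
      by (simp add: series_of_poly_def coeff2_def coeff_map_poly)
    also have "\<dots> = coeff2 (box_part n f) i j"
      by (auto simp: p_def coeff_sum coeff2_box_part)
    finally show "coeff2 (series_of_poly p) i j = coeff2 (box_part n f) i j" .
  qed
  then show ?thesis
    by blast
qed

lemma fps_cutoff_shear:
  fixes \<phi> :: "complex fps"
  assumes "fps_nth \<phi> 0 = 0"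
  shows "fps_nth (fps_cutoff (Suc n) \<phi>) 0 = 0"
    and "wt_ge 1 1 (Suc n) (fps_const (\<phi> - fps_cutoff (Suc n) \<phi>))"
    and "fps_const (fps_cutoff (Suc n) \<phi>) \<in> convergent_series"
    and "swap2 (fps_const (fps_cutoff (Suc n) \<phi>)) \<in> convergent_series"
proof -
  show "fps_nth (fps_cutoff (Suc n) \<phi>) 0 = 0"
    using assms by simp
  show "wt_ge 1 1 (Suc n) (fps_const (\<phi> - fps_cutoff (Suc n) \<phi>))"
    by (auto simp: wt_ge_def coeff2_fps_const)
  have "fps_const (fps_cutoff (Suc n) \<phi>) = box_part (Suc n) (fps_const \<phi>)"
    "swap2 (fps_const (fps_cutoff (Suc n) \<phi>)) = box_part (Suc n) (swap2 (fps_const \<phi>))"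
    by (auto intro!: series2_eqI simp: coeff2_box_part coeff2_fps_const)
  then show "fps_const (fps_cutoff (Suc n) \<phi>) \<in> convergent_series"
    "swap2 (fps_const (fps_cutoff (Suc n) \<phi>)) \<in> convergent_series"
    by (simp_all only: convergent_box_part)
qed

theorem proposition3p6:
  "(\<forall>f :: series2. \<exists>g :: series2.
      formally_right_equivalent f g \<and> normalised_compact_facets g) \<and>
   (\<forall>f \<in> convergent_series. isolated_singularity f \<longrightarrow>
      (\<exists>g :: complex poly poly.
         right_equivalent f (series_of_poly g) \<and> normalised_compact_facets (series_of_poly g)))"
proof (intro conjI allI ballI impI)
  fix f :: series2
  show "\<exists>g. formally_right_equivalent f g \<and> normalised_compact_facets g"
  proof (cases "f = 0")
    case True
    have "newton_polyhedron 0 = {}"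
      by (simp add: newton_polyhedron_def)
    then have "normalised_compact_facets 0"
      by (auto simp: normalised_compact_facets_def facet_of_def)
    moreover have "algebra_automorphism UNIV (\<lambda>f. f)"
      by (simp add: algebra_automorphism_def bij_betw_def)
    ultimately show ?thesis
      unfolding True formally_right_equivalent_def by (intro exI[of _ 0] conjI exI[of _ "\<lambda>f. f"]) simp_all
  next
    case False
    obtain \<phi> \<psi> where \<phi>\<psi>: "fps_nth \<phi> 0 = 0" "fps_nth \<psi> 0 = 0" and normal: "normal (xshear \<psi> (yshear \<phi> f))"
      by (rule ex_normalising_shears[OF False])
    have aut: "algebra_automorphism UNIV (\<lambda>f. xshear \<psi> (yshear \<phi> f))"
      by (rule algebra_automorphism_comp[OF yshear_automorphism xshear_automorphism]) (simp_all add: \<phi>\<psi>)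
    have "xshear \<psi> (yshear \<phi> f) \<noteq> 0"
      using False \<phi>\<psi> by (simp add: xshear_def yshear_eq_0_iff)
    then have "normalised_compact_facets (xshear \<psi> (yshear \<phi> f))"
      using normal by (rule normal_imp_normalised_compact_facets)
    then show ?thesis
      unfolding formally_right_equivalent_def using aut
      by (intro exI[of _ "xshear \<psi> (yshear \<phi> f)"] conjI exI[of _ "\<lambda>f. xshear \<psi> (yshear \<phi> f)"]) simp_all
  qed
next
  fix f assume f: "f \<in> convergent_series" and iso: "isolated_singularity f"
  obtain K where J: "X2 ^ K \<in> conv_ideal (deriv_x f) (deriv_y f)" "Y2 ^ K \<in> conv_ideal (deriv_x f) (deriv_y f)"
    by (rule isolated_singularity_jacobian[OF f iso]) blast+
  have "f \<noteq> 0"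
  proof
    assume "f = 0"
    then have "deriv_x f = 0" "deriv_y f = 0"
      by (auto intro!: series2_eqI simp: deriv_x_def deriv_y_def)
    then show False
      using J(1) X2_Y2_ne_0(1) by (auto simp: conv_ideal_def)
  qed
  then obtain \<phi> \<psi> where \<phi>\<psi>: "fps_nth \<phi> 0 = 0" "fps_nth \<psi> 0 = 0" and normal: "normal (xshear \<psi> (yshear \<phi> f))"
    by (rule ex_normalising_shears)
  define h where "h = xshear \<psi> (yshear \<phi> f)"
  have h: "h \<noteq> 0"
    using \<open>f \<noteq> 0\<close> \<phi>\<psi> by (simp add: h_def xshear_def yshear_eq_0_iff)
  obtain K0 where K0: "\<And>K. K0 \<le> K \<Longrightarrow> box_part K h \<noteq> 0 \<and> normal (box_part K h)"
    using normal_box_part[OF h] normal unfolding h_def by blast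
  define N where "N = 4 * K + 2"
  define M where "M = max N K0"
  define g where "g = box_part M h"
  have g: "g \<in> convergent_series"
    by (simp add: g_def convergent_box_part)
  have hg: "wt_ge 1 1 N (g - h)"
    by (auto simp: wt_ge_def g_def coeff2_box_part M_def)
  \<comment> \<open>the shears may diverge; their truncations are automorphisms of the convergent series\<close>
  define \<phi>' \<psi>' where "\<phi>' = fps_cutoff (Suc N) \<phi>" and "\<psi>' = fps_cutoff (Suc N) \<psi>"
  note cut = fps_cutoff_shear[OF \<phi>\<psi>(1), of N, folded \<phi>'_def] fps_cutoff_shear[OF \<phi>\<psi>(2), of N, folded \<psi>'_def]
  define \<sigma> where "\<sigma> = (\<lambda>f. xshear \<psi>' (yshear \<phi>' f))"
  \<comment> \<open>the preimage of the polynomial \<open>g\<close>, which finite determinacy compares with \<open>f\<close>\<close>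
  define f' where "f' = yshear (- \<phi>') (xshear (- \<psi>') g)"
  have \<sigma>: "algebra_automorphism convergent_series \<sigma>"
    unfolding \<sigma>_def by (rule algebra_automorphism_comp[OF yshear_automorphism xshear_automorphism]) (simp_all add: cut)
  have \<sigma>f': "\<sigma> f' = g"
    by (simp add: \<sigma>_def f'_def yshear_inverse[OF cut(1)] xshear_inverse[OF cut(5)])
  have f': "f' \<in> convergent_series"
  proof -
    have "g \<in> \<sigma> ` convergent_series"
      using \<sigma> g by (simp add: algebra_automorphism_def bij_betw_def)
    then obtain f1 where f1: "f1 \<in> convergent_series" "\<sigma> f1 = g"
      by (metis imageE)
    then have "f1 = f'"
      unfolding f'_def by (auto simp: \<sigma>_def yshear_inverse[OF cut(1)] xshear_inverse[OF cut(5)])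
    then show ?thesis
      using f1 by simp
  qed
  have "wt_ge 1 1 N (h - \<sigma> f)"
  proof -
    have "wt_ge 1 1 N (xshear \<psi> (yshear \<phi> f) - xshear \<psi>' (yshear \<phi> f))"
      by (intro wt_ge_xshear_diff cut \<phi>\<psi>)
    moreover have "wt_ge 1 1 N (xshear \<psi>' (yshear \<phi> f) - xshear \<psi>' (yshear \<phi>' f))"
      unfolding xshear_diff[symmetric] by (intro wt_ge_11_xshear wt_ge_yshear_diff cut \<phi>\<psi>)
    ultimately show ?thesis
      unfolding h_def \<sigma>_def by (rule wt_ge_diff_trans)
  qed
  with hg have "wt_ge 1 1 N (g - \<sigma> f)"
    by (rule wt_ge_diff_trans)
  then have "wt_ge 1 1 N (yshear (- \<phi>') (xshear (- \<psi>') (g - \<sigma> f)))"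
    using cut(1,5) by (intro wt_ge_11_yshear wt_ge_11_xshear) simp_all
  also have "yshear (- \<phi>') (xshear (- \<psi>') (g - \<sigma> f)) = f' - f"
    by (simp add: xshear_diff yshear_diff f'_def \<sigma>_def yshear_inverse[OF cut(1)] xshear_inverse[OF cut(5)])
  finally have "wt_ge 1 1 (4 * K + 2) (f' - f)"
    by (simp add: N_def)
  note fin_det = finite_determinacy[OF f f' this]
  obtain \<alpha> \<beta> where 1: "X2 ^ K = \<alpha> * deriv_x f + \<beta> * deriv_y f" "\<alpha> \<in> convergent_series" "\<beta> \<in> convergent_series"
    using J(1) by (auto simp: conv_ideal_def)
  obtain \<gamma> \<delta> where 2: "Y2 ^ K = \<gamma> * deriv_x f + \<delta> * deriv_y f" "\<gamma> \<in> convergent_series" "\<delta> \<in> convergent_series"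
    using J(2) by (auto simp: conv_ideal_def)
  have "right_equivalent f f'"
    by (rule fin_det[OF 1(1) 2(1) 1(2,3) 2(2,3)])
  moreover have "right_equivalent f' g"
    unfolding right_equivalent_def using f' g \<sigma> \<sigma>f' by (intro conjI exI[of _ \<sigma>])
  ultimately have "right_equivalent f g"
    by (rule right_equivalent_trans)
  moreover have "normalised_compact_facets g"
    unfolding g_def using K0[of M] by (intro normal_imp_normalised_compact_facets) (simp_all add: M_def)
  moreover obtain p where "series_of_poly p = g"
    using ex_poly_box_part unfolding g_def by blast
  ultimately show "\<exists>g. right_equivalent f (series_of_poly g) \<and> normalised_compact_facets (series_of_poly g)"
    by blast
qed

end
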